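(* Let $(F,R_\bullet)$ be an invisible matter causal graph dynamics (IMCGD) over $\mathcal{Y}$ which is invertible, i.e. $F:\mathcal{Y}\to\mathcal{Y}$ is a bijection. Then $(F^{-1},S_\bullet)$, where $S_Y=(R_{F^{-1}(Y)})^{-1}$ for every $Y\in\mathcal{Y}$, is an IMCGD.
   Context: Fix finite sets $\pi$ (ports), $\Sigma$ (vertex labels), $\Delta$ (edge labels). A graph has an at most countable vertex set and edges $\{u:a,v:b\}$ (unordered, $a,b$ ports), each vertex–port pair in at most one edge, partial labels on vertices (in $\Sigma$) and edges (in $\Delta$), and is connected. A pointed graph modulo is an isomorphism class of pointed graphs (renamings of vertices preserving edges, ports, labels and pointer); $\mathcal{X}_{\Sigma,\Delta,\pi}$ is their set. In a pointed graph modulo $X$, vertices are designated by paths: words of port pairs $ab$ ("leave by port $a$, arrive by port $b$") from the pointer, identified when they reach the same vertex; $V(X)$ is the vertex set, $\varepsilon$ the pointer, "." concatenation. $X_u$ is $X$ re-pointed at $u$. The disk $X^r$ is the pointed graph modulo of the subgraph induced by vertices at distance $\le r+1$ from the pointer, keeping labels only on vertices at distance $\le r$ and edges between them. A dynamics $(F,R_\bullet)$ over a set $\mathcal{S}$ of pointed graphs modulo is $F:\mathcal{S}\to\mathcal{S}$ with maps $R_X:V(X)\to V(F(X))$. Continuous: for every $X,m$ there is $n$ with $F(X)^m=F(X^n)^m$, $\mathrm{dom}\,R_X^m\subseteq V(X^n)$, $R_X^m=R_{X^n}^m$ ($R_X^m$ = restriction of $R_X$ to vertices mapped into $F(X)^m$).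 Shift-invariant: $F(X_u)=F(X)_{R_X(u)}$ and $R_X(u.v)=R_X(u).R_{X_u}(v)$ for all $X$, $u\in V(X)$, $v\in V(X_u)$. Bounded: there is $b$ such that for all $X$, $w'\in V(F(X))$ there are $u'\in\mathrm{Im}R_X$, $v'\in V(F(X)_{u'}^b)$ with $w'=u'.v'$. A CGD is a continuous, shift-invariant, bounded dynamics. Invisible matter: assume $m\notin\Sigma$ and $m,l,r\notin\pi$; let $\mathcal{X}'=\mathcal{X}_{\Sigma\cup\{m\},\Delta,\pi\cup\{m,l,r\}}$. Let $T$ be the infinite rooted binary tree, all vertices labelled $m$, each vertex connected through its port $l$ (resp. $r$) to port $m$ of its left (resp. right) child, pointed at the root (so the children are reached by paths $lm$, $rm$). Each $X\in\mathcal{X}_{\Sigma,\Delta,\pi}$ is identified with the element of $\mathcal{X}'$ obtained by attaching to every vertex $v$ a copy of $T$ whose root's port $m$ is connected to port $m$ of $v$ (root reached from $v$ by path $mm$). $\mathcal{Y}$ is the set of all such graphs with the pointer at any of their vertices. Vertices of the attached trees are invisible, the others visible. For $s\in\{lm,rm\}^*$, $X_{\bullet s}$ denotes $X_{mm.s}$. A dynamics $(F,R_\bullet)$ over $\mathcal{Y}$ is invisible matter quiescent if there is $b$ such that for all $X\in\mathcal{X}_{\Sigma,\Delta,\pi}$, all $s\in\{lm,rm\}^*$ with $|s|\ge b$ and all $t\in\{lm,rm\}^*$, $R_{X_{\bullet s}}(t)=t$; it is vertex-preserving if every $R_Y$ is bijective. An IMCGD is a CGD over $\mathcal{Y}$ which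 is vertex-preserving and invisible matter quiescent.
   Formalization: Disks X^n of graphs in 𝒴 are not in 𝒴, so F(X^n) and R_{X^n} are undefined; continuity is read as: for every X, m there is n such that every Y in 𝒴 with Y^n = X^n has F(Y)^m = F(X)^m, dom R_Y^m within V(Y^n), and R_Y^m = R_X^m. *)

theory Defs
  imports Main "HOL-Library.Countable_Set" "HOL-Library.FuncSet"
begin

text \<open>The edge \<open>{u:a, v:b}\<close> is the set \<open>{(u, a), (v, b)}\<close> of two vertex-port pairs.\<close>

record ('v, 'p, 's, 'd) pgraph =
  verts :: "'v set"
  edges :: "('v \<times> 'p) set set"
  vlab :: "'v \<Rightarrow> 's option"
  elab :: "('v \<times> 'p) set \<Rightarrow> 'd option"
  pointer :: "'v"

text \<open>The letter \<open>(a, b)\<close> of a word stands for the step ``leave by port \<open>a\<close>, arrive by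
  port \<open>b\<close>''.\<close>

type_synonym 'p word = "('p \<times> 'p) list"

fun walk :: "('v, 'p, 's, 'd) pgraph \<Rightarrow> 'v \<Rightarrow> 'p word \<Rightarrow> 'v \<Rightarrow> bool" where
  "walk G u [] v \<longleftrightarrow> u = v"
| "walk G u ((a, b) # w) v \<longleftrightarrow> (\<exists>x. {(u, a), (x, b)} \<in> edges G \<and> walk G x w v)"

definition pointed_graph :: "('v, 'p, 's, 'd) pgraph \<Rightarrow> bool" where
  "pointed_graph G \<longleftrightarrow>
     countable (verts G) \<and>
     (\<forall>e\<in>edges G. card e = 2 \<and> fst ` e \<subseteq> verts G) \<and>
     pairwise disjnt (edges G) \<and>
     dom (vlab G) \<subseteq> verts G \<and>
     dom (elab G) \<subseteq> edges G \<and>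
     (\<forall>u\<in>verts G. \<forall>v\<in>verts G. \<exists>w. walk G u w v) \<and>
     pointer G \<in> verts G"

definition pointed_graph_over ::
  "'s set \<Rightarrow> 'd set \<Rightarrow> 'p set \<Rightarrow> ('v, 'p, 's, 'd) pgraph \<Rightarrow> bool" where
  "pointed_graph_over \<Sigma> \<Delta> \<pi> G \<longleftrightarrow>
     pointed_graph G \<and> (\<forall>e\<in>edges G. snd ` e \<subseteq> \<pi>) \<and> ran (vlab G) \<subseteq> \<Sigma> \<and> ran (elab G) \<subseteq> \<Delta>"

definition isomorphic ::
  "('v, 'p, 's, 'd) pgraph \<Rightarrow> ('w, 'p, 's, 'd) pgraph \<Rightarrow> bool" where
  "isomorphic G H \<longleftrightarrow>
     (\<exists>f. bij_betw f (verts G) (verts H) \<and>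
          edges H = (\<lambda>e. map_prod f id ` e) ` edges G \<and>
          (\<forall>v\<in>verts G. vlab H (f v) = vlab G v) \<and>
          (\<forall>e\<in>edges G. elab H (map_prod f id ` e) = elab G e) \<and>
          pointer H = f (pointer G))"

definition ball_of :: "('v, 'p, 's, 'd) pgraph \<Rightarrow> nat \<Rightarrow> 'v set" where
  "ball_of G k = {v. \<exists>w. length w \<le> k \<and> walk G (pointer G) w v}"

definition disk_graph :: "nat \<Rightarrow> ('v, 'p, 's, 'd) pgraph \<Rightarrow> ('v, 'p, 's, 'd) pgraph" where
  "disk_graph r G =
     \<lparr>verts = ball_of G (r + 1),
      edges = {e \<in> edges G. fst ` e \<subseteq> ball_of G (r + 1)},
      vlab = vlab G |` ball_of G r,
      elab = elab G |` {e. fst ` e \<subseteq> ball_of G r},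
      pointer = pointer G\<rparr>"

text \<open>Every graph is countable, so an isomorphism class is faithfully represented by its members
  with vertices in \<open>nat\<close>. Operations on graphs modulo are taken over all representatives; they do
  not depend on the representative.\<close>

type_synonym ('p, 's, 'd) graph_mod = "(nat, 'p, 's, 'd) pgraph set"

definition modulo :: "('v, 'p, 's, 'd) pgraph \<Rightarrow> ('p, 's, 'd) graph_mod" where
  "modulo G = {H. pointed_graph H \<and> isomorphic G H}"

definition graphs_modulo :: "'s set \<Rightarrow> 'd set \<Rightarrow> 'p set \<Rightarrow> ('p, 's, 'd) graph_mod set" where
  "graphs_modulo \<Sigma> \<Delta> \<pi> = {modulo G | G :: (nat, 'p, 's, 'd) pgraph. pointed_graph_over \<Sigma> \<Delta> \<pi> G}"

definition paths :: "('p, 's, 'd) graph_mod \<Rightarrow> 'p word set" where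
  "paths X = {w. \<exists>G\<in>X. \<exists>v. walk G (pointer G) w v}"

text \<open>A vertex of \<open>X\<close> is the set of all paths that reach it from the pointer; \<open>vert X w\<close> is the
  vertex reached by \<open>w\<close>.\<close>

type_synonym 'p vertex = "'p word set"

definition vert :: "('p, 's, 'd) graph_mod \<Rightarrow> 'p word \<Rightarrow> 'p vertex" where
  "vert X w = {w'. \<exists>G\<in>X. \<exists>v. walk G (pointer G) w v \<and> walk G (pointer G) w' v}"

definition V :: "('p, 's, 'd) graph_mod \<Rightarrow> 'p vertex set" where
  "V X = vert X ` paths X"

definition shift :: "('p, 's, 'd) graph_mod \<Rightarrow> 'p vertex \<Rightarrow> ('p, 's, 'd) graph_mod" where
  "shift X u = \<Union>{modulo (G\<lparr>pointer := v\<rparr>) | G v. G \<in> X \<and> (\<exists>w\<in>u. walk G (pointer G) w v)}"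

text \<open>The vertex \<open>u.v\<close> of \<open>X\<close>, for \<open>u\<close> a vertex of \<open>X\<close> and \<open>v\<close> a vertex of \<open>shift X u\<close> or
  of a disk of it.\<close>

definition conc :: "('p, 's, 'd) graph_mod \<Rightarrow> 'p vertex \<Rightarrow> 'p vertex \<Rightarrow> 'p vertex" where
  "conc X u v = \<Union>{vert X (p @ q) | p q. p \<in> u \<and> q \<in> v}"

definition disk :: "nat \<Rightarrow> ('p, 's, 'd) graph_mod \<Rightarrow> ('p, 's, 'd) graph_mod" where
  "disk r X = (\<Union>G\<in>X. modulo (disk_graph r G))"

text \<open>As sets of paths, the vertices of a disk of \<open>X\<close> are not literally vertices of \<open>X\<close>, since
  only paths inside the disk remain: the vertex \<open>u\<close> of \<open>X\<close> becomes \<open>u \<inter> paths (disk r X)\<close>.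
  \<open>disk_V r X\<close> is the set of those vertices of \<open>X\<close> that lie in the disk.\<close>

definition disk_V :: "nat \<Rightarrow> ('p, 's, 'd) graph_mod \<Rightarrow> 'p vertex set" where
  "disk_V r X = vert X ` paths (disk r X)"

type_synonym ('p, 's, 'd) gmap = "('p, 's, 'd) graph_mod \<Rightarrow> ('p, 's, 'd) graph_mod"
type_synonym ('p, 's, 'd) vmap = "('p, 's, 'd) graph_mod \<Rightarrow> 'p vertex \<Rightarrow> 'p vertex"

definition dynamics ::
  "('p, 's, 'd) graph_mod set \<Rightarrow> ('p, 's, 'd) gmap \<Rightarrow> ('p, 's, 'd) vmap \<Rightarrow> bool" where
  "dynamics S F R \<longleftrightarrow> F \<in> S \<rightarrow> S \<and> (\<forall>X\<in>S. R X \<in> V X \<rightarrow> V (F X))"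

text \<open>The restriction of \<open>R X\<close> to the vertices mapped into \<open>disk m (F X)\<close> is usually written
  \<open>R\<^sup>m\<close>; this is its domain.\<close>

definition dom_restr ::
  "('p, 's, 'd) gmap \<Rightarrow> ('p, 's, 'd) vmap \<Rightarrow> nat \<Rightarrow> ('p, 's, 'd) graph_mod \<Rightarrow> 'p vertex set" where
  "dom_restr F R m X = {u \<in> V X. R X u \<in> disk_V m (F X)}"

text \<open>A set \<open>S\<close> of graphs need not contain the disks of its members (\<open>im_graphs\<close> below
  contains none), so \<open>F\<close> is compared on \<open>X\<close> and on all \<open>Y\<close> in \<open>S\<close> that have the same disk as \<open>X\<close>,
  rather than on \<open>X\<close> and its disk; if \<open>disk n X\<close> is in \<open>S\<close>, it is one such \<open>Y\<close>.
  The last two conjuncts say that the restrictions of \<open>R X\<close> and \<open>R Y\<close> agree as partial functions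
  from the vertices of \<open>disk n X\<close> to the vertices of \<open>disk m (F X)\<close>; for a vertex outside the
  domain the intersection is empty.\<close>

definition continuous_dynamics ::
  "('p, 's, 'd) graph_mod set \<Rightarrow> ('p, 's, 'd) gmap \<Rightarrow> ('p, 's, 'd) vmap \<Rightarrow> bool" where
  "continuous_dynamics S F R \<longleftrightarrow>
     (\<forall>X\<in>S. \<forall>m. \<exists>n.
        dom_restr F R m X \<subseteq> disk_V n X \<and>
        (\<forall>Y\<in>S. disk n Y = disk n X \<longrightarrow>
           disk m (F Y) = disk m (F X) \<and>
           dom_restr F R m Y \<subseteq> disk_V n Y \<and>
           (\<forall>w\<in>paths (disk n X).
              R Y (vert Y w) \<inter> paths (disk m (F Y)) = R X (vert X w) \<inter> paths (disk m (F X)))))"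

definition shift_invariant ::
  "('p, 's, 'd) graph_mod set \<Rightarrow> ('p, 's, 'd) gmap \<Rightarrow> ('p, 's, 'd) vmap \<Rightarrow> bool" where
  "shift_invariant S F R \<longleftrightarrow>
     (\<forall>X\<in>S. \<forall>u\<in>V X.
        F (shift X u) = shift (F X) (R X u) \<and>
        (\<forall>v\<in>V (shift X u). R X (conc X u v) = conc (F X) (R X u) (R (shift X u) v)))"

definition bounded_dynamics ::
  "('p, 's, 'd) graph_mod set \<Rightarrow> ('p, 's, 'd) gmap \<Rightarrow> ('p, 's, 'd) vmap \<Rightarrow> bool" where
  "bounded_dynamics S F R \<longleftrightarrow>
     (\<exists>b. \<forall>X\<in>S. \<forall>w\<in>V (F X). \<exists>u\<in>R X ` V X. \<exists>v\<in>V (disk b (shift (F X) u)). w = conc (F X) u v)"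

definition CGD ::
  "('p, 's, 'd) graph_mod set \<Rightarrow> ('p, 's, 'd) gmap \<Rightarrow> ('p, 's, 'd) vmap \<Rightarrow> bool" where
  "CGD S F R \<longleftrightarrow>
     dynamics S F R \<and> continuous_dynamics S F R \<and> shift_invariant S F R \<and> bounded_dynamics S F R"

text \<open>Throughout, \<open>\<mu>\<close> is the vertex label and \<open>m\<close> the port of invisible matter (the same symbol
  in the mathematics, but labels and ports have different types here).
  The vertices of the binary tree are named by their paths from the root.\<close>

definition matter_tree :: "'s \<Rightarrow> 'p \<Rightarrow> 'p \<Rightarrow> 'p \<Rightarrow> ('p word, 'p, 's, 'd) pgraph" where
  "matter_tree \<mu> m l r =
     \<lparr>verts = lists {(l, m), (r, m)},
      edges = {{(s, a), (s @ [(a, m)], m)} | s a. s \<in> lists {(l, m), (r, m)} \<and> a \<in> {l, r}},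
      vlab = (\<lambda>s. if s \<in> lists {(l, m), (r, m)} then Some \<mu> else None),
      elab = (\<lambda>e. None),
      pointer = []\<rparr>"

text \<open>\<open>Inv v s\<close> is the vertex \<open>s\<close> of the copy of the tree attached to \<open>v\<close>.\<close>

datatype ('v, 'p) im_vertex = Vis 'v | Inv 'v "'p word"

definition attach_graph ::
  "'s \<Rightarrow> 'p \<Rightarrow> 'p \<Rightarrow> 'p \<Rightarrow> ('v, 'p, 's, 'd) pgraph \<Rightarrow> (('v, 'p) im_vertex, 'p, 's, 'd) pgraph" where
  "attach_graph \<mu> m l r G =
     (let T = matter_tree \<mu> m l r :: ('p word, 'p, 's, 'd) pgraph;
          vis = (\<lambda>e. map_prod Vis id ` e)
      in
     \<lparr>verts = Vis ` verts G \<union> {Inv v s | v s. v \<in> verts G \<and> s \<in> verts T},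
      edges = vis ` edges G
        \<union> {{(Vis v, m), (Inv v (pointer T), m)} | v. v \<in> verts G}
        \<union> {map_prod (Inv v) id ` e | v e. v \<in> verts G \<and> e \<in> edges T},
      vlab = (\<lambda>x. case x of Vis v \<Rightarrow> vlab G v | Inv v s \<Rightarrow> if v \<in> verts G then vlab T s else None),
      elab = (\<lambda>e. if e \<in> vis ` edges G then elab G (map_prod Vis id -` e) else None),
      pointer = Vis (pointer G)\<rparr>)"

definition attach ::
  "'s \<Rightarrow> 'p \<Rightarrow> 'p \<Rightarrow> 'p \<Rightarrow> ('p, 's, 'd) graph_mod \<Rightarrow> ('p, 's, 'd) graph_mod" where
  "attach \<mu> m l r X = (\<Union>G\<in>X. modulo (attach_graph \<mu> m l r G))"

definition im_graphs ::
  "'s set \<Rightarrow> 'd set \<Rightarrow> 'p set \<Rightarrow> 's \<Rightarrow> 'p \<Rightarrow> 'p \<Rightarrow> 'p \<Rightarrow> ('p, 's, 'd) graph_mod set" where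
  "im_graphs \<Sigma> \<Delta> \<pi> \<mu> m l r =
     {shift (attach \<mu> m l r X) u | X u. X \<in> graphs_modulo \<Sigma> \<Delta> \<pi> \<and> u \<in> V (attach \<mu> m l r X)}"

text \<open>Usually written \<open>X\<close> with subscript \<open>\<bullet>s\<close>.\<close>

definition im_shift ::
  "'s \<Rightarrow> 'p \<Rightarrow> 'p \<Rightarrow> 'p \<Rightarrow> ('p, 's, 'd) graph_mod \<Rightarrow> 'p word \<Rightarrow> ('p, 's, 'd) graph_mod" where
  "im_shift \<mu> m l r X s = shift (attach \<mu> m l r X) (vert (attach \<mu> m l r X) ((m, m) # s))"

definition im_quiescent ::
  "'s set \<Rightarrow> 'd set \<Rightarrow> 'p set \<Rightarrow> 's \<Rightarrow> 'p \<Rightarrow> 'p \<Rightarrow> 'p \<Rightarrow>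
   ('p, 's, 'd) gmap \<Rightarrow> ('p, 's, 'd) vmap \<Rightarrow> bool" where
  "im_quiescent \<Sigma> \<Delta> \<pi> \<mu> m l r F R \<longleftrightarrow>
     (\<exists>b. \<forall>X\<in>graphs_modulo \<Sigma> \<Delta> \<pi>.
        \<forall>s\<in>lists {(l, m), (r, m)}. \<forall>t\<in>lists {(l, m), (r, m)}. b \<le> length s \<longrightarrow>
          (let Y = im_shift \<mu> m l r X s in t \<in> paths (F Y) \<and> R Y (vert Y t) = vert (F Y) t))"

definition vertex_preserving ::
  "('p, 's, 'd) graph_mod set \<Rightarrow> ('p, 's, 'd) gmap \<Rightarrow> ('p, 's, 'd) vmap \<Rightarrow> bool" where
  "vertex_preserving S F R \<longleftrightarrow> (\<forall>X\<in>S. bij_betw (R X) (V X) (V (F X)))"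

definition IMCGD ::
  "'s set \<Rightarrow> 'd set \<Rightarrow> 'p set \<Rightarrow> 's \<Rightarrow> 'p \<Rightarrow> 'p \<Rightarrow> 'p \<Rightarrow>
   ('p, 's, 'd) gmap \<Rightarrow> ('p, 's, 'd) vmap \<Rightarrow> bool" where
  "IMCGD \<Sigma> \<Delta> \<pi> \<mu> m l r F R \<longleftrightarrow>
     CGD (im_graphs \<Sigma> \<Delta> \<pi> \<mu> m l r) F R \<and>
     vertex_preserving (im_graphs \<Sigma> \<Delta> \<pi> \<mu> m l r) F R \<and>
     im_quiescent \<Sigma> \<Delta> \<pi> \<mu> m l r F R"

end

theory Submission
  imports Defs "HOL-Library.Diagonal_Subsequence"
begin

text \<open>Everything but continuity and quiescence of the inverse is immediate from bijectivity of \<open>F\<close>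
  and of all \<open>R X\<close>. The space \<open>\<Y>\<close> is not compact, because pointers can sink into the trees, but
  its elements with pointer at bounded depth form a sequentially compact set, and the depth of the
  pointer is a locally constant function. Hence the image under \<open>F\<close> of a pointer at depth below
  \<open>b\<close> has bounded depth, that is, a deep pointer of \<open>F X\<close> comes from a deep pointer of \<open>X\<close>;
  this gives quiescence of the inverse. Conversely, quiescence of \<open>F\<close> implies that \<open>F\<close> decreases
  depth by at most a constant. So if \<open>Y\<^sub>n\<close> converges to \<open>Y\<close>, the preimages of the \<open>Y\<^sub>n\<close> stay at
  bounded depth, and each of their limit points is mapped to \<open>Y\<close> by continuity of \<open>F\<close>, so it is the
  preimage of \<open>Y\<close>.\<close>

section \<open>Walks and isomorphisms\<close>

text \<open>A graph modulo has no vertices of its own, only words, and \<open>im_graphs\<close> is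
  not closed under taking disks. Compactness is therefore carried out on representatives: base
  graphs converge in the form of partial isomorphisms between balls, and these extend to the
  infinite trees attached afterwards. Depth becomes a local quantity through a certificate: every
  element of \<open>im_graphs\<close> has a path that climbs by port \<open>m\<close> and ends with
  the letter \<open>(m, m)\<close>. Such a path is visible in a disk, and its length bounds the
  depth of the pointer. Compactness controls only the graphs. The vertex maps are treated last: a
  disk of the preimage has finitely many vertices, their images under \<open>R\<close> fit into some
  disk of the image, and continuity of \<open>F\<close> at that radius fixes them, and with them the
  inverse map.\<close>

lemma walk_append:
  "walk G u (w @ w') v \<longleftrightarrow> (\<exists>x. walk G u w x \<and> walk G x w' v)"
  by (induction G u w v rule: walk.induct) auto

lemma walk_rev:
  "walk G u w v \<Longrightarrow> walk G v (rev (map prod.swap w)) u"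
  by (induction G u w v rule: walk.induct) (auto simp: walk_append insert_commute)

lemma walk_pointer_update [simp]: "walk (G\<lparr>pointer := x\<rparr>) u w v \<longleftrightarrow> walk G u w v"
  by (induction w arbitrary: u) auto

lemma edge_cases:
  assumes "pointed_graph G" "e \<in> edges G"
  obtains u a v b where "e = {(u, a), (v, b)}" "(u, a) \<noteq> (v, b)" "u \<in> verts G" "v \<in> verts G"
proof -
  have "card e = 2" "fst ` e \<subseteq> verts G"
    using assms unfolding pointed_graph_def by blast+
  then obtain x y where "e = {x, y}" "x \<noteq> y"
    by (auto simp: card_2_iff)
  with \<open>fst ` e \<subseteq> verts G\<close> that[of "fst x" "snd x" "fst y" "snd y"] show ?thesis
    by auto
qed

lemma edge_verts:
  assumes "pointed_graph G" "{(u, a), (v, b)} \<in> edges G"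
  shows "u \<in> verts G" "v \<in> verts G" "(u, a) \<noteq> (v, b)"
proof -
  have "card {(u, a), (v, b)} = 2" "fst ` {(u, a), (v, b)} \<subseteq> verts G"
    using assms unfolding pointed_graph_def by blast+
  then show "u \<in> verts G" "v \<in> verts G" "(u, a) \<noteq> (v, b)"
    by (auto split: if_splits)
qed

lemma edge_unique:
  assumes "pointed_graph G" "{(u, a), (v, b)} \<in> edges G" "{(u, a), (v', b')} \<in> edges G"
  shows "v' = v" "b' = b"
proof -
  have "pairwise disjnt (edges G)" using assms(1) by (simp add: pointed_graph_def)
  moreover have "\<not> disjnt {(u, a), (v, b)} {(u, a), (v', b')}" by simp
  ultimately have "{(u, a), (v, b)} = {(u, a), (v', b')}"
    using assms(2,3) pairwiseD by metis
  moreover have "(u, a) \<noteq> (v, b)" "(u, a) \<noteq> (v', b')"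
    using assms edge_verts by metis+
  ultimately show "v' = v" "b' = b"
    by (auto simp: doubleton_eq_iff)
qed

text \<open>A letter names the port of departure, and a vertex-port pair lies in at most one edge.
  This is what allows words to serve as names of vertices.\<close>

lemma walk_det:
  assumes "pointed_graph G"
  shows "walk G u w v \<Longrightarrow> walk G u w v' \<Longrightarrow> v' = v"
proof (induction w arbitrary: u)
  case (Cons ab w)
  obtain a b where ab: "ab = (a, b)" by (cases ab)
  from Cons.prems ab obtain x x' where
    "{(u, a), (x, b)} \<in> edges G" "walk G x w v" "{(u, a), (x', b)} \<in> edges G" "walk G x' w v'"
    by auto
  with edge_unique[OF assms] Cons.IH show ?case by metis
qed auto

lemma walk_verts:
  assumes "pointed_graph G"
  shows "walk G u w v \<Longrightarrow> u \<in> verts G \<Longrightarrow> v \<in> verts G"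
proof (induction w arbitrary: u)
  case (Cons ab w)
  then show ?case
    using edge_verts[OF assms] by (cases ab) auto
qed auto

lemma pointer_verts: "pointed_graph G \<Longrightarrow> pointer G \<in> verts G"
  by (simp add: pointed_graph_def)

lemma verts_reachable:
  "pointed_graph G \<Longrightarrow> v \<in> verts G \<Longrightarrow> \<exists>w. walk G (pointer G) w v"
  by (simp add: pointed_graph_def)

lemma pointed_graph_repoint:
  "pointed_graph G \<Longrightarrow> v \<in> verts G \<Longrightarrow> pointed_graph (G\<lparr>pointer := v\<rparr>)"
  by (simp add: pointed_graph_def)

text \<open>Up to isomorphism a pointed graph is determined by the following three functions of words,
  and convergence of graphs is pointwise convergence of these functions.\<close>

definition same :: "('v, 'p, 's, 'd) pgraph \<Rightarrow> 'p word \<Rightarrow> 'p word \<Rightarrow> bool" where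
  "same G w w' \<longleftrightarrow> (\<exists>v. walk G (pointer G) w v \<and> walk G (pointer G) w' v)"

definition vlabs :: "('v, 'p, 's, 'd) pgraph \<Rightarrow> 'p word \<Rightarrow> 's option set" where
  "vlabs G w = {vlab G v | v. walk G (pointer G) w v}"

definition elabs :: "('v, 'p, 's, 'd) pgraph \<Rightarrow> 'p word \<Rightarrow> 'p \<Rightarrow> 'p \<Rightarrow> 'd option set" where
  "elabs G w a b =
     {elab G {(u, a), (v, b)} | u v. walk G (pointer G) w u \<and> {(u, a), (v, b)} \<in> edges G}"

lemma same_refl_iff: "same G w w \<longleftrightarrow> (\<exists>v. walk G (pointer G) w v)"
  by (auto simp: same_def)

lemma same_sym: "same G w w' \<Longrightarrow> same G w' w"
  by (auto simp: same_def)

lemma same_trans: "pointed_graph G \<Longrightarrow> same G w w' \<Longrightarrow> same G w' w'' \<Longrightarrow> same G w w''"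
  unfolding same_def by (metis walk_det)

lemma same_walk:
  "pointed_graph G \<Longrightarrow> walk G (pointer G) w v \<Longrightarrow> same G w w' \<longleftrightarrow> walk G (pointer G) w' v"
  unfolding same_def by (metis walk_det)

text \<open>An isomorphism between the subgraphs induced on \<open>A\<close> and on its image,
  expressed through endpoints instead of edge sets. With \<open>A\<close> all of
  \<open>verts G\<close> it describes isomorphisms; with \<open>A\<close> containing a ball it
  yields isomorphic disks.\<close>

definition agree_on ::
  "'v set \<Rightarrow> ('v \<Rightarrow> 'w) \<Rightarrow> ('v, 'p, 's, 'd) pgraph \<Rightarrow> ('w, 'p, 's, 'd) pgraph \<Rightarrow> bool" where
  "agree_on A f G H \<longleftrightarrow>
     inj_on f A \<and>
     (\<forall>u\<in>A. vlab H (f u) = vlab G u) \<and>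
     (\<forall>u\<in>A. \<forall>v\<in>A. \<forall>a b.
        ({(f u, a), (f v, b)} \<in> edges H \<longleftrightarrow> {(u, a), (v, b)} \<in> edges G) \<and>
        ({(u, a), (v, b)} \<in> edges G \<longrightarrow>
           elab H {(f u, a), (f v, b)} = elab G {(u, a), (v, b)}))"

lemma agree_on_edge:
  "agree_on A f G H \<Longrightarrow> u \<in> A \<Longrightarrow> v \<in> A \<Longrightarrow>
     {(f u, a), (f v, b)} \<in> edges H \<longleftrightarrow> {(u, a), (v, b)} \<in> edges G"
  by (simp add: agree_on_def)

lemma agree_on_inv:
  assumes "agree_on A f G H"
  shows "agree_on (f ` A) (inv_into A f) H G"
proof -
  have "inj_on f A" using assms by (simp add: agree_on_def)
  then show ?thesis
    using assms unfolding agree_on_def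
    by (auto simp: inv_into_f_f inj_on_inv_into)
qed

lemma agree_on_comp:
  assumes "agree_on A f G H" "agree_on (f ` A) g H K"
  shows "agree_on A (g \<circ> f) G K"
  using assms unfolding agree_on_def by (auto intro: comp_inj_on)

lemma isomorphicI:
  assumes G: "pointed_graph G" and H: "pointed_graph H"
    and f: "agree_on (verts G) f G H" "f ` verts G = verts H" "f (pointer G) = pointer H"
  shows "isomorphic G H"
  unfolding isomorphic_def
proof (intro exI conjI ballI)
  show "bij_betw f (verts G) (verts H)"
    using f by (simp add: agree_on_def bij_betw_def)
  have fwd: "map_prod f id ` e \<in> edges H \<and> elab H (map_prod f id ` e) = elab G e"
    if "e \<in> edges G" for e
    using edge_cases[OF G that] f(1) that unfolding agree_on_def
    by (smt (verit) id_apply image_empty image_insert map_prod_simp)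
  then show "\<And>e. e \<in> edges G \<Longrightarrow> elab H (map_prod f id ` e) = elab G e" by simp
  show "edges H = (\<lambda>e. map_prod f id ` e) ` edges G"
  proof
    show "edges H \<subseteq> (\<lambda>e. map_prod f id ` e) ` edges G"
    proof
      fix e assume e: "e \<in> edges H"
      obtain u a v b where "e = {(u, a), (v, b)}" "u \<in> verts H" "v \<in> verts H"
        using edge_cases[OF H e] by metis
      moreover then obtain u' v' where "u = f u'" "v = f v'" "u' \<in> verts G" "v' \<in> verts G"
        using f(2) by blast
      ultimately show "e \<in> (\<lambda>e. map_prod f id ` e) ` edges G"
        using e agree_on_edge[OF f(1)] by (intro image_eqI[of _ _ "{(u', a), (v', b)}"]) auto
    qed
  qed (use fwd in auto)
  show "\<And>v. v \<in> verts G \<Longrightarrow> vlab H (f v) = vlab G v"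
    using f(1) by (simp add: agree_on_def)
  show "pointer H = f (pointer G)" using f(3) by simp
qed

lemma isomorphicE:
  assumes G: "pointed_graph G" and iso: "isomorphic G H"
  obtains f where "agree_on (verts G) f G H" "f ` verts G = verts H" "f (pointer G) = pointer H"
proof -
  obtain f where f: "bij_betw f (verts G) (verts H)"
      "edges H = (\<lambda>e. map_prod f id ` e) ` edges G"
      "\<forall>v\<in>verts G. vlab H (f v) = vlab G v"
      "\<forall>e\<in>edges G. elab H (map_prod f id ` e) = elab G e"
      "pointer H = f (pointer G)"
    using iso unfolding isomorphic_def by blast
  have inj: "inj_on f (verts G)" using f(1) by (simp add: bij_betw_def)
  have "{(f u, a), (f v, b)} \<in> edges H \<longleftrightarrow> {(u, a), (v, b)} \<in> edges G"
    if uv: "u \<in> verts G" "v \<in> verts G" for u v a b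
  proof
    assume "{(f u, a), (f v, b)} \<in> edges H"
    then obtain e where e: "e \<in> edges G" "{(f u, a), (f v, b)} = map_prod f id ` e"
      using f(2) by auto
    obtain x c y d where "e = {(x, c), (y, d)}" "x \<in> verts G" "y \<in> verts G"
      using edge_cases[OF G e(1)] by metis
    with e(2) uv have "e = {(u, a), (v, b)}"
      using inj_onD[OF inj] by (auto simp: doubleton_eq_iff)
    with e(1) show "{(u, a), (v, b)} \<in> edges G" by simp
  next
    assume "{(u, a), (v, b)} \<in> edges G"
    then have "map_prod f id ` {(u, a), (v, b)} \<in> edges H" using f(2) by blast
    then show "{(f u, a), (f v, b)} \<in> edges H" by simp
  qed
  moreover have "elab H {(f u, a), (f v, b)} = elab G {(u, a), (v, b)}"
    if "{(u, a), (v, b)} \<in> edges G" for u v a b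
    using f(4) that by force
  ultimately have "agree_on (verts G) f G H"
    using inj f(3) unfolding agree_on_def by blast
  then show ?thesis using that f(1,5) by (simp add: bij_betw_def)
qed

lemma isomorphic_sym:
  assumes G: "pointed_graph G" and H: "pointed_graph H" and "isomorphic G H"
  shows "isomorphic H G"
proof -
  obtain f where f: "agree_on (verts G) f G H" "f ` verts G = verts H" "f (pointer G) = pointer H"
    using isomorphicE[OF G assms(3)] .
  then have "inj_on f (verts G)" by (simp add: agree_on_def)
  with f G show ?thesis
    using agree_on_inv[OF f(1)]
    by (intro isomorphicI[OF H G, of "inv_into (verts G) f"])
      (auto simp: pointer_verts inj_on_imp_bij_betw bij_betw_imp_surj_on bij_betw_inv_into
        simp flip: f(2,3))
qed

lemma isomorphic_trans:
  assumes G: "pointed_graph G" and H: "pointed_graph H" and K: "pointed_graph K"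
    and "isomorphic G H" "isomorphic H K"
  shows "isomorphic G K"
proof -
  obtain f where f: "agree_on (verts G) f G H" "f ` verts G = verts H" "f (pointer G) = pointer H"
    using isomorphicE[OF G assms(4)] .
  obtain g where g: "agree_on (verts H) g H K" "g ` verts H = verts K" "g (pointer H) = pointer K"
    using isomorphicE[OF H assms(5)] .
  show ?thesis
    using f g agree_on_comp[OF f(1), of g K] image_comp[of g f "verts G"]
    by (intro isomorphicI[OF G K, of "g \<circ> f"]) auto
qed

text \<open>Only the vertices met along \<open>w\<close> have to lie in \<open>A\<close>; since
  \<open>A\<close> is not assumed closed under edges, this applies to balls.\<close>

lemma agree_on_walk:
  assumes "agree_on A f G H" "walk G u w v" "u \<in> A"
    and "\<And>w1 w2 x. w = w1 @ w2 \<Longrightarrow> walk G u w1 x \<Longrightarrow> x \<in> A"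
  shows "walk H (f u) w (f v)"
  using assms(2,3,4)
proof (induction w arbitrary: u)
  case (Cons ab w)
  obtain a b where ab: "ab = (a, b)" by (cases ab)
  from Cons.prems ab obtain x where x: "{(u, a), (x, b)} \<in> edges G" "walk G x w v"
    by auto
  have step: "y \<in> A" if "w = w1 @ w2" "walk G x w1 y" for w1 w2 y
    using Cons.prems(3)[of "ab # w1" w2 y] that x ab by auto
  from step[of "[]" w x] have x': "x \<in> A" by simp
  moreover from Cons.IH[OF x(2) this] step have "walk H (f x) w (f v)" by blast
  moreover have "{(f u, a), (f x, b)} \<in> edges H"
    using agree_on_edge[OF assms(1) Cons.prems(2) x'] x(1) by simp
  ultimately show ?case using ab by auto
qed auto

lemma isomorphic_walkE:
  assumes G: "pointed_graph G" and iso: "isomorphic G H"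
  obtains f where "agree_on (verts G) f G H" "f ` verts G = verts H" "f (pointer G) = pointer H"
    "\<And>w v. walk G (pointer G) w v \<Longrightarrow> walk H (pointer H) w (f v)"
proof -
  obtain f where f: "agree_on (verts G) f G H" "f ` verts G = verts H" "f (pointer G) = pointer H"
    using isomorphicE[OF assms] .
  moreover have "walk H (pointer H) w (f v)" if "walk G (pointer G) w v" for w v
    using agree_on_walk[OF f(1) that] walk_verts[OF G] pointer_verts[OF G] f(3) by metis
  ultimately show ?thesis using that by blast
qed

section \<open>Invariance of the codes under isomorphism, and reconstruction from the codes\<close>

lemma isomorphic_same:
  fixes G :: "('v, 'p, 's, 'd) pgraph" and H :: "('w, 'p, 's, 'd) pgraph"
  assumes G: "pointed_graph G" and H: "pointed_graph H" and "isomorphic G H"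
  shows "same G w w' \<longleftrightarrow> same H w w'"
proof -
  \<comment> \<open>Polymorphic in both vertex types, so that it can be applied in either
    direction.\<close>
  have *: "same H w w'" if GH: "same G w w'" "pointed_graph G" "isomorphic G H"
    for G :: "('x, 'p, 's, 'd) pgraph" and H :: "('y, 'p, 's, 'd) pgraph"
  proof -
    obtain f where "\<And>w v. walk G (pointer G) w v \<Longrightarrow> walk H (pointer H) w (f v)"
      using isomorphic_walkE[OF GH(2,3)] by metis
    with GH(1) show ?thesis by (auto simp: same_def)
  qed
  from *[of G H] *[of H G] assms isomorphic_sym show ?thesis by blast
qed

lemma isomorphic_vlabs:
  fixes G :: "('v, 'p, 's, 'd) pgraph" and H :: "('w, 'p, 's, 'd) pgraph"
  assumes G: "pointed_graph G" and H: "pointed_graph H" and "isomorphic G H"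
  shows "vlabs G w = vlabs H w"
proof -
  have *: "vlabs G w \<subseteq> vlabs H w" if GH: "pointed_graph G" "isomorphic G H"
    for G :: "('x, 'p, 's, 'd) pgraph" and H :: "('y, 'p, 's, 'd) pgraph"
  proof -
    obtain f where f: "agree_on (verts G) f G H"
        "\<And>w v. walk G (pointer G) w v \<Longrightarrow> walk H (pointer H) w (f v)"
      using isomorphic_walkE[OF GH] by metis
    moreover have "v \<in> verts G" if "walk G (pointer G) w v" for v
      using walk_verts[OF GH(1) that] pointer_verts[OF GH(1)] by blast
    moreover have "vlab H (f v) = vlab G v" if "v \<in> verts G" for v
      using f(1) that by (simp add: agree_on_def)
    ultimately show ?thesis
      unfolding vlabs_def by (smt (verit) mem_Collect_eq subsetI)
  qed
  from *[of G H] *[of H G] assms isomorphic_sym show ?thesis by blast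
qed

lemma isomorphic_elabs:
  fixes G :: "('v, 'p, 's, 'd) pgraph" and H :: "('w, 'p, 's, 'd) pgraph"
  assumes G: "pointed_graph G" and H: "pointed_graph H" and "isomorphic G H"
  shows "elabs G w a b = elabs H w a b"
proof -
  have *: "elabs G w a b \<subseteq> elabs H w a b" if GH: "pointed_graph G" "isomorphic G H"
    for G :: "('x, 'p, 's, 'd) pgraph" and H :: "('y, 'p, 's, 'd) pgraph"
  proof
    obtain f where f: "agree_on (verts G) f G H"
        "\<And>w v. walk G (pointer G) w v \<Longrightarrow> walk H (pointer H) w (f v)"
      using isomorphic_walkE[OF GH] by metis
    fix c assume "c \<in> elabs G w a b"
    then obtain u v where uv: "c = elab G {(u, a), (v, b)}" "walk G (pointer G) w u"
        "{(u, a), (v, b)} \<in> edges G"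
      by (auto simp: elabs_def)
    then have "{(f u, a), (f v, b)} \<in> edges H" "elab H {(f u, a), (f v, b)} = c"
      using f(1) edge_verts[OF GH(1)] unfolding agree_on_def by metis+
    with f(2)[OF uv(2)] show "c \<in> elabs H w a b"
      by (auto simp: elabs_def)
  qed
  from *[of G H] *[of H G] assms isomorphic_sym show ?thesis by blast
qed

text \<open>Words serve as names: \<open>f\<close> sends a vertex reached by a word of
  \<open>W\<close> to the vertex that the same word reaches in \<open>H\<close>. Agreement of
  \<open>same\<close> makes this independent of the word and injective. An edge from
  \<open>u\<close> to \<open>v\<close> means that a word for \<open>u\<close> prolonged by one
  letter reaches \<open>v\<close>, which is why \<open>edge\<close> speaks of words one letter
  longer than those of \<open>W\<close>. \<open>W\<close> is everything for isomorphisms and a set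
  of words of bounded length for balls.\<close>

lemma agree_on_words:
  fixes G :: "('v, 'p, 's, 'd) pgraph" and H :: "('w, 'p, 's, 'd) pgraph"
  assumes G: "pointed_graph G" and H: "pointed_graph H" and "[] \<in> W"
    and same: "\<And>w w'. w \<in> W \<Longrightarrow> w' \<in> W \<Longrightarrow> same G w w' \<longleftrightarrow> same H w w'"
    and edge: "\<And>w w' a b. w \<in> W \<Longrightarrow> w' \<in> W \<Longrightarrow>
                 same G (w @ [(a, b)]) w' \<longleftrightarrow> same H (w @ [(a, b)]) w'"
    and vlabs: "\<And>w. w \<in> W \<Longrightarrow> vlabs G w = vlabs H w"
    and elabs: "\<And>w a b. w \<in> W \<Longrightarrow> elabs G w a b = elabs H w a b"
  defines "A \<equiv> {v. \<exists>w\<in>W. walk G (pointer G) w v}"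
    and "B \<equiv> {v. \<exists>w\<in>W. walk H (pointer H) w v}"
  obtains f where "agree_on A f G H" "f ` A = B" "f (pointer G) = pointer H"
proof -
  have ex: "\<exists>v'. \<forall>w\<in>W. walk G (pointer G) w v \<longrightarrow> walk H (pointer H) w v'" if "v \<in> A" for v
  proof -
    from that obtain w where w: "w \<in> W" "walk G (pointer G) w v" by (auto simp: A_def)
    then have "same H w w" using same by (auto simp: same_def)
    then obtain v' where v': "walk H (pointer H) w v'" by (auto simp: same_def)
    have "walk H (pointer H) w' v'" if "w' \<in> W" "walk G (pointer G) w' v" for w'
      using same[OF w(1) that(1)] that(2) w(2) same_walk[OF H v', of w'] by (auto simp: same_def)
    then show ?thesis by blast
  qed
  define f where "f v = (SOME v'. \<forall>w\<in>W. walk G (pointer G) w v \<longrightarrow> walk H (pointer H) w v')" for v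
  have f: "walk H (pointer H) w (f v)" if "w \<in> W" "walk G (pointer G) w v" for w v
  proof -
    have "v \<in> A" using that by (auto simp: A_def)
    from someI_ex[OF ex[OF this]] that show ?thesis unfolding f_def by blast
  qed
  have inj: "inj_on f A"
  proof (rule inj_onI)
    fix u v assume "u \<in> A" "v \<in> A" "f u = f v"
    then obtain w w' where w: "w \<in> W" "w' \<in> W" "walk G (pointer G) w u" "walk G (pointer G) w' v"
      by (auto simp: A_def)
    then have "same H w w'" using f \<open>f u = f v\<close> by (metis same_def)
    with same w have "same G w w'" by blast
    with w show "u = v" using same_walk[OF G w(3)] walk_det[OF G] by metis
  qed
  have vl: "vlab H (f u) = vlab G u" if u: "u \<in> A" for u
  proof -
    obtain w where w: "w \<in> W" "walk G (pointer G) w u" using u by (auto simp: A_def)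
    then have "vlab H (f u) \<in> vlabs H w" using f by (auto simp: vlabs_def)
    then have "vlab H (f u) \<in> vlabs G w" using vlabs w(1) by simp
    then show ?thesis using walk_det[OF G w(2)] by (auto simp: vlabs_def)
  qed
  have ed: "({(f u, a), (f v, b)} \<in> edges H \<longleftrightarrow> {(u, a), (v, b)} \<in> edges G) \<and>
        ({(u, a), (v, b)} \<in> edges G \<longrightarrow>
           elab H {(f u, a), (f v, b)} = elab G {(u, a), (v, b)})"
    if u: "u \<in> A" and v: "v \<in> A" for u v a b
  proof -
    obtain w w' where w: "w \<in> W" "w' \<in> W" "walk G (pointer G) w u" "walk G (pointer G) w' v"
      using u v by (auto simp: A_def)
    have "{(u, a), (v, b)} \<in> edges G \<longleftrightarrow> walk G (pointer G) (w @ [(a, b)]) v"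
    proof
      assume "walk G (pointer G) (w @ [(a, b)]) v"
      then obtain x where "walk G (pointer G) w x" "{(x, a), (v, b)} \<in> edges G"
        by (auto simp: walk_append)
      with walk_det[OF G w(3)] show "{(u, a), (v, b)} \<in> edges G" by blast
    qed (use w in \<open>auto simp: walk_append\<close>)
    also have "\<dots> \<longleftrightarrow> same G (w @ [(a, b)]) w'"
      using same_walk[OF G w(4)] same_sym by metis
    also have "\<dots> \<longleftrightarrow> same H (w @ [(a, b)]) w'" using edge w by blast
    also have "\<dots> \<longleftrightarrow> walk H (pointer H) (w @ [(a, b)]) (f v)"
      using same_walk[OF H f[OF w(2,4)]] same_sym by metis
    also have "\<dots> \<longleftrightarrow> {(f u, a), (f v, b)} \<in> edges H"
    proof
      assume "walk H (pointer H) (w @ [(a, b)]) (f v)"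
      then obtain x where "walk H (pointer H) w x" "{(x, a), (f v, b)} \<in> edges H"
        by (auto simp: walk_append)
      with walk_det[OF H f[OF w(1,3)]] show "{(f u, a), (f v, b)} \<in> edges H" by blast
    qed (use f[OF w(1,3)] in \<open>auto simp: walk_append\<close>)
    finally have iff: "{(f u, a), (f v, b)} \<in> edges H \<longleftrightarrow> {(u, a), (v, b)} \<in> edges G" by simp
    moreover have "elab H {(f u, a), (f v, b)} = elab G {(u, a), (v, b)}"
      if uv: "{(u, a), (v, b)} \<in> edges G"
    proof -
      have "elab G {(u, a), (v, b)} \<in> elabs G w a b" using uv w(3) by (auto simp: elabs_def)
      then have "elab G {(u, a), (v, b)} \<in> elabs H w a b" using elabs w(1) by simp
      then obtain u' v' where "elab G {(u, a), (v, b)} = elab H {(u', a), (v', b)}"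
          "walk H (pointer H) w u'" "{(u', a), (v', b)} \<in> edges H"
        by (auto simp: elabs_def)
      moreover then have "u' = f u" using walk_det[OF H f[OF w(1,3)]] by blast
      moreover from calculation have "v' = f v" using edge_unique(1)[OF H] uv iff by metis
      ultimately show ?thesis by simp
    qed
    ultimately show ?thesis by blast
  qed
  have "agree_on A f G H"
    unfolding agree_on_def using inj vl ed by blast
  moreover have "f ` A = B"
  proof
    show "f ` A \<subseteq> B" using f by (auto simp: A_def B_def)
    show "B \<subseteq> f ` A"
    proof
      fix v assume "v \<in> B"
      then obtain w where w: "w \<in> W" "walk H (pointer H) w v" by (auto simp: B_def)
      then have "same G w w" using same[OF w(1) w(1)] by (auto simp: same_def)
      then obtain u where u: "walk G (pointer G) w u" by (auto simp: same_def)
      with w f walk_det[OF H] have "v = f u" by metis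
      with u w show "v \<in> f ` A" by (auto simp: A_def)
    qed
  qed
  moreover have "f (pointer G) = pointer H"
    using f[OF \<open>[] \<in> W\<close>, of "pointer G"] by simp
  ultimately show ?thesis using that by blast
qed

lemma isomorphic_codes:
  fixes G :: "('v, 'p, 's, 'd) pgraph" and H :: "('w, 'p, 's, 'd) pgraph"
  assumes G: "pointed_graph G" and H: "pointed_graph H"
    and "\<And>w w'. same G w w' \<longleftrightarrow> same H w w'"
    and "\<And>w. vlabs G w = vlabs H w" and "\<And>w a b. elabs G w a b = elabs H w a b"
  shows "isomorphic G H"
proof -
  have verts: "{v. \<exists>w\<in>UNIV. walk K (pointer K) w v} = verts K" if "pointed_graph K"
    for K :: "('x, 'p, 's, 'd) pgraph"
    using verts_reachable[OF that] walk_verts[OF that] pointer_verts[OF that] by blast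
  show ?thesis
    by (rule agree_on_words[OF G H UNIV_I])
      (use assms isomorphicI[OF G H] in \<open>simp_all add: verts[OF G, simplified] verts[OF H, simplified]\<close>)
qed

section \<open>Copies on the natural numbers\<close>

lemma pointed_graph_over_UNIV: "pointed_graph_over UNIV UNIV UNIV G \<longleftrightarrow> pointed_graph G"
  by (simp add: pointed_graph_over_def)

text \<open>\<open>modulo\<close> collects only graphs on \<open>nat\<close>. Graphs over other
  vertex types, such as limits, whose vertices are sets of words, or graphs with trees attached, are
  brought back by enumerating their countable vertex set.\<close>

lemma nat_copy:
  fixes G :: "('v, 'p, 's, 'd) pgraph"
  assumes "pointed_graph_over \<Sigma> \<Delta> \<pi> G"
  obtains H :: "(nat, 'p, 's, 'd) pgraph" where "pointed_graph_over \<Sigma> \<Delta> \<pi> H" "isomorphic G H"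
proof -
  have G: "pointed_graph G" using assms by (simp add: pointed_graph_over_def)
  define f where "f = to_nat_on (verts G)"
  have inj: "inj_on f (verts G)"
    using G unfolding f_def by (intro inj_on_to_nat_on) (simp add: pointed_graph_def)
  define g where "g = inv_into (verts G) f"
  have gf: "g (f v) = v" if "v \<in> verts G" for v using inj that by (simp add: g_def)
  define h where "h e = map_prod f (id :: 'p \<Rightarrow> 'p) ` e" for e
  have inv_h: "map_prod g id ` h e = e" if e: "e \<in> edges G" for e
  proof -
    obtain u a v b where "e = {(u, a), (v, b)}" "u \<in> verts G" "v \<in> verts G"
      using edge_cases[OF G e] by metis
    then show ?thesis by (simp add: h_def gf)
  qed
  define H where "H = \<lparr>verts = f ` verts G, edges = h ` edges G,
    vlab = (\<lambda>x. if x \<in> f ` verts G then vlab G (g x) else None),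
    elab = (\<lambda>e. if e \<in> h ` edges G then elab G (map_prod g id ` e) else None),
    pointer = f (pointer G)\<rparr>"
  have iso: "isomorphic G H"
    unfolding isomorphic_def H_def using inj gf inv_h
    by (intro exI[of _ f]) (auto simp: bij_betw_def simp flip: h_def)
  have fst: "fst ` e \<subseteq> verts G" and card: "card e = 2" if "e \<in> edges G" for e
    using G that unfolding pointed_graph_def by blast+
  have inj': "inj_on (map_prod f id) (verts G \<times> UNIV)"
    using inj by (auto simp: inj_on_def)
  have sub: "e \<subseteq> verts G \<times> UNIV" if "e \<in> edges G" for e
    using fst[OF that] by (auto simp: image_subset_iff mem_Times_iff)
  have "pointed_graph H"
    unfolding pointed_graph_def
  proof (intro conjI ballI)
    show "countable (verts H)" by (rule countableI_type)
    show "pairwise disjnt (edges H)"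
    proof (rule pairwiseI)
      fix e e' assume e: "e \<in> edges H" "e' \<in> edges H" "e \<noteq> e'"
      then obtain d d' where d: "d \<in> edges G" "d' \<in> edges G" "e = h d" "e' = h d'"
        by (auto simp: H_def)
      with e have "disjnt d d'" using G by (auto simp: pointed_graph_def pairwise_def)
      then show "disjnt e e'"
        using inj_on_image_Int[OF inj' sub[OF d(1)] sub[OF d(2)]] d(3,4)
        by (auto simp: disjnt_def h_def)
    qed
    show "dom (vlab H) \<subseteq> verts H" "dom (elab H) \<subseteq> edges H"
      by (auto simp: H_def split: if_splits)
    show "pointer H \<in> verts H" using pointer_verts[OF G] by (simp add: H_def)
    fix e assume "e \<in> edges H"
    show "card e = 2" "fst ` e \<subseteq> verts H"
    proof -
      obtain d where d: "d \<in> edges G" "e = map_prod f id ` d"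
        using \<open>e \<in> edges H\<close> by (auto simp: H_def h_def)
      then show "card e = 2" using card card_image[OF inj_on_subset[OF inj' sub]] by simp
      show "fst ` e \<subseteq> verts H" using fst[OF d(1)] d(2) by (auto simp: H_def)
    qed
  next
    fix u v assume uv: "u \<in> verts H" "v \<in> verts H"
    show "\<exists>w. walk H u w v"
    proof -
      obtain f' where f': "agree_on (verts G) f' G H" "f' ` verts G = verts H"
        using isomorphicE[OF G iso] by metis
      then obtain u' v' where u': "u = f' u'" "u' \<in> verts G" "v = f' v'" "v' \<in> verts G"
        using uv by blast
      then obtain w where "walk G u' w v'" using G unfolding pointed_graph_def by blast
      then have "walk H (f' u') w (f' v')"
        using agree_on_walk[OF f'(1) _ u'(2)] walk_verts[OF G _ u'(2)] by blast
      with u' show ?thesis by blast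
    qed
  qed
  moreover have "\<forall>e\<in>edges H. snd ` e \<subseteq> \<pi>"
    using assms by (fastforce simp: H_def h_def pointed_graph_over_def)
  moreover have "ran (vlab H) \<subseteq> \<Sigma>" "ran (elab H) \<subseteq> \<Delta>"
    using assms by (auto simp: H_def pointed_graph_over_def ran_def split: if_splits)
  ultimately show ?thesis using that iso by (auto simp: pointed_graph_over_def)
qed

section \<open>Graphs modulo\<close>

lemma modulo_nonempty:
  assumes "pointed_graph G"
  obtains K where "K \<in> modulo G"
  using assms nat_copy[of UNIV UNIV UNIV G] unfolding pointed_graph_over_UNIV modulo_def by blast

lemma moduloD:
  assumes "pointed_graph G" "K \<in> modulo G"
  shows "pointed_graph K" "isomorphic G K"
  using assms by (auto simp: modulo_def)

lemma modulo_eq_iff: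
  assumes G: "pointed_graph G" and H: "pointed_graph H"
  shows "modulo G = modulo H \<longleftrightarrow> isomorphic G H"
proof
  assume eq: "modulo G = modulo H"
  obtain K where "K \<in> modulo G" using modulo_nonempty[OF G] .
  with eq moduloD[OF G] moduloD[OF H] show "isomorphic G H"
    using isomorphic_sym isomorphic_trans G H by metis
next
  assume "isomorphic G H"
  then show "modulo G = modulo H"
    unfolding modulo_def using isomorphic_sym[OF G H] isomorphic_trans[OF G H] isomorphic_trans[OF H G]
    by blast
qed

lemma same_modulo:
  "pointed_graph G \<Longrightarrow> K \<in> modulo G \<Longrightarrow> same K w w' \<longleftrightarrow> same G w w'"
  using isomorphic_same moduloD by blast

lemma paths_modulo:
  assumes "pointed_graph G"
  shows "paths (modulo G) = {w. \<exists>v. walk G (pointer G) w v}"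
proof -
  obtain K where "K \<in> modulo G" using modulo_nonempty[OF assms] .
  with same_modulo[OF assms] show ?thesis
    unfolding paths_def same_refl_iff[symmetric] by blast
qed

lemma vert_modulo:
  assumes "pointed_graph G"
  shows "vert (modulo G) w = {w'. same G w w'}"
proof -
  obtain K where "K \<in> modulo G" using modulo_nonempty[OF assms] .
  with same_modulo[OF assms] show ?thesis
    unfolding vert_def same_def[symmetric] by blast
qed

text \<open>An isomorphism to another representative carries the vertex reached by \<open>w\<close>
  to the one reached there by any word of the same class, so all re-pointed representatives are
  isomorphic.\<close>

lemma shift_modulo:
  assumes G: "pointed_graph G" and w: "walk G (pointer G) w v"
  shows "shift (modulo G) (vert (modulo G) w) = modulo (G\<lparr>pointer := v\<rparr>)"
proof -
  have v: "v \<in> verts G" using walk_verts[OF G w] pointer_verts[OF G] .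
  have *: "modulo (K\<lparr>pointer := x\<rparr>) = modulo (G\<lparr>pointer := v\<rparr>)"
    if K: "K \<in> modulo G" and w': "same G w w'" "walk K (pointer K) w' x" for K w' x
  proof -
    note GK = moduloD[OF G K]
    obtain f where f: "agree_on (verts G) f G K" "f ` verts G = verts K" "f (pointer G) = pointer K"
        "\<And>w v. walk G (pointer G) w v \<Longrightarrow> walk K (pointer K) w (f v)"
      using isomorphic_walkE[OF G GK(2)] by metis
    have "walk G (pointer G) w' v" using w' w same_walk[OF G] by blast
    then have x: "x = f v" using f(4) w'(2) walk_det[OF GK(1)] by metis
    have "isomorphic (G\<lparr>pointer := v\<rparr>) (K\<lparr>pointer := x\<rparr>)"
      using v f(1,2) x pointed_graph_repoint[OF G v] pointed_graph_repoint[OF GK(1), of x]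
      by (intro isomorphicI[of _ _ f]) (auto simp: agree_on_def)
    then show ?thesis
      using modulo_eq_iff pointed_graph_repoint[OF G v] pointed_graph_repoint[OF GK(1), of x] x v f(2)
      by blast
  qed
  obtain K where K: "K \<in> modulo G" using modulo_nonempty[OF G] .
  have "same G w w" using w by (auto simp: same_def)
  moreover have "same K w w" using same_modulo[OF G K] \<open>same G w w\<close> by blast
  then obtain x where "walk K (pointer K) w x" by (auto simp: same_def)
  ultimately have "modulo (K\<lparr>pointer := x\<rparr>) \<in> {modulo (K\<lparr>pointer := x\<rparr>) | K x.
      K \<in> modulo G \<and> (\<exists>w'\<in>{w'. same G w w'}. walk K (pointer K) w' x)}" (is "_ \<in> ?M")
    using K by blast
  then have "?M = {modulo (G\<lparr>pointer := v\<rparr>)}" using * K by blast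
  then show ?thesis
    unfolding shift_def vert_modulo[OF G] by simp
qed

text \<open>\<open>u'\<close> is any nonempty set of words leading from \<open>v\<close> to
  \<open>x\<close>, not necessarily a full vertex: in the definition of boundedness the second
  factor is a vertex of a disk, which contains only the paths inside that disk.\<close>

lemma conc_modulo:
  assumes G: "pointed_graph G" and p: "walk G (pointer G) p v" and q: "walk G v q x"
    and u': "u' \<noteq> {}" "\<And>q'. q' \<in> u' \<Longrightarrow> walk G v q' x"
  shows "conc (modulo G) (vert (modulo G) p) u' = vert (modulo G) (p @ q)"
proof -
  have *: "same G (p' @ q') w \<longleftrightarrow> same G (p @ q) w" if "same G p p'" "q' \<in> u'" for p' q' w
  proof -
    have "walk G (pointer G) (p' @ q') x"
      using that u' same_walk[OF G p] by (auto simp: walk_append)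
    moreover have "walk G (pointer G) (p @ q) x" using p q by (auto simp: walk_append)
    ultimately show ?thesis using same_walk[OF G] by blast
  qed
  have "same G p p" using p by (auto simp: same_def)
  with u'(1) show ?thesis
    unfolding conc_def vert_modulo[OF G] using * by blast
qed

section \<open>Disks\<close>

lemma ball_of_mono: "j \<le> k \<Longrightarrow> ball_of G j \<subseteq> ball_of G k"
  unfolding ball_of_def using order.trans by blast

lemma ball_ofI: "walk G (pointer G) w v \<Longrightarrow> length w \<le> k \<Longrightarrow> v \<in> ball_of G k"
  by (auto simp: ball_of_def)

lemma ball_of_verts: "pointed_graph G \<Longrightarrow> ball_of G k \<subseteq> verts G"
  using walk_verts pointer_verts by (fastforce simp: ball_of_def)

lemma walk_disk_graphD: "walk (disk_graph r G) u w v \<Longrightarrow> walk G u w v"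
  by (induction "disk_graph r G" u w v rule: walk.induct) (auto simp: disk_graph_def)

text \<open>\<open>w0\<close> records a route from the pointer, so that the induction, which moves
  the start \<open>u\<close>, still sees that every vertex on the way lies within distance
  \<open>r + 1\<close>.\<close>

lemma walk_disk_graphI:
  "walk G u w v \<Longrightarrow> walk G (pointer G) w0 u \<Longrightarrow> length w0 + length w \<le> r + 1 \<Longrightarrow>
     walk (disk_graph r G) u w v"
proof (induction w arbitrary: u w0)
  case (Cons ab w)
  obtain a b where ab: "ab = (a, b)" by (cases ab)
  from Cons.prems ab obtain x where x: "{(u, a), (x, b)} \<in> edges G" "walk G x w v" by auto
  have w0: "walk G (pointer G) (w0 @ [(a, b)]) x" using Cons.prems(2) x by (auto simp: walk_append)
  have "walk (disk_graph r G) x w v"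
    using Cons.IH[OF x(2) w0] Cons.prems(3) by simp
  moreover have "u \<in> ball_of G (r + 1)" "x \<in> ball_of G (r + 1)"
    using Cons.prems(2,3) w0 by (auto intro: ball_ofI)
  ultimately show ?case using x ab by (auto simp: disk_graph_def)
qed auto

lemma pointer_disk_graph [simp]: "pointer (disk_graph r G) = pointer G"
  by (simp add: disk_graph_def)

lemma walk_disk_graph:
  "length w \<le> r + 1 \<Longrightarrow> walk (disk_graph r G) (pointer G) w v \<longleftrightarrow> walk G (pointer G) w v"
  using walk_disk_graphD walk_disk_graphI[of G "pointer G" w v "[]"] by auto

lemma pointed_disk_graph:
  assumes "pointed_graph G"
  shows "pointed_graph (disk_graph r G)"
  unfolding pointed_graph_def
proof (intro conjI ballI)
  have edges: "edges (disk_graph r G) \<subseteq> edges G" by (auto simp: disk_graph_def)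
  show "countable (verts (disk_graph r G))"
    using assms ball_of_verts[OF assms, of "r + 1"] countable_subset
    by (auto simp: pointed_graph_def disk_graph_def)
  show "card e = 2" "fst ` e \<subseteq> verts (disk_graph r G)" if "e \<in> edges (disk_graph r G)" for e
    using that assms by (auto simp: pointed_graph_def disk_graph_def)
  show "pairwise disjnt (edges (disk_graph r G))"
    using edges assms pairwise_subset by (auto simp: pointed_graph_def)
  show "dom (vlab (disk_graph r G)) \<subseteq> verts (disk_graph r G)"
    using ball_of_mono[of r "r + 1" G] by (auto simp: disk_graph_def)
  show "dom (elab (disk_graph r G)) \<subseteq> edges (disk_graph r G)"
    using ball_of_mono[of r "r + 1" G] assms by (auto simp: disk_graph_def pointed_graph_def)
  show "pointer (disk_graph r G) \<in> verts (disk_graph r G)"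
    by (auto simp: disk_graph_def ball_of_def intro: exI[of _ "[]"])
  show "\<exists>w. walk (disk_graph r G) u w v"
    if "u \<in> verts (disk_graph r G)" "v \<in> verts (disk_graph r G)" for u v
  proof -
    have "\<exists>w. walk (disk_graph r G) (pointer G) w x" if "x \<in> verts (disk_graph r G)" for x
      using that walk_disk_graph by (fastforce simp: disk_graph_def ball_of_def)
    from this[OF that(1)] this[OF that(2)] obtain w w'
      where "walk (disk_graph r G) (pointer G) w u" "walk (disk_graph r G) (pointer G) w' v"
      by blast
    then have "walk (disk_graph r G) u (rev (map prod.swap w) @ w') v"
      using walk_rev walk_append by metis
    then show ?thesis by blast
  qed
qed

lemma agree_on_ball:
  assumes "agree_on A f G H" "ball_of G k \<subseteq> A" "f (pointer G) = pointer H"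
    and "length w \<le> k" "walk G (pointer G) w v"
  shows "walk H (pointer H) w (f v)"
proof -
  have "x \<in> A" if "w = w1 @ w2" "walk G (pointer G) w1 x" for w1 w2 x
    using that assms(2,4) ball_ofI[OF that(2), of k] by auto
  moreover from this[of "[]" w] have "pointer G \<in> A" by simp
  ultimately show ?thesis
    using agree_on_walk[OF assms(1,5)] assms(3) by metis
qed

text \<open>Short walks from the pointer are carried over by \<open>f\<close> and back by its
  inverse, so \<open>f\<close> preserves distances from the pointer up to \<open>k + 1\<close>.
  \<open>A\<close> may be larger than the ball; over graphs with trees it is even infinite.\<close>

lemma isomorphic_disk_graph:
  assumes G: "pointed_graph G" and H: "pointed_graph H"
    and f: "agree_on A f G H" "ball_of G (k + 1) \<subseteq> A" "ball_of H (k + 1) \<subseteq> f ` A"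
      "f (pointer G) = pointer H"
  shows "isomorphic (disk_graph k G) (disk_graph k H)"
proof -
  have inj: "inj_on f A" using f(1) by (simp add: agree_on_def)
  have "pointer G \<in> ball_of G (k + 1)" by (auto simp: ball_of_def intro: exI[of _ "[]"])
  then have inv: "inv_into A f (pointer H) = pointer G"
    using inj f(2,4) by (metis inv_into_f_f subsetD)
  have ball: "f ` ball_of G j = ball_of H j" if j: "j \<le> k + 1" for j
  proof
    show "f ` ball_of G j \<subseteq> ball_of H j"
      using agree_on_ball[OF f(1) _ f(4), of j] f(2) ball_of_mono[OF j]
      by (fastforce simp: ball_of_def)
    show "ball_of H j \<subseteq> f ` ball_of G j"
    proof
      fix y assume y: "y \<in> ball_of H j"
      then have "inv_into A f y \<in> ball_of G j"
        using agree_on_ball[OF agree_on_inv[OF f(1)] _ inv, of j] f(3) ball_of_mono[OF j, of H]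
        by (fastforce simp: ball_of_def)
      moreover have "f (inv_into A f y) = y"
        using y f(3) ball_of_mono[OF j, of H] by (intro f_inv_into_f) blast
      ultimately show "y \<in> f ` ball_of G j" by force
    qed
  qed
  have mem: "f u \<in> ball_of H j \<longleftrightarrow> u \<in> ball_of G j" if "u \<in> ball_of G (k + 1)" "j \<le> k + 1" for u j
  proof -
    have "u \<in> A" "ball_of G j \<subseteq> A" using that f(2) ball_of_mono[OF that(2), of G] by auto
    then show ?thesis using ball[OF that(2)] inj_on_image_mem_iff[OF inj] by metis
  qed
  have "agree_on (verts (disk_graph k G)) f (disk_graph k G) (disk_graph k H)"
    using f(1,2) mem unfolding agree_on_def
    by (auto simp: disk_graph_def restrict_map_def subset_iff intro: inj_on_subset)
  then show ?thesis
    using ball[of "k + 1"] f(4)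
    by (intro isomorphicI[of _ _ f] pointed_disk_graph G H) (auto simp: disk_graph_def)
qed

lemma disk_modulo:
  assumes G: "pointed_graph G"
  shows "disk r (modulo G) = modulo (disk_graph r G)"
proof -
  have "modulo (disk_graph r K) = modulo (disk_graph r G)" if K: "K \<in> modulo G" for K
  proof -
    note GK = moduloD[OF G K]
    obtain f where "agree_on (verts G) f G K" "f ` verts G = verts K" "f (pointer G) = pointer K"
      using isomorphicE[OF G GK(2)] .
    then have "isomorphic (disk_graph r G) (disk_graph r K)"
      using isomorphic_disk_graph[OF G GK(1)] ball_of_verts[OF G] ball_of_verts[OF GK(1)] by metis
    then show ?thesis using modulo_eq_iff pointed_disk_graph G GK(1) by metis
  qed
  moreover obtain K where "K \<in> modulo G" using modulo_nonempty[OF G] .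
  ultimately show ?thesis unfolding disk_def by blast
qed

lemma ball_of_disk_graph: "j \<le> r + 1 \<Longrightarrow> ball_of (disk_graph r G) j = ball_of G j"
  unfolding ball_of_def using walk_disk_graph[of _ r G]
  by (metis (no_types, opaque_lifting) order.trans pointer_disk_graph)

lemma disk_graph_disk_graph:
  assumes "m \<le> n" shows "disk_graph m (disk_graph n G) = disk_graph m G"
proof -
  have "ball_of G (m + 1) \<subseteq> ball_of G (n + 1)" "ball_of G m \<subseteq> ball_of G n"
      "ball_of G m \<subseteq> ball_of G (n + 1)"
    using assms by (auto intro!: ball_of_mono)
  then show ?thesis
    using ball_of_disk_graph[of m n G] ball_of_disk_graph[of "m + 1" n G] assms
    unfolding disk_graph_def[of m]
    by (auto simp: disk_graph_def[of n] restrict_map_def fun_eq_iff)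
qed

section \<open>Reading the codes inside a disk\<close>

lemma vlabs_disk_graph:
  assumes "length w \<le> r" shows "vlabs (disk_graph r G) w = vlabs G w"
proof -
  have "vlab (disk_graph r G) v = vlab G v" if "walk G (pointer G) w v" for v
    using ball_ofI[OF that assms] by (simp add: disk_graph_def)
  then have "c = vlab (disk_graph r G) v \<and> walk (disk_graph r G) (pointer G) w v \<longleftrightarrow>
      c = vlab G v \<and> walk G (pointer G) w v" for c v
    using walk_disk_graph[of w r G] assms by auto
  then show ?thesis unfolding vlabs_def by simp
qed

text \<open>The far end of the edge is one step beyond the end of \<open>w\<close>, and edge labels
  survive only between vertices at distance at most \<open>r\<close>; hence the strict inequality,
  against \<open>\<le>\<close> for vertex labels.\<close>

lemma elabs_disk_graph:
  assumes "length w < r" shows "elabs (disk_graph r G) w a b = elabs G w a b"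
proof -
  have *: "u \<in> ball_of G r \<and> v \<in> ball_of G r"
    if "walk G (pointer G) w u" "{(u, a), (v, b)} \<in> edges G" for u v
  proof -
    have "walk G (pointer G) (w @ [(a, b)]) v" using that by (auto simp: walk_append)
    moreover have "length (w @ [(a, b)]) \<le> r" "length w \<le> r" using assms by auto
    ultimately show ?thesis using that(1) unfolding ball_of_def by blast
  qed
  have "elab (disk_graph r G) {(u, a), (v, b)} = elab G {(u, a), (v, b)}"
      "{(u, a), (v, b)} \<in> edges (disk_graph r G)"
    if "walk G (pointer G) w u" "{(u, a), (v, b)} \<in> edges G" for u v
    using *[OF that] that(2) ball_of_mono[of r "r + 1" G] by (auto simp: disk_graph_def)
  moreover have "{(u, a), (v, b)} \<in> edges (disk_graph r G) \<Longrightarrow> {(u, a), (v, b)} \<in> edges G" for u v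
    by (simp add: disk_graph_def)
  ultimately have "c = elab (disk_graph r G) {(u, a), (v, b)} \<and>
      walk (disk_graph r G) (pointer G) w u \<and> {(u, a), (v, b)} \<in> edges (disk_graph r G) \<longleftrightarrow>
      c = elab G {(u, a), (v, b)} \<and> walk G (pointer G) w u \<and> {(u, a), (v, b)} \<in> edges G" for c u v
    using walk_disk_graph[of w r G] assms by auto
  then show ?thesis unfolding elabs_def by simp
qed

lemma same_disk_graph:
  assumes "length w \<le> r + 1" "length w' \<le> r + 1"
  shows "same (disk_graph r G) w w' \<longleftrightarrow> same G w w'"
  using assms by (simp add: same_def walk_disk_graph)

text \<open>The disk of an element of \<open>im_graphs\<close> truncates the trees and leaves that
  set; statements about disks are therefore made in this larger one.\<close>

abbreviation mods :: "('p, 's, 'd) graph_mod set" where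
  "mods \<equiv> graphs_modulo UNIV UNIV UNIV"

lemma modulo_mods:
  assumes "pointed_graph G" shows "modulo G \<in> mods"
proof -
  obtain K where "K \<in> modulo G" using modulo_nonempty[OF assms] .
  with modulo_eq_iff[OF assms] moduloD[OF assms] show ?thesis
    unfolding graphs_modulo_def pointed_graph_over_UNIV by blast
qed

lemma modsE:
  assumes "X \<in> mods"
  obtains G :: "(nat, 'p, 's, 'd) pgraph" where "pointed_graph G" "X = modulo G"
  using assms unfolding graphs_modulo_def pointed_graph_over_UNIV by blast

lemma disk_mods: "X \<in> mods \<Longrightarrow> disk r X \<in> mods"
  by (metis disk_modulo modsE modulo_mods pointed_disk_graph)

lemma disk_disk:
  assumes "X \<in> mods" "j \<le> k" shows "disk j (disk k X) = disk j X"
  using assms(1) by (rule modsE) (simp add: disk_modulo pointed_disk_graph disk_graph_disk_graph assms)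

lemma disk_eq_mono:
  "X \<in> mods \<Longrightarrow> Y \<in> mods \<Longrightarrow> disk k X = disk k Y \<Longrightarrow> j \<le> k \<Longrightarrow> disk j X = disk j Y"
  by (metis disk_disk)

text \<open>Each value of the three codes concerns words of fixed length and can be read off in a
  sufficiently large disk. This gives uniqueness of limits.\<close>

lemma disk_separated:
  assumes "X \<in> mods" "Y \<in> mods" and eq: "\<And>k. disk k X = disk k Y"
  shows "X = Y"
proof -
  obtain G :: "(nat, 'a, 'b, 'c) pgraph" where G: "pointed_graph G" "X = modulo G"
    using assms(1) by (rule modsE)
  obtain H :: "(nat, 'a, 'b, 'c) pgraph" where H: "pointed_graph H" "Y = modulo H"
    using assms(2) by (rule modsE)
  have iso: "isomorphic (disk_graph k G) (disk_graph k H)" for k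
    using eq[of k] G H by (simp add: disk_modulo modulo_eq_iff pointed_disk_graph)
  note iso' = pointed_disk_graph[OF G(1)] pointed_disk_graph[OF H(1)] iso
  have "isomorphic G H"
  proof (rule isomorphic_codes[OF G(1) H(1)])
    show "same G w w' = same H w w'" for w w'
      using isomorphic_same[OF iso', of "max (length w) (length w')" w w']
      by (simp add: same_disk_graph)
    show "vlabs G w = vlabs H w" for w
      using isomorphic_vlabs[OF iso', of "length w" w] by (simp add: vlabs_disk_graph)
    show "elabs G w a b = elabs H w a b" for w a b
      using isomorphic_elabs[OF iso', of "length w + 1" w a b] by (simp add: elabs_disk_graph)
  qed
  then show ?thesis using G H by (simp add: modulo_eq_iff)
qed

section \<open>Limits of graphs\<close>

text \<open>Diagonal extraction: for a single index the pigeonhole principle gives a subsequence on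
  which the value is constant, and being eventually constant survives passing to further
  subsequences.\<close>

lemma eventually_constant_subseq:
  fixes f :: "nat \<Rightarrow> 'c \<Rightarrow> 'a"
  assumes C: "countable C" and fin: "\<And>c. c \<in> C \<Longrightarrow> finite (range (\<lambda>n. f n c))"
  obtains s :: "nat \<Rightarrow> nat"
  where "strict_mono s" "\<And>c. c \<in> C \<Longrightarrow> \<exists>a. \<forall>\<^sub>F n in sequentially. f (s n) c = a"
proof (cases "C = {}")
  case True
  then show ?thesis using that[of id] by (simp add: strict_mono_id)
next
  case False
  define c where "c = from_nat_into C"
  define P where "P i s \<longleftrightarrow> (\<exists>a. \<forall>\<^sub>F n in sequentially. f (s n) (c i) = a)" for i and s :: "nat \<Rightarrow> nat"
  interpret subseqs P
  proof
    fix i and s :: "nat \<Rightarrow> nat"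
    have "finite ((\<lambda>n. f (s n) (c i)) ` UNIV)"
      by (rule finite_subset[OF _ fin[OF from_nat_into[OF False, of i]]]) (auto simp: c_def)
    then obtain n0 where inf: "infinite {n \<in> UNIV. f (s n) (c i) = f (s n0) (c i)}"
      using pigeonhole_infinite[of UNIV "\<lambda>n. f (s n) (c i)"] by auto
    let ?r = "enumerate {n. f (s n) (c i) = f (s n0) (c i)}"
    have "strict_mono ?r" using inf by (simp add: strict_mono_enumerate)
    moreover have "f (s (?r n)) (c i) = f (s n0) (c i)" for n
      using enumerate_in_set[of "{n. f (s n) (c i) = f (s n0) (c i)}" n] inf by simp
    ultimately show "\<exists>r. strict_mono r \<and> P i (s \<circ> r)" unfolding P_def by auto
  qed
  have "\<exists>a. \<forall>\<^sub>F n in sequentially. f (diagseq n) x = a" if x: "x \<in> C" for x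
  proof -
    obtain i where i: "x = c i" using from_nat_into_surj[OF C x] c_def by metis
    \<comment> \<open>From index \<open>Suc i\<close> on, the diagonal sequence is a subsequence of
      the extraction made for \<open>c i\<close>; shifting the index back does not affect eventual
      constancy.\<close>
    have "P i (diagseq \<circ> ((+) (Suc i)))"
    proof (rule diagseq_holds)
      fix r s :: "nat \<Rightarrow> nat" and j assume "strict_mono r" "P j s"
      then show "P j (s \<circ> r)"
        unfolding P_def comp_def using eventually_subseq by blast
    qed
    then obtain a where "\<forall>\<^sub>F n in sequentially. f (diagseq (n + Suc i)) (c i) = a"
      unfolding P_def by (auto simp: add.commute)
    then have "\<forall>\<^sub>F n in sequentially. f (diagseq n) (c i) = a"
      using eventually_sequentially_seg[of "\<lambda>n. f (diagseq n) (c i) = a"] by blast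
    then show ?thesis using i by blast
  qed
  with that subseq_diagseq show ?thesis by blast
qed

lemma walk_in_lists:
  assumes "pointed_graph_over \<Sigma> \<Delta> \<pi> G"
  shows "walk G u w v \<Longrightarrow> w \<in> lists (\<pi> \<times> \<pi>)"
proof (induction w arbitrary: u)
  case (Cons ab w)
  obtain a b where ab: "ab = (a, b)" by (cases ab)
  from Cons.prems ab obtain x where x: "{(u, a), (x, b)} \<in> edges G" "walk G x w v" by auto
  then have "snd ` {(u, a), (x, b)} \<subseteq> \<pi>" using assms unfolding pointed_graph_over_def by blast
  with Cons.IH[OF x(2)] ab show ?case by simp
qed auto

section \<open>Compatibility of the codes with the choice of path and with reversing an edge\<close>

lemma same_append_iff:
  "pointed_graph G \<Longrightarrow> same G w w' \<Longrightarrow> same G (w @ x) y \<longleftrightarrow> same G (w' @ x) y"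
  unfolding same_def walk_append by (metis walk_det)

lemma same_back:
  assumes "pointed_graph G" "same G (w @ [(a, b)]) w'"
  shows "same G (w' @ [(b, a)]) w"
proof -
  obtain u v where "walk G (pointer G) w u" "{(u, a), (v, b)} \<in> edges G" "walk G (pointer G) w' v"
    using assms by (auto simp: same_def walk_append)
  then have "walk G (pointer G) w u \<and> walk G (pointer G) (w' @ [(b, a)]) u"
    by (auto simp: walk_append insert_commute)
  then show ?thesis unfolding same_def by blast
qed

lemma vlabs_cong:
  assumes "pointed_graph G" "same G w w'" shows "vlabs G w = vlabs G w'"
proof -
  obtain v where "walk G (pointer G) w v" "walk G (pointer G) w' v"
    using assms(2) by (auto simp: same_def)
  then have "walk G (pointer G) w x \<longleftrightarrow> walk G (pointer G) w' x" for x
    using walk_det[OF assms(1)] by metis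
  then show ?thesis by (simp add: vlabs_def)
qed

lemma elabs_cong:
  assumes "pointed_graph G" "same G w w'" shows "elabs G w a b = elabs G w' a b"
proof -
  obtain v where "walk G (pointer G) w v" "walk G (pointer G) w' v"
    using assms(2) by (auto simp: same_def)
  then have "walk G (pointer G) w x \<longleftrightarrow> walk G (pointer G) w' x" for x
    using walk_det[OF assms(1)] by metis
  then show ?thesis by (simp add: elabs_def)
qed

text \<open>Together with \<open>vlabs_empty\<close> this explains the set-valued code: it is total
  and still tells an unlabelled vertex, with value \<open>{None}\<close>, from a missing one, with
  the empty value.\<close>

lemma vlabs_singleton:
  assumes "pointed_graph G" "walk G (pointer G) w v" shows "vlabs G w = {vlab G v}"
proof -
  have "x = v" if "walk G (pointer G) w x" for x using walk_det[OF assms that] by simp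
  then show ?thesis unfolding vlabs_def using assms(2) by blast
qed

lemma elabs_singleton:
  assumes G: "pointed_graph G" and "walk G (pointer G) w u" "{(u, a), (v, b)} \<in> edges G"
  shows "elabs G w a b = {elab G {(u, a), (v, b)}}"
proof -
  have "u' = u \<and> v' = v" if "walk G (pointer G) w u'" "{(u', a), (v', b)} \<in> edges G" for u' v'
    using walk_det[OF G assms(2) that(1)] edge_unique(1)[OF G assms(3)] that(2) by blast
  then show ?thesis unfolding elabs_def using assms(2,3) by blast
qed

lemma elabs_back:
  assumes G: "pointed_graph G" and "same G (w @ [(a, b)]) w'"
  shows "elabs G w a b = elabs G w' b a"
proof -
  obtain u v where uv: "walk G (pointer G) w u" "{(u, a), (v, b)} \<in> edges G" "walk G (pointer G) w' v"
    using assms by (auto simp: same_def walk_append)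
  then have "{(v, b), (u, a)} \<in> edges G" by (simp add: insert_commute)
  with uv show ?thesis
    using elabs_singleton[OF G uv(1,2)] elabs_singleton[OF G uv(3), of b u a]
    by (simp add: insert_commute)
qed

lemma vlabs_empty: "\<not> same G w w \<Longrightarrow> vlabs G w = {}"
  by (auto simp: vlabs_def same_def)

lemma elabs_empty: "\<not> same G (w @ [(a, b)]) (w @ [(a, b)]) \<Longrightarrow> elabs G w a b = {}"
  by (auto simp: elabs_def same_def walk_append)

section \<open>The limit of a sequence of graphs whose codes are eventually constant\<close>

locale converging_graphs =
  fixes Gs :: "nat \<Rightarrow> ('v, 'p, 's, 'd) pgraph"
    and \<Sigma> :: "'s set" and \<Delta> :: "'d set" and \<pi> :: "'p set"
  assumes over: "\<And>n. pointed_graph_over \<Sigma> \<Delta> \<pi> (Gs n)"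
    and finite_ports: "finite \<pi>"
    and same_decided: "\<And>w w'. (\<forall>\<^sub>F n in sequentially. same (Gs n) w w') \<or>
                              (\<forall>\<^sub>F n in sequentially. \<not> same (Gs n) w w')"
    and vlabs_decided: "\<And>w. \<exists>c. \<forall>\<^sub>F n in sequentially. vlabs (Gs n) w = c"
    and elabs_decided: "\<And>w a b. \<exists>c. \<forall>\<^sub>F n in sequentially. elabs (Gs n) w a b = c"
begin

text \<open>A partial equivalence relation: \<open>E w w\<close> says that \<open>w\<close> is a
  path in all but finitely many graphs, and such words modulo \<open>E\<close> become the vertices
  of the limit.\<close>

definition E where "E w w' \<longleftrightarrow> (\<forall>\<^sub>F n in sequentially. same (Gs n) w w')"

definition cls where "cls w = {w'. E w w'}"

definition lim_edges :: "('p word set \<times> 'p) set set" where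
  "lim_edges = {{(cls w, a), (cls (w @ [(a, b)]), b)} | w a b. E (w @ [(a, b)]) (w @ [(a, b)])}"

text \<open>Labels are the eventual values of the codes. Any representing word may be used, and an
  edge may be read from either end; that this yields a single value is what
  \<open>vlabs_cong\<close>, \<open>elabs_cong\<close> and \<open>elabs_back\<close> contribute to
  \<open>vlab_lim\<close> and \<open>elab_lim\<close>.\<close>

definition lim_graph :: "('p word set, 'p, 's, 'd) pgraph" where
  "lim_graph = \<lparr>verts = cls ` {w. E w w}, edges = lim_edges,
     vlab = (\<lambda>x. if x \<in> cls ` {w. E w w}
       then THE c. \<exists>w. x = cls w \<and> E w w \<and> (\<forall>\<^sub>F n in sequentially. vlabs (Gs n) w = {c}) else None),
     elab = (\<lambda>e. if e \<in> lim_edges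
       then THE c. \<exists>w a b. e = {(cls w, a), (cls (w @ [(a, b)]), b)} \<and>
              E (w @ [(a, b)]) (w @ [(a, b)]) \<and>
              (\<forall>\<^sub>F n in sequentially. elabs (Gs n) w a b = {c}) else None),
     pointer = cls []\<rparr>"

lemma pointed: "pointed_graph (Gs n)"
  using over by (simp add: pointed_graph_over_def)

lemma E_happens:
  assumes "E w w'" obtains n where "same (Gs n) w w'"
  using assms eventually_happens'[OF sequentially_bot] unfolding E_def by metis

lemma not_E: "\<not> E w w' \<Longrightarrow> \<forall>\<^sub>F n in sequentially. \<not> same (Gs n) w w'"
  using same_decided E_def by blast

lemma E_Nil: "E [] []"
  by (simp add: E_def same_def)

lemma E_sym: "E w w' \<Longrightarrow> E w' w"
  unfolding E_def by (erule eventually_mono) (rule same_sym)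

lemma E_trans:
  assumes "E w w'" "E w' w''" shows "E w w''"
  using assms unfolding E_def by eventually_elim (rule same_trans[OF pointed])

lemma E_refl: "E w w' \<Longrightarrow> E w w" "E w w' \<Longrightarrow> E w' w'"
  using E_sym E_trans by blast+

lemma E_prefix: "E (w @ x) y \<Longrightarrow> E w w"
  unfolding E_def by (erule eventually_mono) (auto simp: same_def walk_append)

lemma E_append:
  assumes "E w w'" "E (w @ x) y" shows "E (w' @ x) y"
  using assms unfolding E_def by eventually_elim (simp add: same_append_iff[OF pointed])

lemma E_back: "E (w @ [(a, b)]) w' \<Longrightarrow> E (w' @ [(b, a)]) w"
  unfolding E_def by (erule eventually_mono) (rule same_back[OF pointed])

lemma cls_eq: "E w w \<Longrightarrow> cls w = cls w' \<longleftrightarrow> E w w'"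
  unfolding cls_def using E_sym E_trans by blast

text \<open>The claim does not mention \<open>n\<close>, so it may be checked in any single graph
  where both words are paths; there a vertex-port pair lies in at most one edge.\<close>

lemma step_unique:
  assumes "E (w @ [(a, b)]) x" "E (w @ [(a, b')]) x'"
  shows "b = b'"
proof -
  have "\<forall>\<^sub>F n in sequentially. b = b'"
    using assms unfolding E_def
  proof eventually_elim
    case (elim n)
    then obtain u v u' v' where "walk (Gs n) (pointer (Gs n)) w u" "{(u, a), (v, b)} \<in> edges (Gs n)"
        "walk (Gs n) (pointer (Gs n)) w u'" "{(u', a), (v', b')} \<in> edges (Gs n)"
      by (auto simp: same_def walk_append)
    then show "b = b'" using walk_det[OF pointed] edge_unique(2)[OF pointed] by metis
  qed
  then show ?thesis by simp
qed

text \<open>A port joined to itself would be an edge with a single element, which no graph of the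
  sequence has. In the limit this ensures that edges have two elements.\<close>

lemma no_loop: "\<not> E (w @ [(a, a)]) w"
proof
  assume "E (w @ [(a, a)]) w"
  then obtain n where "same (Gs n) (w @ [(a, a)]) w" by (rule E_happens)
  then obtain u v where uv: "walk (Gs n) (pointer (Gs n)) w u" "{(u, a), (v, a)} \<in> edges (Gs n)"
      "walk (Gs n) (pointer (Gs n)) w v"
    by (auto simp: same_def walk_append)
  then have "v = u" using walk_det[OF pointed] by blast
  with edge_verts(3)[OF pointed uv(2)] show False by simp
qed

lemma lim_edge_iff:
  assumes "E w w" "E w' w'"
  shows "{(cls w, a), (cls w', b)} \<in> lim_edges \<longleftrightarrow> E (w @ [(a, b)]) w'"
proof
  assume "{(cls w, a), (cls w', b)} \<in> lim_edges"
  then obtain x c d where x: "E (x @ [(c, d)]) (x @ [(c, d)])"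
      "{(cls w, a), (cls w', b)} = {(cls x, c), (cls (x @ [(c, d)]), d)}"
    by (auto simp: lim_edges_def)
  then consider "cls w = cls x" "a = c" "cls w' = cls (x @ [(c, d)])" "b = d"
    | "cls w = cls (x @ [(c, d)])" "a = d" "cls w' = cls x" "b = c"
    by (auto simp: doubleton_eq_iff)
  then show "E (w @ [(a, b)]) w'"
  proof cases
    case 1
    then show ?thesis using assms cls_eq E_append E_sym E_trans x(1) by metis
  next
    case 2
    then have "E w (x @ [(c, d)])" "E w' x" using assms cls_eq by auto
    then show ?thesis using E_back E_sym E_trans 2 by metis
  qed
next
  assume E: "E (w @ [(a, b)]) w'"
  then have "cls w' = cls (w @ [(a, b)])" using cls_eq E_sym assms(2) by metis
  with E show "{(cls w, a), (cls w', b)} \<in> lim_edges"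
    using E_refl unfolding lim_edges_def by blast
qed

lemma lim_edge_cases:
  assumes "e \<in> lim_edges"
  obtains w w' a b where "e = {(cls w, a), (cls w', b)}" "E w w" "E w' w'" "E (w @ [(a, b)]) w'"
    "(cls w, a) \<noteq> (cls w', b)"
proof -
  obtain w a b where w: "e = {(cls w, a), (cls (w @ [(a, b)]), b)}" "E (w @ [(a, b)]) (w @ [(a, b)])"
    using assms by (auto simp: lim_edges_def)
  moreover have "(cls w, a) \<noteq> (cls (w @ [(a, b)]), b)"
  proof
    assume "(cls w, a) = (cls (w @ [(a, b)]), b)"
    then have "E (w @ [(a, a)]) w" using cls_eq[OF E_prefix[OF w(2)]] E_sym by auto
    with no_loop show False by blast
  qed
  ultimately show ?thesis using that E_prefix by blast
qed

text \<open>Walking in the limit is appending letters to a representing word. In particular the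
  words that reach \<open>cls w\<close> from the pointer are those equivalent to \<open>w\<close>,
  so the limit has the intended codes.\<close>

lemma lim_walk:
  "E u u \<Longrightarrow> walk lim_graph (cls u) w x \<longleftrightarrow> E (u @ w) (u @ w) \<and> x = cls (u @ w)"
proof (induction w arbitrary: u)
  case (Cons ab w)
  obtain a b where ab: "ab = (a, b)" by (cases ab)
  have edges: "edges lim_graph = lim_edges" by (simp add: lim_graph_def)
  show ?case
  proof
    assume "walk lim_graph (cls u) (ab # w) x"
    then obtain y where y: "{(cls u, a), (y, b)} \<in> lim_edges" "walk lim_graph y w x"
      using ab edges by auto
    obtain w1 w2 where "E w1 w1" "E w2 w2" "y = cls w1 \<or> y = cls w2"
      using lim_edge_cases[OF y(1)] by (metis Pair_inject doubleton_eq_iff)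
    then obtain w' where w': "E w' w'" "y = cls w'" by blast
    with y(1) lim_edge_iff[OF Cons.prems w'(1)] have *: "E (u @ [(a, b)]) w'" by simp
    then have "y = cls (u @ [(a, b)])" using w' cls_eq E_sym by metis
    with y(2) Cons.IH[OF E_refl(1)[OF *]] show "E (u @ ab # w) (u @ ab # w) \<and> x = cls (u @ ab # w)"
      by (simp add: ab)
  next
    assume *: "E (u @ ab # w) (u @ ab # w) \<and> x = cls (u @ ab # w)"
    then have **: "E (u @ [(a, b)]) (u @ [(a, b)])"
      using E_prefix[of "u @ [(a, b)]" w "u @ ab # w"] ab by simp
    then have "walk lim_graph (cls (u @ [(a, b)])) w x"
      using Cons.IH[OF **] * ab by simp
    moreover have "{(cls u, a), (cls (u @ [(a, b)]), b)} \<in> edges lim_graph"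
      using lim_edge_iff[OF Cons.prems **] ** edges by simp
    ultimately show "walk lim_graph (cls u) (ab # w) x" using ab by auto
  qed
qed auto

lemma lim_walk_pointer: "walk lim_graph (pointer lim_graph) w x \<longleftrightarrow> E w w \<and> x = cls w"
  using lim_walk[OF E_Nil] by (simp add: lim_graph_def)

lemma same_lim: "same lim_graph w w' \<longleftrightarrow> E w w'"
  unfolding same_def lim_walk_pointer using cls_eq E_refl by metis

lemma E_in_lists:
  assumes "E w w" shows "w \<in> lists (\<pi> \<times> \<pi>)"
proof -
  obtain n where "same (Gs n) w w" using E_happens[OF assms] .
  then show ?thesis using walk_in_lists[OF over] by (metis same_refl_iff)
qed

lemma pointed_lim: "pointed_graph lim_graph"
  unfolding pointed_graph_def
proof (intro conjI ballI)
  have edges: "edges lim_graph = lim_edges" and verts: "verts lim_graph = cls ` {w. E w w}"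
    by (simp_all add: lim_graph_def)
  have "countable (lists (\<pi> \<times> \<pi>))"
    using finite_ports by (intro countable_lists countable_finite) simp
  then have "countable {w. E w w}"
    by (rule countable_subset[rotated]) (use E_in_lists in blast)
  then show "countable (verts lim_graph)"
    unfolding verts by (rule countable_image)
  show "card e = 2" "fst ` e \<subseteq> verts lim_graph" if e: "e \<in> edges lim_graph" for e
  proof -
    obtain w w' a b where w: "e = {(cls w, a), (cls w', b)}" "E w w" "E w' w'"
        "(cls w, a) \<noteq> (cls w', b)"
      using lim_edge_cases[OF e[unfolded edges]] by metis
    then show "card e = 2" by (metis card_2_iff)
    show "fst ` e \<subseteq> verts lim_graph" using w(1-3) unfolding verts by auto
  qed
  show "pairwise disjnt (edges lim_graph)"
  proof (rule pairwiseI, rule ccontr)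
    fix e e' assume e: "e \<in> edges lim_graph" "e' \<in> edges lim_graph" "e \<noteq> e'" "\<not> disjnt e e'"
    then obtain x c where xc: "(x, c) \<in> e" "(x, c) \<in> e'" by (auto simp: disjnt_def)
    \<comment> \<open>Edges are unordered, so each of the two is turned to put the shared pair
      \<open>(x, c)\<close> first.\<close>
    have *: "\<exists>w w' d. E w w \<and> E w' w' \<and> x = cls w \<and> f = {(cls w, c), (cls w', d)} \<and> E (w @ [(c, d)]) w'"
      if f: "f \<in> edges lim_graph" "(x, c) \<in> f" for f
      using f(1)[unfolded edges]
    proof (rule lim_edge_cases)
      fix w w' a b assume w: "f = {(cls w, a), (cls w', b)}" "E w w" "E w' w'" "E (w @ [(a, b)]) w'"
      with f(2) consider "x = cls w" "c = a" | "x = cls w'" "c = b" by auto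
      then show ?thesis
      proof cases
        case 1
        with w show ?thesis by blast
      next
        case 2
        moreover have "f = {(cls w', b), (cls w, a)}" using w(1) by (simp add: insert_commute)
        ultimately show ?thesis using E_back[OF w(4)] w(2,3) by blast
      qed
    qed
    obtain w w' d where w: "E w w" "E w' w'" "x = cls w" "e = {(cls w, c), (cls w', d)}"
        "E (w @ [(c, d)]) w'" using *[OF e(1) xc(1)] by blast
    obtain y y' d' where y: "E y y" "E y' y'" "x = cls y" "e' = {(cls y, c), (cls y', d')}"
        "E (y @ [(c, d')]) y'" using *[OF e(2) xc(2)] by blast
    have "E y w" using cls_eq w y by metis
    then have *: "E (w @ [(c, d')]) y'" using E_append y(5) by blast
    have d: "d = d'" using step_unique[OF w(5) *] .
    then have "E w' y'" using * w(5) E_sym E_trans by blast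
    then have "e = e'" using w y d cls_eq by metis
    with e(3) show False by simp
  qed
  show "dom (vlab lim_graph) \<subseteq> verts lim_graph" "dom (elab lim_graph) \<subseteq> edges lim_graph"
    by (auto simp: lim_graph_def split: if_splits)
  show "pointer lim_graph \<in> verts lim_graph" using E_Nil by (auto simp: lim_graph_def)
  fix u v assume "u \<in> verts lim_graph" "v \<in> verts lim_graph"
  then obtain w w' where "walk lim_graph (pointer lim_graph) w u" "walk lim_graph (pointer lim_graph) w' v"
    unfolding verts lim_walk_pointer by blast
  then have "walk lim_graph u (rev (map prod.swap w) @ w') v"
    using walk_rev walk_append by metis
  then show "\<exists>w. walk lim_graph u w v" by blast
qed

lemma vlab_lim:
  assumes "E w w"
  shows "\<forall>\<^sub>F n in sequentially. vlabs (Gs n) w = {vlab lim_graph (cls w)}"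
proof -
  obtain c where c: "\<forall>\<^sub>F n in sequentially. vlabs (Gs n) w = c" using vlabs_decided by blast
  with assms have "\<forall>\<^sub>F n in sequentially. same (Gs n) w w \<and> vlabs (Gs n) w = c"
    unfolding E_def by (rule eventually_conj)
  from eventually_happens'[OF sequentially_bot this]
  obtain n where n: "same (Gs n) w w" "vlabs (Gs n) w = c" by blast
  then obtain v where "walk (Gs n) (pointer (Gs n)) w v" by (auto simp: same_def)
  \<comment> \<open>The eventual value is a singleton because \<open>w\<close> is a path in the
    graph with index \<open>n\<close>.\<close>
  from vlabs_singleton[OF pointed this] n(2) obtain d where "c = {d}" by blast
  with c have d: "\<forall>\<^sub>F n in sequentially. vlabs (Gs n) w = {d}" by simp
  have "(THE c. \<exists>w'. cls w = cls w' \<and> E w' w' \<and> (\<forall>\<^sub>F n in sequentially. vlabs (Gs n) w' = {c})) = d"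
  proof (rule the_equality)
    show "\<exists>w'. cls w = cls w' \<and> E w' w' \<and> (\<forall>\<^sub>F n in sequentially. vlabs (Gs n) w' = {d})"
      using assms d by blast
    fix d' assume "\<exists>w'. cls w = cls w' \<and> E w' w' \<and> (\<forall>\<^sub>F n in sequentially. vlabs (Gs n) w' = {d'})"
    then obtain w' where w': "E w w'" "\<forall>\<^sub>F n in sequentially. vlabs (Gs n) w' = {d'}"
      using cls_eq[OF assms] by blast
    have "\<forall>\<^sub>F n in sequentially. d' = d"
      using d w'(2) w'(1)[unfolded E_def]
      by eventually_elim (use vlabs_cong[OF pointed] in auto)
    then show "d' = d" by simp
  qed
  then have "vlab lim_graph (cls w) = d" using assms by (auto simp: lim_graph_def)
  with d show ?thesis by simp
qed

lemma elab_lim: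
  assumes wab: "E (w @ [(a, b)]) (w @ [(a, b)])"
  shows "\<forall>\<^sub>F n in sequentially.
    elabs (Gs n) w a b = {elab lim_graph {(cls w, a), (cls (w @ [(a, b)]), b)}}"
proof -
  let ?e = "{(cls w, a), (cls (w @ [(a, b)]), b)}"
  have w: "E w w" using E_prefix[OF wab] .
  obtain c where c: "\<forall>\<^sub>F n in sequentially. elabs (Gs n) w a b = c" using elabs_decided by blast
  with wab have "\<forall>\<^sub>F n in sequentially. same (Gs n) (w @ [(a, b)]) (w @ [(a, b)]) \<and> elabs (Gs n) w a b = c"
    unfolding E_def by (rule eventually_conj)
  from eventually_happens'[OF sequentially_bot this]
  obtain n where n: "same (Gs n) (w @ [(a, b)]) (w @ [(a, b)])" "elabs (Gs n) w a b = c" by blast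
  then obtain u v where "walk (Gs n) (pointer (Gs n)) w u" "{(u, a), (v, b)} \<in> edges (Gs n)"
    by (auto simp: same_def walk_append)
  from elabs_singleton[OF pointed this] n(2) obtain d where "c = {d}" by blast
  with c have d: "\<forall>\<^sub>F n in sequentially. elabs (Gs n) w a b = {d}" by simp
  have "(THE c. \<exists>w' a' b'. ?e = {(cls w', a'), (cls (w' @ [(a', b')]), b')} \<and>
      E (w' @ [(a', b')]) (w' @ [(a', b')]) \<and>
      (\<forall>\<^sub>F n in sequentially. elabs (Gs n) w' a' b' = {c})) = d"
  proof (rule the_equality)
    show "\<exists>w' a' b'. ?e = {(cls w', a'), (cls (w' @ [(a', b')]), b')} \<and>
      E (w' @ [(a', b')]) (w' @ [(a', b')]) \<and>
      (\<forall>\<^sub>F n in sequentially. elabs (Gs n) w' a' b' = {d})"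
      using wab d by blast
    fix d' assume "\<exists>w' a' b'. ?e = {(cls w', a'), (cls (w' @ [(a', b')]), b')} \<and>
      E (w' @ [(a', b')]) (w' @ [(a', b')]) \<and>
      (\<forall>\<^sub>F n in sequentially. elabs (Gs n) w' a' b' = {d'})"
    then obtain w' a' b' where w': "?e = {(cls w', a'), (cls (w' @ [(a', b')]), b')}"
      "E (w' @ [(a', b')]) (w' @ [(a', b')])"
      "\<forall>\<^sub>F n in sequentially. elabs (Gs n) w' a' b' = {d'}" by blast
    from w'(1) consider "cls w = cls w'" "a = a'" "b = b'"
      | "cls (w @ [(a, b)]) = cls w'" "a = b'" "b = a'"
      by (auto simp: doubleton_eq_iff)
    then have "\<forall>\<^sub>F n in sequentially. elabs (Gs n) w a b = elabs (Gs n) w' a' b'"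
    proof cases
      case 1
      then have "E w w'" using cls_eq w by blast
      then show ?thesis unfolding E_def
        by eventually_elim (use elabs_cong[OF pointed] 1 in auto)
    next
      case 2
      then have "E (w @ [(a, b)]) w'" using cls_eq wab by blast
      then show ?thesis unfolding E_def
        by eventually_elim (use elabs_back[OF pointed] 2 in auto)
    qed
    with d w'(3) have "\<forall>\<^sub>F n in sequentially. d' = d"
      by eventually_elim auto
    then show "d' = d" by simp
  qed
  moreover have "?e \<in> lim_edges" using wab by (auto simp: lim_edges_def)
  ultimately have "elab lim_graph ?e = d" by (simp add: lim_graph_def)
  with d show ?thesis by simp
qed

lemma eventually_same: "\<forall>\<^sub>F n in sequentially. same (Gs n) w w' \<longleftrightarrow> same lim_graph w w'"
proof (cases "E w w'")
  case True
  then show ?thesis using same_lim by (simp add: E_def)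
next
  case False
  then show ?thesis using same_lim not_E by simp
qed

lemma eventually_vlabs: "\<forall>\<^sub>F n in sequentially. vlabs (Gs n) w = vlabs lim_graph w"
proof (cases "E w w")
  case True
  then have "vlabs lim_graph w = {vlab lim_graph (cls w)}"
    using vlabs_singleton[OF pointed_lim] lim_walk_pointer by blast
  then show ?thesis using vlab_lim[OF True] by simp
next
  case False
  then have "vlabs lim_graph w = {}" using vlabs_empty[of lim_graph w] same_lim by simp
  with not_E[OF False] show ?thesis
    by (auto elim!: eventually_mono simp: vlabs_empty)
qed

lemma eventually_elabs: "\<forall>\<^sub>F n in sequentially. elabs (Gs n) w a b = elabs lim_graph w a b"
proof (cases "E (w @ [(a, b)]) (w @ [(a, b)])")
  case True
  then have "{(cls w, a), (cls (w @ [(a, b)]), b)} \<in> edges lim_graph"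
    by (auto simp: lim_graph_def lim_edges_def)
  then have "elabs lim_graph w a b = {elab lim_graph {(cls w, a), (cls (w @ [(a, b)]), b)}}"
    using elabs_singleton[OF pointed_lim] lim_walk_pointer E_prefix[OF True] by blast
  then show ?thesis using elab_lim[OF True] by simp
next
  case False
  then have "elabs lim_graph w a b = {}" using elabs_empty[of lim_graph w a b] same_lim by simp
  with not_E[OF False] show ?thesis
    by (auto elim!: eventually_mono simp: elabs_empty)
qed

text \<open>Each label of the limit is an eventual value of a code and so occurs in some graph of
  the sequence; likewise each path of the limit is a path of some graph of the sequence.\<close>

lemma over_lim: "pointed_graph_over \<Sigma> \<Delta> \<pi> lim_graph"
  unfolding pointed_graph_over_def
proof (intro conjI ballI pointed_lim)
  fix e assume "e \<in> edges lim_graph"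
  then obtain w a b where "e = {(cls w, a), (cls (w @ [(a, b)]), b)}" "E (w @ [(a, b)]) (w @ [(a, b)])"
    by (auto simp: lim_graph_def lim_edges_def)
  with E_in_lists[of "w @ [(a, b)]"] show "snd ` e \<subseteq> \<pi>" by auto
next
  show "ran (vlab lim_graph) \<subseteq> \<Sigma>"
  proof
    fix c assume "c \<in> ran (vlab lim_graph)"
    then obtain x where x: "vlab lim_graph x = Some c" by (auto simp: ran_def)
    then have "x \<in> verts lim_graph" using pointed_lim by (auto simp: pointed_graph_def)
    then obtain w where w: "x = cls w" "E w w" by (auto simp: lim_graph_def)
    have "vlab lim_graph (cls w) = Some c" using w x by simp
    with eventually_happens'[OF sequentially_bot vlab_lim[OF w(2)]]
    obtain n where "vlabs (Gs n) w = {Some c}" by metis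
    then have "Some c \<in> vlabs (Gs n) w" by simp
    then have "\<exists>v. vlab (Gs n) v = Some c" unfolding vlabs_def by force
    then show "c \<in> \<Sigma>" using over[of n] by (auto simp: pointed_graph_over_def ran_def)
  qed
  show "ran (elab lim_graph) \<subseteq> \<Delta>"
  proof
    fix c assume "c \<in> ran (elab lim_graph)"
    then obtain e where e: "elab lim_graph e = Some c" by (auto simp: ran_def)
    then have "e \<in> edges lim_graph" using pointed_lim by (auto simp: pointed_graph_def)
    then obtain w a b where w: "e = {(cls w, a), (cls (w @ [(a, b)]), b)}"
      "E (w @ [(a, b)]) (w @ [(a, b)])"
      by (auto simp: lim_graph_def lim_edges_def)
    have "elab lim_graph {(cls w, a), (cls (w @ [(a, b)]), b)} = Some c" using w e by simp
    with eventually_happens'[OF sequentially_bot elab_lim[OF w(2)]]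
    obtain n where "elabs (Gs n) w a b = {Some c}" by metis
    then have "Some c \<in> elabs (Gs n) w a b" by simp
    then have "\<exists>v. elab (Gs n) v = Some c" unfolding elabs_def by force
    then show "c \<in> \<Delta>" using over[of n] by (auto simp: pointed_graph_over_def ran_def)
  qed
qed

end

text \<open>With finite alphabets each code takes finitely many values at each argument, and there
  are countably many words over \<open>\<pi>\<close>, so a diagonal subsequence makes all codes
  eventually constant. Convergence is stated as agreement on balls with all labels kept, not as
  equality of disks: in this form \<open>agree_on_att\<close> can attach the trees to it.\<close>

lemma graph_compactness:
  fixes Gs :: "nat \<Rightarrow> ('v, 'p, 's, 'd) pgraph"
  assumes fin: "finite \<Sigma>" "finite \<Delta>" "finite \<pi>"
    and Gs: "\<And>n. pointed_graph_over \<Sigma> \<Delta> \<pi> (Gs n)"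
  obtains s :: "nat \<Rightarrow> nat" and L :: "(nat, 'p, 's, 'd) pgraph"
  where "strict_mono s" "pointed_graph_over \<Sigma> \<Delta> \<pi> L"
    "\<And>k. \<forall>\<^sub>F n in sequentially. \<exists>f. agree_on (ball_of L k) f L (Gs (s n)) \<and>
       f ` ball_of L k = ball_of (Gs (s n)) k \<and> f (pointer L) = pointer (Gs (s n))"
proof -
  have pG: "pointed_graph (Gs n)" for n using Gs by (simp add: pointed_graph_over_def)
  define ws where "ws = lists (\<pi> \<times> \<pi>)"
  \<comment> \<open>The third component treats the first word as a word followed by a letter
    \<open>(a, b)\<close>; at the empty word it is an arbitrary value from the same finite
    range.\<close>
  define c where "c n = (\<lambda>(w, w'). (same (Gs n) w w', vlabs (Gs n) w,
     elabs (Gs n) (butlast w) (fst (last w)) (snd (last w))))" for n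
  have labels: "vlabs (Gs n) w \<subseteq> insert None (Some ` \<Sigma>)"
      "elabs (Gs n) w a b \<subseteq> insert None (Some ` \<Delta>)" for n w a b
  proof -
    have v: "vlab (Gs n) v \<in> insert None (Some ` \<Sigma>)" for v
      using Gs[of n] by (cases "vlab (Gs n) v") (auto simp: pointed_graph_over_def ran_def)
    have e: "elab (Gs n) e \<in> insert None (Some ` \<Delta>)" for e
      using Gs[of n] by (cases "elab (Gs n) e") (auto simp: pointed_graph_over_def ran_def)
    show "vlabs (Gs n) w \<subseteq> insert None (Some ` \<Sigma>)"
      by (rule subsetI, unfold vlabs_def, elim CollectE exE conjE) (simp only: v)
    show "elabs (Gs n) w a b \<subseteq> insert None (Some ` \<Delta>)"
      by (rule subsetI, unfold elabs_def, elim CollectE exE conjE) (simp only: e)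
  qed
  have cnt: "countable (ws \<times> ws)"
    using fin(3) unfolding ws_def by (intro countable_SIGMA countable_lists countable_finite) auto
  have fin_c: "finite (range (\<lambda>n. c n x))" if "x \<in> ws \<times> ws" for x
  proof (rule finite_subset)
    show "range (\<lambda>n. c n x) \<subseteq>
        UNIV \<times> Pow (insert None (Some ` \<Sigma>)) \<times> Pow (insert None (Some ` \<Delta>))"
      using labels by (intro image_subsetI) (simp add: c_def case_prod_beta)
    show "finite ((UNIV :: bool set) \<times> Pow (insert None (Some ` \<Sigma>)) \<times> Pow (insert None (Some ` \<Delta>)))"
      using fin by simp
  qed
  have "\<exists>s :: nat \<Rightarrow> nat. strict_mono s \<and>
      (\<forall>x \<in> ws \<times> ws. \<exists>a. \<forall>\<^sub>F n in sequentially. c (s n) x = a)"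
    by (rule eventually_constant_subseq[OF cnt fin_c]) auto
  then obtain s :: "nat \<Rightarrow> nat" where s: "strict_mono s"
      "\<And>x. x \<in> ws \<times> ws \<Longrightarrow> \<exists>a. \<forall>\<^sub>F n in sequentially. c (s n) x = a"
    by blast
  \<comment> \<open>Words using a port outside \<open>\<pi>\<close> are never paths, so their codes
    are constant from the start.\<close>
  have not_same: "\<not> same (Gs n) w w" "\<not> same (Gs n) w w'" "\<not> same (Gs n) w' w"
    if "w \<notin> ws" for n w w'
    using that walk_in_lists[OF Gs, of n] unfolding same_def ws_def by blast+
  have decided: "\<exists>a. \<forall>\<^sub>F n in sequentially. c (s n) (w, w') = a" if "w \<in> ws" "w' \<in> ws" for w w'
    using s(2) that by blast
  interpret converging_graphs "Gs \<circ> s" \<Sigma> \<Delta> \<pi>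
  proof
    show "pointed_graph_over \<Sigma> \<Delta> \<pi> ((Gs \<circ> s) n)" for n using Gs by simp
    show "finite \<pi>" by fact
    show "(\<forall>\<^sub>F n in sequentially. same ((Gs \<circ> s) n) w w') \<or>
        (\<forall>\<^sub>F n in sequentially. \<not> same ((Gs \<circ> s) n) w w')" for w w'
    proof (cases "w \<in> ws \<and> w' \<in> ws")
      case True
      then obtain a where a: "\<forall>\<^sub>F n in sequentially. c (s n) (w, w') = a" using decided by blast
      then have "\<forall>\<^sub>F n in sequentially. same (Gs (s n)) w w' = fst a"
        by eventually_elim (auto simp: c_def)
      then show ?thesis by (cases "fst a") auto
    qed (use not_same in auto)
    show "\<exists>a. \<forall>\<^sub>F n in sequentially. vlabs ((Gs \<circ> s) n) w = a" for w
    proof (cases "w \<in> ws")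
      case True
      then obtain a where a: "\<forall>\<^sub>F n in sequentially. c (s n) (w, w) = a" using decided by blast
      then have "\<forall>\<^sub>F n in sequentially. vlabs (Gs (s n)) w = fst (snd a)"
        by eventually_elim (auto simp: c_def)
      then show ?thesis by auto
    next
      case False
      then have "vlabs (Gs n) w = {}" for n using vlabs_empty not_same by blast
      then show ?thesis by simp
    qed
    show "\<exists>x. \<forall>\<^sub>F n in sequentially. elabs ((Gs \<circ> s) n) w a b = x" for w a b
    proof (cases "w @ [(a, b)] \<in> ws")
      case True
      then obtain x where x: "\<forall>\<^sub>F n in sequentially. c (s n) (w @ [(a, b)], w @ [(a, b)]) = x"
        using decided by blast
      then have "\<forall>\<^sub>F n in sequentially. elabs (Gs (s n)) w a b = snd (snd x)"
        by eventually_elim (auto simp: c_def)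
      then show ?thesis by auto
    next
      case False
      then have "elabs (Gs n) w a b = {}" for n using elabs_empty not_same by metis
      then show ?thesis by simp
    qed
  qed
  obtain L :: "(nat, 'p, 's, 'd) pgraph" where L: "pointed_graph_over \<Sigma> \<Delta> \<pi> L" "isomorphic lim_graph L"
    using nat_copy[OF over_lim] by metis
  have pL: "pointed_graph L" using L(1) by (simp add: pointed_graph_over_def)
  note iso = pointed_lim pL L(2)
  have not_same_L: "\<not> same L w w'" "\<not> same L w w" if "w \<notin> ws" for w w'
    using that walk_in_lists[OF L(1)] unfolding same_def ws_def by blast+
  have "\<forall>\<^sub>F n in sequentially. \<exists>f. agree_on (ball_of L k) f L (Gs (s n)) \<and>
       f ` ball_of L k = ball_of (Gs (s n)) k \<and> f (pointer L) = pointer (Gs (s n))" for k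
  proof -
    \<comment> \<open>Finitely many words name all vertices of the ball, so the finitely many
      eventual equalities between codes hold simultaneously from some index on.\<close>
    define W where "W = {w. set w \<subseteq> \<pi> \<times> \<pi> \<and> length w \<le> k}"
    have finW: "finite W" unfolding W_def using fin(3) by (intro finite_lists_length_le) simp
    have W: "w \<in> W \<longleftrightarrow> w \<in> ws \<and> length w \<le> k" for w by (auto simp: W_def ws_def in_lists_conv_set)
    have ball: "{v. \<exists>w\<in>W. walk K (pointer K) w v} = ball_of K k" if "pointed_graph_over \<Sigma> \<Delta> \<pi> K"
      for K :: "('x, 'p, 's, 'd) pgraph"
      unfolding ball_of_def using W walk_in_lists[OF that] ws_def by blast
    have "\<forall>\<^sub>F n in sequentially. \<forall>w\<in>W. \<forall>w'\<in>W. same (Gs (s n)) w w' = same L w w'"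
      using eventually_same finW isomorphic_same[OF iso] by (intro eventually_ball_finite ballI) auto
    moreover have "\<forall>\<^sub>F n in sequentially. \<forall>w\<in>W. vlabs (Gs (s n)) w = vlabs L w"
      using eventually_vlabs finW isomorphic_vlabs[OF iso] by (intro eventually_ball_finite ballI) auto
    moreover have "\<forall>\<^sub>F n in sequentially. \<forall>w\<in>W. \<forall>a\<in>\<pi>. \<forall>b\<in>\<pi>. elabs (Gs (s n)) w a b = elabs L w a b"
      using eventually_elabs finW fin(3) isomorphic_elabs[OF iso]
      by (intro eventually_ball_finite ballI) auto
    moreover have "\<forall>\<^sub>F n in sequentially. \<forall>w\<in>W. \<forall>w'\<in>W. \<forall>a\<in>\<pi>. \<forall>b\<in>\<pi>.
        same (Gs (s n)) (w @ [(a, b)]) w' = same L (w @ [(a, b)]) w'"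
      using eventually_same finW fin(3) isomorphic_same[OF iso]
      by (intro eventually_ball_finite ballI) auto
    ultimately show ?thesis
    proof eventually_elim
      case (elim n)
      have ports: "a \<in> \<pi> \<and> b \<in> \<pi>" if "w @ [(a, b)] \<in> ws" for w a b
        using that by (auto simp: ws_def)
      have "\<exists>f. agree_on {v. \<exists>w\<in>W. walk L (pointer L) w v} f L (Gs (s n)) \<and>
          f ` {v. \<exists>w\<in>W. walk L (pointer L) w v} =
            {v. \<exists>w\<in>W. walk (Gs (s n)) (pointer (Gs (s n))) w v} \<and>
          f (pointer L) = pointer (Gs (s n))"
      proof (rule agree_on_words[OF pL pG[of "s n"], of W])
        show "[] \<in> W" by (simp add: W_def)
        show "same L w w' = same (Gs (s n)) w w'" if "w \<in> W" "w' \<in> W" for w w'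
          using elim(1) that by blast
        show "same L (w @ [(a, b)]) w' = same (Gs (s n)) (w @ [(a, b)]) w'"
          if "w \<in> W" "w' \<in> W" for w w' a b
          using elim(4) that ports not_same not_same_L by metis
        show "vlabs L w = vlabs (Gs (s n)) w" if "w \<in> W" for w
          using elim(2) that by simp
        show "elabs L w a b = elabs (Gs (s n)) w a b" if "w \<in> W" for w a b
          using elim(3) that ports not_same not_same_L elabs_empty by metis
      qed blast
      then show ?case unfolding ball[OF L(1)] ball[OF Gs] .
    qed
  qed
  with that s(1) L(1) show ?thesis by blast
qed

text \<open>Only the ports are tracked: attaching trees is sound as soon as the ports of the base
  graph avoid \<open>m\<close>, \<open>l\<close> and \<open>r\<close>, whatever its labels.\<close>

lemma pointed_graph_over_iso:
  assumes "pointed_graph_over UNIV UNIV \<pi> G" "pointed_graph K" "isomorphic G K"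
  shows "pointed_graph_over UNIV UNIV \<pi> K"
proof -
  obtain f where f: "edges K = (\<lambda>e. map_prod f id ` e) ` edges G"
    using assms(3) unfolding isomorphic_def by blast
  have "snd ` e \<subseteq> \<pi>" if e: "e \<in> edges K" for e
  proof -
    obtain e' where "e' \<in> edges G" "e = map_prod f id ` e'" using e f by blast
    moreover have "snd ` (map_prod f id ` e') = snd ` e'" by (simp add: image_image)
    ultimately show ?thesis using assms(1) by (simp add: pointed_graph_over_def)
  qed
  then show ?thesis using assms(2) by (simp add: pointed_graph_over_def)
qed

section \<open>Attaching invisible matter\<close>

locale invisible_matter =
  fixes \<Sigma> :: "'s set" and \<Delta> :: "'d set" and \<pi> :: "'p set" and \<mu> :: 's and m l r :: 'p
  assumes finite_alphabets: "finite \<Sigma>" "finite \<Delta>" "finite \<pi>"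
    and fresh: "m \<notin> \<pi>" "l \<notin> \<pi>" "r \<notin> \<pi>" "m \<noteq> l" "m \<noteq> r" "l \<noteq> r"
begin

section \<open>The graph with trees attached: vertices, edges, walks\<close>

abbreviation T :: "'p word set" where "T \<equiv> lists {(l, m), (r, m)}"

abbreviation att :: "('v, 'p, 's, 'd) pgraph \<Rightarrow> (('v, 'p) im_vertex, 'p, 's, 'd) pgraph" where
  "att \<equiv> attach_graph \<mu> m l r"

text \<open>Holds for both orientations of the unordered edge between a parent and its child, so
  that adjacency in the attached graph is decided by comparing endpoints, as in
  \<open>att_edge_iff\<close>.\<close>

definition tree_edge :: "'p word \<Rightarrow> 'p \<Rightarrow> 'p word \<Rightarrow> 'p \<Rightarrow> bool" where
  "tree_edge s a t b \<longleftrightarrow>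
     s \<in> T \<and> a \<in> {l, r} \<and> b = m \<and> t = s @ [(a, m)] \<or>
     t \<in> T \<and> b \<in> {l, r} \<and> a = m \<and> s = t @ [(b, m)]"

lemma tree_edge_in_T: "tree_edge s a t b \<Longrightarrow> s \<in> T \<and> t \<in> T"
  by (auto simp: tree_edge_def)

lemma att_simps [simp]:
  "verts (att G) = Vis ` verts G \<union> {Inv v s | v s. v \<in> verts G \<and> s \<in> T}"
  "pointer (att G) = Vis (pointer G)"
  "vlab (att G) (Vis v) = vlab G v"
  "vlab (att G) (Inv v s) = (if v \<in> verts G \<and> s \<in> T then Some \<mu> else None)"
  by (simp_all add: attach_graph_def matter_tree_def)

lemma edges_att:
  "edges (att G) = (\<lambda>e. map_prod Vis id ` e) ` edges G
     \<union> {{(Vis v, m), (Inv v [], m)} | v. v \<in> verts G}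
     \<union> {{(Inv v s, a), (Inv v t, b)} | v s a t b. v \<in> verts G \<and> tree_edge s a t b}" (is "?L = ?R")
proof -
  have "{map_prod (Inv v) id ` e | v e. v \<in> verts G \<and>
          e \<in> {{(s, a), (s @ [(a, m)], m)} | s a. s \<in> T \<and> a \<in> {l, r}}} =
        {{(Inv v s, a), (Inv v t, b)} | v s a t b. v \<in> verts G \<and> tree_edge s a t b}" (is "?A = ?B")
  proof
    show "?A \<subseteq> ?B"
      unfolding tree_edge_def by (auto, blast+)
    show "?B \<subseteq> ?A"
    proof
      fix e assume "e \<in> ?B"
      then obtain v s a t b where e: "e = {(Inv v s, a), (Inv v t, b)}" "v \<in> verts G" "tree_edge s a t b"
        by blast
      then have "\<exists>s a. s \<in> T \<and> a \<in> {l, r} \<and> e = map_prod (Inv v) id ` {(s, a), (s @ [(a, m)], m)}"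
        unfolding tree_edge_def by (auto simp: insert_commute)
      with e(2) show "e \<in> ?A" by blast
    qed
  qed
  then show ?thesis by (simp add: attach_graph_def matter_tree_def)
qed

lemma vis_image_eq_iff:
  fixes u v :: 'v and a b :: 'p
  shows "{(Vis u :: ('v, 'q) im_vertex, a), (Vis v, b)} = map_prod Vis id ` e \<longleftrightarrow> e = {(u, a), (v, b)}"
proof -
  have "inj (map_prod (Vis :: 'v \<Rightarrow> ('v, 'q) im_vertex) (id :: 'p \<Rightarrow> 'p))"
    by (intro prod.inj_map injI) auto
  from inj_image_eq_iff[OF this, of "{(u, a), (v, b)}" e] show ?thesis
    by (simp only: image_insert image_empty map_prod_simp id_apply) blast
qed

lemma inv_not_in_vis_image: "(Inv v s, b) \<in> e \<Longrightarrow> e \<noteq> map_prod Vis id ` e'"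
  by auto

lemma att_edge_iff [simp]:
  "{(Vis u, a), (Vis v, b)} \<in> edges (att G) \<longleftrightarrow> {(u, a), (v, b)} \<in> edges G"
  "{(Vis u, a), (Inv v s, b)} \<in> edges (att G) \<longleftrightarrow>
     u = v \<and> v \<in> verts G \<and> s = [] \<and> a = m \<and> b = m"
  "{(Inv v s, b), (Vis u, a)} \<in> edges (att G) \<longleftrightarrow>
     u = v \<and> v \<in> verts G \<and> s = [] \<and> a = m \<and> b = m"
  "{(Inv u s, a), (Inv v t, b)} \<in> edges (att G) \<longleftrightarrow> u = v \<and> v \<in> verts G \<and> tree_edge s a t b"
proof -
  show "{(Vis u, a), (Vis v, b)} \<in> edges (att G) \<longleftrightarrow> {(u, a), (v, b)} \<in> edges G"
    unfolding edges_att Un_iff image_iff vis_image_eq_iff by (simp add: doubleton_eq_iff)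
  show VI: "{(Vis u, a), (Inv v s, b)} \<in> edges (att G) \<longleftrightarrow>
     u = v \<and> v \<in> verts G \<and> s = [] \<and> a = m \<and> b = m" for u a v s b
  proof -
    have "{(Vis u, a), (Inv v s, b)} \<notin> (\<lambda>e. map_prod Vis id ` e) ` edges G"
      using inv_not_in_vis_image[of v s b "{(Vis u, a), (Inv v s, b)}"] by auto
    then show ?thesis unfolding edges_att Un_iff by (simp add: doubleton_eq_iff) blast
  qed
  show "{(Inv v s, b), (Vis u, a)} \<in> edges (att G) \<longleftrightarrow>
     u = v \<and> v \<in> verts G \<and> s = [] \<and> a = m \<and> b = m"
    using VI by (simp add: insert_commute)
  have "{(Inv u s, a), (Inv v t, b)} \<notin> (\<lambda>e. map_prod Vis id ` e) ` edges G"
    using inv_not_in_vis_image[of v t b "{(Inv u s, a), (Inv v t, b)}"] by auto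
  moreover have "tree_edge s a t b \<longleftrightarrow> tree_edge t b s a"
    by (auto simp: tree_edge_def)
  ultimately show "{(Inv u s, a), (Inv v t, b)} \<in> edges (att G) \<longleftrightarrow>
      u = v \<and> v \<in> verts G \<and> tree_edge s a t b"
    unfolding edges_att Un_iff by (simp add: doubleton_eq_iff) blast
qed

lemma elab_att:
  "elab (att G) {(Vis u, a), (Vis v, b)} =
     (if {(u, a), (v, b)} \<in> edges G then elab G {(u, a), (v, b)} else None)"
  "elab (att G) {(Vis u, a), (Inv v s, b)} = None"
  "elab (att G) {(Inv v s, b), (Vis u, a)} = None"
  "elab (att G) {(Inv u s, a), (Inv v t, b)} = None"
proof -
  have elab: "elab (att G) e = (if e \<in> (\<lambda>e. map_prod Vis id ` e) ` edges G
      then elab G (map_prod Vis id -` e) else None)" for e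
    by (simp add: attach_graph_def Let_def)
  have "map_prod Vis id -` {(Vis u :: ('a, 'p) im_vertex, a), (Vis v, b)} = {(u, a), (v, b)}"
    by auto
  moreover have "{(Vis u :: ('a, 'p) im_vertex, a), (Vis v, b)} \<in> (\<lambda>e. map_prod Vis id ` e) ` edges G \<longleftrightarrow>
      {(u, a), (v, b)} \<in> edges G"
    by (simp only: image_iff vis_image_eq_iff) blast
  ultimately show "elab (att G) {(Vis u, a), (Vis v, b)} =
     (if {(u, a), (v, b)} \<in> edges G then elab G {(u, a), (v, b)} else None)"
    by (simp add: elab)
  have "e \<notin> (\<lambda>e. map_prod Vis id ` e) ` edges G" if "(Inv v s, b) \<in> e"
    for e :: "(('a, 'p) im_vertex \<times> 'p) set" and v s b
    using that by auto
  then show "elab (att G) {(Vis u, a), (Inv v s, b)} = None"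
    "elab (att G) {(Inv v s, b), (Vis u, a)} = None"
    "elab (att G) {(Inv u s, a), (Inv v t, b)} = None"
    unfolding elab by (metis insertCI)+
qed

lemma att_edge_cases:
  assumes G: "pointed_graph G" and e: "e \<in> edges (att G)"
  obtains x a y b where "e = {(x, a), (y, b)}" "(x, a) \<noteq> (y, b)"
    "x \<in> verts (att G)" "y \<in> verts (att G)"
proof -
  from e[unfolded edges_att] consider
      e' where "e' \<in> edges G" "e = map_prod Vis id ` e'"
    | v where "e = {(Vis v, m), (Inv v [], m)}" "v \<in> verts G"
    | v s a t b where "e = {(Inv v s, a), (Inv v t, b)}" "v \<in> verts G" "tree_edge s a t b"
    by blast
  then show ?thesis
  proof cases
    case 1
    obtain u a v b where "e' = {(u, a), (v, b)}" "(u, a) \<noteq> (v, b)" "u \<in> verts G" "v \<in> verts G"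
      using edge_cases[OF G 1(1)] .
    with 1(2) that[of "Vis u" a "Vis v" b] show ?thesis by simp
  next
    case 2
    with that[of "Vis v" m "Inv v []" m] show ?thesis by simp
  next
    case 3
    with that[of "Inv v s" a "Inv v t" b] tree_edge_in_T[OF 3(3)] show ?thesis
      by (auto simp: tree_edge_def)
  qed
qed

lemma walk_att_Vis: "walk G u w v \<Longrightarrow> walk (att G) (Vis u) w (Vis v)"
  by (induction G u w v rule: walk.induct) (auto simp del: att_simps, metis att_edge_iff(1))

lemma walk_att_Inv:
  "v \<in> verts G \<Longrightarrow> s \<in> T \<Longrightarrow> t \<in> T \<Longrightarrow> walk (att G) (Inv v s) t (Inv v (s @ t))"
proof (induction t arbitrary: s)
  case (Cons x t)
  obtain a where x: "x = (a, m)" "a \<in> {l, r}" using Cons.prems(3) by auto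
  then have "tree_edge s a (s @ [x]) m" using Cons.prems(2) by (auto simp: tree_edge_def)
  moreover have "walk (att G) (Inv v (s @ [x])) t (Inv v ((s @ [x]) @ t))"
    using Cons.prems by (intro Cons.IH) auto
  ultimately show ?case
    using Cons.prems(1) unfolding x(1) walk.simps by (intro exI[of _ "Inv v (s @ [(a, m)])"]) simp
qed auto

lemma walk_att_enter:
  "v \<in> verts G \<Longrightarrow> s \<in> T \<Longrightarrow> walk (att G) (Vis v) ((m, m) # s) (Inv v s)"
  using walk_att_Inv[of v G "[]" s] unfolding walk.simps by (intro exI[of _ "Inv v []"]) simp

text \<open>The ports never clash: a visible vertex has its own ports in \<open>\<pi>\<close> and
  \<open>m\<close> for its tree; a tree vertex uses \<open>l\<close> and \<open>r\<close> downwards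
  and \<open>m\<close> upwards, to its parent or, at the root, to the visible vertex. This rests on
  the freshness of \<open>m\<close>, \<open>l\<close>, \<open>r\<close> and on their being
  distinct.\<close>

lemma pointed_att:
  assumes over: "pointed_graph_over UNIV UNIV \<pi> G"
  shows "pointed_graph (att G)"
proof -
  have G: "pointed_graph G" using over by (simp add: pointed_graph_over_def)
  have ports: "c \<in> \<pi>" if "{(u, c), (v, d)} \<in> edges G" for u c v d
    using over that unfolding pointed_graph_over_def by fastforce
  have reach: "\<exists>w. walk (att G) (pointer (att G)) w x" if x: "x \<in> verts (att G)" for x
  proof -
    from x obtain v where v: "v \<in> verts G" "x = Vis v \<or> (\<exists>s\<in>T. x = Inv v s)" by auto
    then obtain w where "walk G (pointer G) w v" using verts_reachable[OF G] by blast
    then have w: "walk (att G) (pointer (att G)) w (Vis v)" using walk_att_Vis by auto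
    from v(2) show ?thesis
    proof (elim disjE bexE)
      fix s assume "s \<in> T" "x = Inv v s"
      with w walk_att_enter[OF v(1)] have "walk (att G) (pointer (att G)) (w @ (m, m) # s) x"
        unfolding walk_append by blast
      then show ?thesis by blast
    qed (use w in blast)
  qed
  show ?thesis
    unfolding pointed_graph_def
  proof (intro conjI ballI)
    have "{Inv v s | v s. v \<in> verts G \<and> s \<in> T} = (\<lambda>(v, s). Inv v s) ` (verts G \<times> T)" by auto
    moreover have "countable (verts G)" using G by (simp add: pointed_graph_def)
    moreover have "countable T" by (intro countable_lists countable_finite) simp
    ultimately show "countable (verts (att G))" by simp
    show "card e = 2" "fst ` e \<subseteq> verts (att G)" if e: "e \<in> edges (att G)" for e
    proof -
      obtain x a y b where "e = {(x, a), (y, b)}" "(x, a) \<noteq> (y, b)"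
        "x \<in> verts (att G)" "y \<in> verts (att G)"
        using att_edge_cases[OF G e] .
      then show "card e = 2" "fst ` e \<subseteq> verts (att G)" by (auto simp: card_2_iff simp del: att_simps)
    qed
    show "pairwise disjnt (edges (att G))"
    proof (rule pairwiseI, rule ccontr)
      fix e e' assume e: "e \<in> edges (att G)" "e' \<in> edges (att G)" "e \<noteq> e'" "\<not> disjnt e e'"
      then obtain x c where xc: "(x, c) \<in> e" "(x, c) \<in> e'" by (auto simp: disjnt_def)
      have *: "\<exists>y d. f = {(x, c), (y, d)}" if "f \<in> edges (att G)" "(x, c) \<in> f" for f
        using that(1)
      proof (rule att_edge_cases[OF G])
        fix x' a y b assume xy: "f = {(x', a), (y, b)}"
        with that(2) consider "x = x'" "c = a" | "x = y" "c = b" by auto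
        then show ?thesis using xy by cases (blast, metis insert_commute)
      qed
      obtain y d where y: "e = {(x, c), (y, d)}" using *[OF e(1) xc(1)] by blast
      obtain y' d' where y': "e' = {(x, c), (y', d')}" using *[OF e(2) xc(2)] by blast
      have "y = y' \<and> d = d'"
      proof (cases x)
        case (Vis u)
        show ?thesis
        proof (cases y; cases y')
          fix v v' assume v: "y = Vis v" "y' = Vis v'"
          with e(1,2) y y' Vis edge_unique[OF G, of u c v d v' d'] show ?thesis by simp
        next
          fix v v' s' assume v: "y = Vis v" "y' = Inv v' s'"
          with e(1,2) y y' Vis ports[of u c v d] fresh show ?thesis by simp
        next
          fix v s v' assume v: "y = Inv v s" "y' = Vis v'"
          with e(1,2) y y' Vis ports[of u c v' d'] fresh show ?thesis by simp
        next
          fix v s v' s' assume v: "y = Inv v s" "y' = Inv v' s'"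
          with e(1,2) y y' Vis show ?thesis by simp
        qed
      next
        case (Inv u s)
        with e(1,2) y y' fresh show ?thesis
          by (cases y; cases y') (auto simp: tree_edge_def)
      qed
      with y y' e(3) show False by simp
    qed
    show "dom (vlab (att G)) \<subseteq> verts (att G)"
    proof
      fix x assume x: "x \<in> dom (vlab (att G))"
      have "dom (vlab G) \<subseteq> verts G" using G by (simp add: pointed_graph_def)
      with x have "\<exists>v\<in>verts G. x = Vis v \<or> (\<exists>s\<in>T. x = Inv v s)"
        by (cases x) (fastforce split: if_splits)+
      then show "x \<in> verts (att G)" by auto
    qed
    show "dom (elab (att G)) \<subseteq> edges (att G)"
      unfolding edges_att by (auto simp: attach_graph_def Let_def split: if_splits)
    show "pointer (att G) \<in> verts (att G)" using pointer_verts[OF G] by simp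
    fix x y assume "x \<in> verts (att G)" "y \<in> verts (att G)"
    from reach[OF this(1)] reach[OF this(2)] obtain w w'
      where "walk (att G) (pointer (att G)) w x" "walk (att G) (pointer (att G)) w' y"
      by blast
    then have "walk (att G) x (rev (map prod.swap w) @ w') y"
      using walk_rev walk_append by metis
    then show "\<exists>w. walk (att G) x w y" by blast
  qed
qed

lemma att_ports:
  assumes over: "pointed_graph_over UNIV UNIV \<pi> G"
  shows "pointed_graph_over UNIV UNIV (insert m (insert l (insert r \<pi>))) (att G)"
proof -
  have "snd ` e \<subseteq> insert m (insert l (insert r \<pi>))" if "e \<in> edges (att G)" for e
    using that over unfolding edges_att pointed_graph_over_def
    by (fastforce simp: tree_edge_def)
  then show ?thesis using pointed_att[OF over] by (simp add: pointed_graph_over_def)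
qed

definition att_set :: "'v set \<Rightarrow> ('v, 'p) im_vertex set" where
  "att_set A = Vis ` A \<union> {Inv v s | v s. v \<in> A \<and> s \<in> T}"

lemma att_set_simps [simp]:
  "Vis v \<in> att_set A \<longleftrightarrow> v \<in> A" "Inv v s \<in> att_set A \<longleftrightarrow> v \<in> A \<and> s \<in> T"
  by (auto simp: att_set_def)

definition att_map :: "('v \<Rightarrow> 'w) \<Rightarrow> ('v, 'p) im_vertex \<Rightarrow> ('w, 'p) im_vertex" where
  "att_map f x = (case x of Vis v \<Rightarrow> Vis (f v) | Inv v s \<Rightarrow> Inv (f v) s)"

lemma att_map_simps [simp]: "att_map f (Vis v) = Vis (f v)" "att_map f (Inv v s) = Inv (f v) s"
  by (simp_all add: att_map_def)

lemma att_set_image: "att_map f ` att_set A = att_set (f ` A)"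
proof
  show "att_map f ` att_set A \<subseteq> att_set (f ` A)"
    by (auto simp: att_set_def)
  show "att_set (f ` A) \<subseteq> att_map f ` att_set A"
  proof
    fix x assume "x \<in> att_set (f ` A)"
    then obtain v where "v \<in> A" "x = Vis (f v) \<or> (\<exists>s\<in>T. x = Inv (f v) s)"
      unfolding att_set_def by blast
    then have "\<exists>y\<in>att_set A. x = att_map f y"
      by (metis att_map_simps att_set_simps)
    then show "x \<in> att_map f ` att_set A" by blast
  qed
qed

text \<open>The trees over \<open>A\<close> are infinite, but \<open>att_map f\<close> leaves tree
  addresses alone, so agreement on the base extends to them at once.\<close>

lemma agree_on_att:
  assumes f: "agree_on A f G H" and A: "A \<subseteq> verts G" "f ` A \<subseteq> verts H"
  shows "agree_on (att_set A) (att_map f) (att G) (att H)"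
proof -
  have inj: "inj_on f A" using f by (simp add: agree_on_def)
  have cases: "(\<exists>v\<in>A. x = Vis v) \<or> (\<exists>v\<in>A. \<exists>s\<in>T. x = Inv v s)" if "x \<in> att_set A" for x
    using that by (auto simp: att_set_def)
  show ?thesis
    unfolding agree_on_def
  proof (intro conjI ballI allI)
    show "inj_on (att_map f) (att_set A)"
    proof (rule inj_onI)
      fix x y assume "x \<in> att_set A" "y \<in> att_set A" "att_map f x = att_map f y"
      then show "x = y" using inj_onD[OF inj] by (cases x; cases y) auto
    qed
    show "vlab (att H) (att_map f x) = vlab (att G) x" if "x \<in> att_set A" for x
      using cases[OF that]
    proof (elim disjE bexE)
      fix v assume "v \<in> A" "x = Vis v"
      then show ?thesis using f by (simp add: agree_on_def)
    next
      fix v s assume "v \<in> A" "s \<in> T" "x = Inv v s"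
      moreover then have "v \<in> verts G" "f v \<in> verts H" using A by auto
      ultimately show ?thesis by simp
    qed
    fix x y a b assume x: "x \<in> att_set A" and y: "y \<in> att_set A"
    show "{(att_map f x, a), (att_map f y, b)} \<in> edges (att H) \<longleftrightarrow>
        {(x, a), (y, b)} \<in> edges (att G)"
      using cases[OF x] cases[OF y] f A agree_on_edge[OF f] inj_on_eq_iff[OF inj] by auto
    show "{(x, a), (y, b)} \<in> edges (att G) \<longrightarrow>
       elab (att H) {(att_map f x, a), (att_map f y, b)} =
       elab (att G) {(x, a), (y, b)}"
      using cases[OF x] cases[OF y] f A agree_on_edge[OF f]
      by (auto simp: elab_att agree_on_def)
  qed
qed

text \<open>Projected to the base, a step inside a tree or between a tree and its visible vertex
  stands still, and a visible step follows an edge of \<open>G\<close>.\<close>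

lemma walk_att_base:
  "walk (att G) (Vis (pointer G)) w x \<Longrightarrow> x \<in> att_set (ball_of G (length w))"
proof (induction w arbitrary: x rule: rev_induct)
  case Nil
  then show ?case by (auto intro!: ball_ofI[of _ "[]"])
next
  case (snoc ab w)
  obtain a b where ab: "ab = (a, b)" by (cases ab)
  from snoc.prems ab obtain y where y: "walk (att G) (Vis (pointer G)) w y"
      "{(y, a), (x, b)} \<in> edges (att G)"
    by (auto simp: walk_append)
  have IH: "y \<in> att_set (ball_of G (length w))" using snoc.IH[OF y(1)] .
  have sub: "ball_of G (length w) \<subseteq> ball_of G (Suc (length w))" by (rule ball_of_mono) simp
  have step: "v \<in> ball_of G (Suc (length w))"
    if "u \<in> ball_of G (length w)" "{(u, a), (v, b)} \<in> edges G" for u v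
  proof -
    obtain w' where "walk G (pointer G) w' u" "length w' \<le> length w"
      using \<open>u \<in> ball_of G (length w)\<close> by (auto simp: ball_of_def)
    with that(2) show ?thesis by (intro ball_ofI[of _ "w' @ [(a, b)]"]) (auto simp: walk_append)
  qed
  show ?case
  proof (cases x)
    case (Vis v)
    with y(2) IH sub step show ?thesis by (cases y) auto
  next
    case (Inv v s)
    then show ?thesis
    proof (cases y)
      case (Inv u t)
      with \<open>x = Inv v s\<close> y(2) have "u = v" "s \<in> T" using tree_edge_in_T by (simp, metis att_edge_iff(4))
      with Inv \<open>x = Inv v s\<close> IH sub show ?thesis by auto
    qed (use y(2) IH sub in auto)
  qed
qed

section \<open>Representatives of elements of \<open>\<Y>\<close> and the depth of the
  pointer\<close>

abbreviation \<Y> :: "('p, 's, 'd) graph_mod set" where "\<Y> \<equiv> im_graphs \<Sigma> \<Delta> \<pi> \<mu> m l r"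

abbreviation \<X> :: "('p, 's, 'd) graph_mod set" where "\<X> \<equiv> graphs_modulo \<Sigma> \<Delta> \<pi>"

lemma over_weaken: "pointed_graph_over \<Sigma> \<Delta> \<pi> G \<Longrightarrow> pointed_graph_over UNIV UNIV \<pi> G"
  by (simp add: pointed_graph_over_def)

lemma att_repoint:
  "att (G\<lparr>pointer := v\<rparr>)\<lparr>pointer := x\<rparr> = att G\<lparr>pointer := x\<rparr>"
  by (simp add: attach_graph_def Let_def cong: if_cong)

lemma attach_modulo:
  assumes G: "pointed_graph_over UNIV UNIV \<pi> G"
  shows "attach \<mu> m l r (modulo G) = modulo (att G)"
proof -
  have pG: "pointed_graph G" using G by (simp add: pointed_graph_over_def)
  have "modulo (att K) = modulo (att G)" if K: "K \<in> modulo G" for K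
  proof -
    note GK = moduloD[OF pG K]
    have pK: "pointed_graph_over UNIV UNIV \<pi> K" using pointed_graph_over_iso[OF G GK] .
    obtain f where f: "agree_on (verts G) f G K" "f ` verts G = verts K" "f (pointer G) = pointer K"
      using isomorphicE[OF pG GK(2)] .
    have att_verts: "att_set (verts H) = verts (att H)" for H :: "('x, 'p, 's, 'd) pgraph"
      by (simp add: att_set_def)
    have "isomorphic (att G) (att K)"
      using agree_on_att[OF f(1)] f(2,3) att_set_image[of f "verts G"]
      by (intro isomorphicI[of _ _ "att_map f"] pointed_att G pK) (simp_all only: att_verts att_simps att_map_simps order.refl)
    then show ?thesis using modulo_eq_iff[OF pointed_att[OF G] pointed_att[OF pK]] by simp
  qed
  moreover obtain K where "K \<in> modulo G" using modulo_nonempty[OF pG] .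
  ultimately show ?thesis unfolding attach_def by blast
qed

text \<open>Normal form for elements of \<open>\<Y>\<close>: the base graph is pointed at the
  visible vertex whose tree carries the pointer, and \<open>q\<close> is the address in that tree,
  or \<open>None\<close> if the pointer is visible itself.\<close>

definition im_graph :: "(nat, 'p, 's, 'd) pgraph \<Rightarrow> 'p word option \<Rightarrow> ((nat, 'p) im_vertex, 'p, 's, 'd) pgraph" where
  "im_graph G q = att G\<lparr>pointer := (case q of None \<Rightarrow> Vis (pointer G) | Some s \<Rightarrow> Inv (pointer G) s)\<rparr>"

lemma pointed_im_graph:
  assumes "pointed_graph_over \<Sigma> \<Delta> \<pi> G" "\<And>s. q = Some s \<Longrightarrow> s \<in> T"
  shows "pointed_graph (im_graph G q)"
proof -
  have "pointer G \<in> verts G" using assms(1) by (auto simp: pointed_graph_over_def pointer_verts)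
  then show ?thesis
    using assms pointed_graph_repoint[OF pointed_att[OF over_weaken[OF assms(1)]]]
    unfolding im_graph_def by (cases q) auto
qed

lemma im_graph_None: "im_graph G None = att G"
  by (simp add: im_graph_def attach_graph_def Let_def)

lemma modulo_im_graph_in_Y:
  fixes G :: "(nat, 'p, 's, 'd) pgraph"
  assumes G: "pointed_graph_over \<Sigma> \<Delta> \<pi> G" and x: "x \<in> verts (att G)"
  shows "modulo (att G\<lparr>pointer := x\<rparr>) \<in> \<Y>"
proof -
  have p: "pointed_graph (att G)" using pointed_att over_weaken G by blast
  obtain w where w: "walk (att G) (pointer (att G)) w x" using verts_reachable[OF p x] by blast
  have eq: "attach \<mu> m l r (modulo G) = modulo (att G)"
    using attach_modulo over_weaken G by blast
  have "vert (modulo (att G)) w \<in> V (modulo (att G))"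
    using w unfolding V_def paths_modulo[OF p] by blast
  moreover have "modulo G \<in> \<X>" using G unfolding graphs_modulo_def by blast
  ultimately show ?thesis
    unfolding im_graphs_def shift_modulo[OF p w, symmetric] eq[symmetric] by blast
qed

lemma modulo_repoint_im_graph:
  fixes G :: "(nat, 'p, 's, 'd) pgraph"
  assumes G: "pointed_graph_over \<Sigma> \<Delta> \<pi> G" and x: "x \<in> verts (att G)"
  obtains H q where "pointed_graph_over \<Sigma> \<Delta> \<pi> H" "\<And>s. q = Some s \<Longrightarrow> s \<in> T"
    "att G\<lparr>pointer := x\<rparr> = im_graph H q"
proof -
  from x obtain v where v: "v \<in> verts G" "x = Vis v \<or> (\<exists>s\<in>T. x = Inv v s)" by auto
  have H: "pointed_graph_over \<Sigma> \<Delta> \<pi> (G\<lparr>pointer := v\<rparr>)"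
    using G v(1) by (simp add: pointed_graph_over_def pointed_graph_repoint)
  from v(2) show ?thesis
  proof (elim disjE bexE)
    assume "x = Vis v"
    with that[OF H, of None] show ?thesis by (simp add: im_graph_def att_repoint)
  next
    fix s assume "s \<in> T" "x = Inv v s"
    with that[OF H, of "Some s"] show ?thesis by (simp add: im_graph_def att_repoint)
  qed
qed

lemma Y_E:
  assumes "Z \<in> \<Y>"
  obtains G q where "pointed_graph_over \<Sigma> \<Delta> \<pi> G" "\<And>s. q = Some s \<Longrightarrow> s \<in> T" "Z = modulo (im_graph G q)"
proof -
  from assms obtain X u where X: "X \<in> \<X>" "u \<in> V (attach \<mu> m l r X)" "Z = shift (attach \<mu> m l r X) u"
    unfolding im_graphs_def by blast
  then obtain G :: "(nat, 'p, 's, 'd) pgraph" where G: "pointed_graph_over \<Sigma> \<Delta> \<pi> G" "X = modulo G"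
    unfolding graphs_modulo_def by blast
  have p: "pointed_graph (att G)" using pointed_att over_weaken G by blast
  have eq: "attach \<mu> m l r X = modulo (att G)" using attach_modulo over_weaken G by blast
  obtain w x where w: "u = vert (modulo (att G)) w" "walk (att G) (pointer (att G)) w x"
    using X(2) unfolding eq V_def paths_modulo[OF p] by blast
  have "x \<in> verts (att G)" using walk_verts[OF p w(2) pointer_verts[OF p]] .
  then show ?thesis
    using modulo_repoint_im_graph[OF G(1)] that X(3) unfolding eq w(1) shift_modulo[OF p w(2)] by metis
qed

lemma Y_mods: "Z \<in> \<Y> \<Longrightarrow> Z \<in> mods"
  using Y_E modulo_mods pointed_im_graph by metis

lemma Y_shift:
  assumes "Z \<in> \<Y>" "u \<in> V Z" shows "shift Z u \<in> \<Y>"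
proof -
  obtain G q where G: "pointed_graph_over \<Sigma> \<Delta> \<pi> G" "\<And>s. q = Some s \<Longrightarrow> s \<in> T" "Z = modulo (im_graph G q)"
    using Y_E[OF assms(1)] by metis
  have p: "pointed_graph (im_graph G q)" using pointed_im_graph G by blast
  obtain w x where w: "u = vert (modulo (im_graph G q)) w" "walk (im_graph G q) (pointer (im_graph G q)) w x"
    using assms(2) unfolding G(3) V_def paths_modulo[OF p] by blast
  have "x \<in> verts (im_graph G q)" using walk_verts[OF p w(2) pointer_verts[OF p]] .
  then have "x \<in> verts (att G)" by (simp add: im_graph_def)
  then have "modulo (att G\<lparr>pointer := x\<rparr>) \<in> \<Y>" using modulo_im_graph_in_Y G(1) by blast
  moreover have "im_graph G q\<lparr>pointer := x\<rparr> = att G\<lparr>pointer := x\<rparr>" by (simp add: im_graph_def)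
  ultimately show ?thesis unfolding w(1) G(3) shift_modulo[OF p w(2)] by simp
qed

lemma im_graph_in_Y:
  assumes "pointed_graph_over \<Sigma> \<Delta> \<pi> G" "\<And>s. q = Some s \<Longrightarrow> s \<in> T"
  shows "modulo (im_graph G q) \<in> \<Y>"
proof -
  have "pointer G \<in> verts G" using assms(1) by (auto simp: pointed_graph_over_def pointer_verts)
  then show ?thesis
    unfolding im_graph_def using assms by (intro modulo_im_graph_in_Y) (auto split: option.split)
qed

lemma im_shift_modulo:
  assumes G: "pointed_graph_over \<Sigma> \<Delta> \<pi> G" and s: "s \<in> T"
  shows "im_shift \<mu> m l r (modulo G) s = modulo (im_graph G (Some s))"
proof -
  have p: "pointed_graph (att G)" using pointed_att over_weaken G by blast
  have "pointer G \<in> verts G" using G by (auto simp: pointed_graph_over_def pointer_verts)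
  then have "walk (att G) (pointer (att G)) ((m, m) # s) (Inv (pointer G) s)"
    using walk_att_enter[OF _ s] by (simp del: walk.simps)
  then show ?thesis
    unfolding im_shift_def attach_modulo[OF over_weaken[OF G]] im_graph_def
    by (simp add: shift_modulo[OF p] del: walk.simps)
qed

text \<open>Depth is the length of the tree address, so the root of a tree has depth 0 and
  \<open>deep 0\<close> collects all invisible pointers.\<close>

definition deep :: "nat \<Rightarrow> ('p, 's, 'd) graph_mod set" where
  "deep b = {im_shift \<mu> m l r X s | X s. X \<in> \<X> \<and> s \<in> T \<and> b \<le> length s}"

lemma deep_eq:
  "deep b = {modulo (im_graph G (Some s)) | G s. pointed_graph_over \<Sigma> \<Delta> \<pi> G \<and> s \<in> T \<and> b \<le> length s}"
  unfolding deep_def graphs_modulo_def using im_shift_modulo by blast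

lemma deep_in_Y: "deep b \<subseteq> \<Y>"
  unfolding deep_eq using im_graph_in_Y by blast

lemma tree_path:
  assumes "X \<in> \<X>" "s \<in> T" "t \<in> T"
  shows "t \<in> paths (im_shift \<mu> m l r X s)"
    "im_shift \<mu> m l r X (s @ t) = shift (im_shift \<mu> m l r X s) (vert (im_shift \<mu> m l r X s) t)"
proof -
  obtain G :: "(nat, 'p, 's, 'd) pgraph" where G: "pointed_graph_over \<Sigma> \<Delta> \<pi> G" "X = modulo G"
    using assms(1) unfolding graphs_modulo_def by blast
  have p: "pointed_graph (im_graph G (Some s))" using pointed_im_graph[OF G(1)] assms(2) by blast
  have "pointer G \<in> verts G" using G by (auto simp: pointed_graph_over_def pointer_verts)
  then have w: "walk (im_graph G (Some s)) (pointer (im_graph G (Some s))) t (Inv (pointer G) (s @ t))"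
    unfolding im_graph_def using walk_att_Inv assms(2,3) by simp
  have eq: "im_shift \<mu> m l r X s = modulo (im_graph G (Some s))"
    using im_shift_modulo G assms(2) by simp
  show "t \<in> paths (im_shift \<mu> m l r X s)"
    unfolding eq paths_modulo[OF p] using w by blast
  have "im_shift \<mu> m l r X (s @ t) = modulo (im_graph G (Some (s @ t)))"
    using im_shift_modulo[OF G(1), of "s @ t"] G(2) assms(2,3) by simp
  then show "im_shift \<mu> m l r X (s @ t) = shift (im_shift \<mu> m l r X s) (vert (im_shift \<mu> m l r X s) t)"
    unfolding eq shift_modulo[OF p w] by (simp add: im_graph_def)
qed

text \<open>Visible vertices have no port \<open>l\<close> or \<open>r\<close>, since these lie
  outside \<open>\<pi>\<close>.\<close>

lemma invisible_if_tree_path: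
  assumes Z: "Z \<in> \<Y>" and t: "t \<in> T" "t \<noteq> []" "t \<in> paths Z"
  shows "Z \<in> deep 0"
proof -
  obtain G q where G: "pointed_graph_over \<Sigma> \<Delta> \<pi> G" "\<And>s. q = Some s \<Longrightarrow> s \<in> T" "Z = modulo (im_graph G q)"
    using Y_E[OF Z] by metis
  have p: "pointed_graph (im_graph G q)" using pointed_im_graph G by blast
  show ?thesis
  proof (cases q)
    case None
    obtain a t' where a: "t = (a, m) # t'" "a \<in> {l, r}" using t(1,2) by (cases t) auto
    then obtain x where x: "{(Vis (pointer G), a), (x, m)} \<in> edges (att G)"
      using t(3) unfolding G(3) paths_modulo[OF p] unfolding None im_graph_None by auto
    have "a \<in> \<pi>" if "{(u, a), (v, b)} \<in> edges G" for u v b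
      using G(1) that unfolding pointed_graph_over_def by fastforce
    then have False using x a(2) fresh by (cases x) auto
    then show ?thesis ..
  next
    case (Some s)
    then show ?thesis using G unfolding deep_eq by auto
  qed
qed

text \<open>The letters \<open>(m, l)\<close> and \<open>(m, r)\<close> climb from child to parent,
  and \<open>(m, m)\<close> leaves the root for the visible vertex. From a visible pointer the
  letter \<open>(m, m)\<close> enters the tree instead, and \<open>w\<close> is empty.\<close>

lemma surface_path:
  assumes "Z \<in> \<Y>"
  obtains w where "w \<in> lists {(m, l), (m, r)}" "w @ [(m, m)] \<in> paths Z"
proof -
  obtain G q where G: "pointed_graph_over \<Sigma> \<Delta> \<pi> G" "\<And>s. q = Some s \<Longrightarrow> s \<in> T" "Z = modulo (im_graph G q)"
    using Y_E[OF assms] by metis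
  have p: "pointed_graph (im_graph G q)" using pointed_im_graph G by blast
  have v: "pointer G \<in> verts G" using G by (auto simp: pointed_graph_over_def pointer_verts)
  show ?thesis
  proof (cases q)
    case None
    have "walk (im_graph G q) (pointer (im_graph G q)) [(m, m)] (Inv (pointer G) [])"
      unfolding None im_graph_None using walk_att_enter[OF v, of "[]"] by (simp del: walk.simps)
    then have "[] @ [(m, m)] \<in> paths Z" unfolding G(3) paths_modulo[OF p] by auto
    then show ?thesis using that[of "[]"] by simp
  next
    case (Some s)
    have s: "s \<in> T" using G(2) Some by blast
    have "walk (att G) (Inv (pointer G) s) (rev (map prod.swap ((m, m) # s))) (Vis (pointer G))"
      using walk_rev[OF walk_att_enter[OF v s]] .
    then have "walk (im_graph G q) (pointer (im_graph G q)) (rev (map prod.swap s) @ [(m, m)]) (Vis (pointer G))"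
      unfolding Some im_graph_def by simp
    then have "rev (map prod.swap s) @ [(m, m)] \<in> paths Z" unfolding G(3) paths_modulo[OF p] by blast
    moreover have "rev (map prod.swap s) \<in> lists {(m, l), (m, r)}" using s by auto
    ultimately show ?thesis using that by blast
  qed
qed

text \<open>Port \<open>m\<close> of a tree vertex leads to its parent, arriving by \<open>l\<close>
  or \<open>r\<close>, except at the root, where the port of arrival is \<open>m\<close>. So a climb
  can be followed by \<open>(m, m)\<close> only when the whole address has been used up.\<close>

lemma walk_to_surface:
  "walk (att G) (Inv v s) (w @ [(m, m)]) y \<Longrightarrow> w \<in> lists {(m, l), (m, r)} \<Longrightarrow> length w = length s"
proof (induction w arbitrary: s)
  case Nil
  then obtain x where "{(Inv v s, m), (x, m)} \<in> edges (att G)" by auto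
  then show ?case using fresh by (cases x) (auto simp: tree_edge_def)
next
  case (Cons c w)
  obtain a where a: "c = (m, a)" "a \<in> {l, r}" using Cons.prems(2) by auto
  then obtain x where x: "{(Inv v s, m), (x, a)} \<in> edges (att G)" "walk (att G) x (w @ [(m, m)]) y"
    using Cons.prems(1) by auto
  from x(1) a(2) fresh obtain t where "x = Inv v t" "length s = Suc (length t)"
    by (cases x) (auto simp: tree_edge_def)
  with x(2) Cons.IH[of t] Cons.prems(2) show ?case by simp
qed

text \<open>Makes the surface path a local certificate: once it lies in a disk, it bounds the depth
  of the pointer in every element of \<open>\<Y>\<close> with that disk.\<close>

lemma surface_path_length:
  assumes "Z \<in> deep b" "w \<in> lists {(m, l), (m, r)}" "w @ [(m, m)] \<in> paths Z"
  shows "b \<le> length w"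
proof -
  obtain G s where G: "pointed_graph_over \<Sigma> \<Delta> \<pi> G" "s \<in> T" "b \<le> length s" "Z = modulo (im_graph G (Some s))"
    using assms(1) unfolding deep_eq by blast
  have p: "pointed_graph (im_graph G (Some s))" using pointed_im_graph[OF G(1)] G(2) by blast
  obtain y where "walk (att G) (Inv (pointer G) s) (w @ [(m, m)]) y"
    using assms(3) unfolding G(4) paths_modulo[OF p] by (auto simp: im_graph_def)
  with walk_to_surface assms(2) G(3) show ?thesis by metis
qed

text \<open>The pointer is at most \<open>b\<close> steps away from the visible vertex
  \<open>pointer G\<close>: the address is shorter than \<open>b\<close>, which leaves room for the
  letter \<open>(m, m)\<close>.\<close>

lemma im_graph_ball:
  assumes "\<And>s. q = Some s \<Longrightarrow> s \<in> T \<and> length s < b" "pointer G \<in> verts G"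
  shows "ball_of (im_graph G q) j \<subseteq> att_set (ball_of G (b + j))"
proof
  fix x assume "x \<in> ball_of (im_graph G q) j"
  then obtain w where w: "length w \<le> j" "walk (att G) (pointer (im_graph G q)) w x"
    by (auto simp: ball_of_def im_graph_def)
  have "\<exists>w0. length w0 \<le> b \<and> walk (att G) (Vis (pointer G)) w0 (pointer (im_graph G q))"
  proof (cases q)
    case None
    then show ?thesis by (intro exI[of _ "[]"]) (simp add: im_graph_def)
  next
    case (Some s)
    with assms walk_att_enter[of "pointer G" G s] show ?thesis
      by (intro exI[of _ "(m, m) # s"]) (auto simp: im_graph_def simp del: walk.simps)
  qed
  then obtain w0 where w0: "length w0 \<le> b" "walk (att G) (Vis (pointer G)) w0 (pointer (im_graph G q))"
    by blast
  with w(2) have "walk (att G) (Vis (pointer G)) (w0 @ w) x" unfolding walk_append by blast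
  from walk_att_base[OF this] have "x \<in> att_set (ball_of G (length (w0 @ w)))" .
  moreover have "ball_of G (length (w0 @ w)) \<subseteq> ball_of G (b + j)"
    using w(1) w0(1) by (intro ball_of_mono) simp
  ultimately show "x \<in> att_set (ball_of G (b + j))" by (auto simp: att_set_def)
qed

text \<open>Below depth \<open>b\<close> the binary tree has finitely many addresses, so on a
  subsequence the address is constant. The base graphs converge along a further subsequence, and the
  agreement of their balls extends to the trees.\<close>

lemma shallow_compactness:
  assumes Z: "\<And>n. Z n \<in> \<Y> - deep b"
  obtains s :: "nat \<Rightarrow> nat" and W where "strict_mono s" "W \<in> \<Y>"
    "\<And>k. \<forall>\<^sub>F n in sequentially. disk k (Z (s n)) = disk k W"
proof -
  define Q where "Q = insert None (Some ` {s. set s \<subseteq> {(l, m), (r, m)} \<and> length s \<le> b})"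
  have "\<exists>G q. pointed_graph_over \<Sigma> \<Delta> \<pi> G \<and> (\<forall>s. q = Some s \<longrightarrow> s \<in> T \<and> length s < b) \<and>
      Z n = modulo (im_graph G q)" for n
  proof -
    obtain G q where G: "pointed_graph_over \<Sigma> \<Delta> \<pi> G" "\<And>s. q = Some s \<Longrightarrow> s \<in> T" "Z n = modulo (im_graph G q)"
      using Y_E[of "Z n"] Z[of n] by blast
    moreover have "length s < b" if "q = Some s" for s
      using Z[of n] G that unfolding deep_eq by force
    ultimately show ?thesis by blast
  qed
  then obtain G q where G: "\<And>n. pointed_graph_over \<Sigma> \<Delta> \<pi> (G n)"
      and q: "\<And>n s. q n = Some s \<Longrightarrow> s \<in> T \<and> length s < b"
      and ZG: "\<And>n. Z n = modulo (im_graph (G n) (q n))"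
    by metis
  have "q n \<in> Q" for n
    using q[of n] by (cases "q n") (auto simp: Q_def)
  moreover have "finite Q" unfolding Q_def by (intro finite.insertI finite_imageI finite_lists_length_le) simp
  ultimately have "finite (range (\<lambda>n. q n))" by (auto intro: finite_subset)
  then have fin: "finite (range (\<lambda>n. (\<lambda>_ :: unit. q n) c))" for c by simp
  have "\<exists>s1 :: nat \<Rightarrow> nat. strict_mono s1 \<and> (\<forall>c::unit. \<exists>a. \<forall>\<^sub>F n in sequentially. q (s1 n) = a)"
    by (rule eventually_constant_subseq[of "UNIV :: unit set" "\<lambda>n _. q n"]) (use fin in auto)
  then obtain s1 :: "nat \<Rightarrow> nat" and q0 where s1: "strict_mono s1" "\<forall>\<^sub>F n in sequentially. q (s1 n) = q0"
    by blast
  have "\<exists>(s2 :: nat \<Rightarrow> nat) (L :: (nat, 'p, 's, 'd) pgraph).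
      strict_mono s2 \<and> pointed_graph_over \<Sigma> \<Delta> \<pi> L \<and>
      (\<forall>k. \<forall>\<^sub>F n in sequentially. \<exists>f. agree_on (ball_of L k) f L (G (s1 (s2 n))) \<and>
       f ` ball_of L k = ball_of (G (s1 (s2 n))) k \<and> f (pointer L) = pointer (G (s1 (s2 n))))"
    by (rule graph_compactness[OF finite_alphabets, where Gs = "\<lambda>n. G (s1 n)"])
      (rule G, intro exI conjI allI)
  then obtain s2 :: "nat \<Rightarrow> nat" and L :: "(nat, 'p, 's, 'd) pgraph"
    where s2: "strict_mono s2" and L: "pointed_graph_over \<Sigma> \<Delta> \<pi> L"
    and conv: "\<And>k. \<forall>\<^sub>F n in sequentially. \<exists>f. agree_on (ball_of L k) f L (G (s1 (s2 n))) \<and>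
       f ` ball_of L k = ball_of (G (s1 (s2 n))) k \<and> f (pointer L) = pointer (G (s1 (s2 n)))"
    by (elim exE conjE) simp
  define s where "s = s1 \<circ> s2"
  have q_ev: "\<forall>\<^sub>F n in sequentially. q (s n) = q0"
    using eventually_subseq[OF s2 s1(2)] by (simp add: s_def)
  from eventually_happens'[OF sequentially_bot q_ev] have q0: "q0 = Some t \<Longrightarrow> t \<in> T \<and> length t < b" for t
    using q by metis
  have pL: "pointed_graph (im_graph L q0)" using pointed_im_graph[OF L] q0 by blast
  have pLv: "pointer L \<in> verts L" and ballL: "ball_of L k \<subseteq> verts L" for k
    using L ball_of_verts by (auto simp: pointed_graph_over_def pointer_verts)
  have "\<forall>\<^sub>F n in sequentially. disk k (Z (s n)) = disk k (modulo (im_graph L q0))" for k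
    using q_ev conv[of "b + (k + 1)"]
  proof eventually_elim
    case (elim n)
    \<comment> \<open>A disk of radius \<open>k\<close> involves vertices at distance up to
      \<open>k + 1\<close> from the pointer, and the pointer itself is up to \<open>b\<close> steps
      away from the base point.\<close>
    let ?G = "G (s n)" and ?B = "ball_of L (b + (k + 1))"
    obtain f where f: "agree_on ?B f L ?G" "f ` ?B = ball_of ?G (b + (k + 1))" "f (pointer L) = pointer ?G"
      using elim(2) by (auto simp: s_def)
    have Gv: "pointer ?G \<in> verts ?G" and ballG: "ball_of ?G (b + (k + 1)) \<subseteq> verts ?G"
      using G[of "s n"] ball_of_verts by (auto simp: pointed_graph_over_def pointer_verts)
    have pG: "pointed_graph (im_graph ?G q0)" using pointed_im_graph[OF G] q0 by blast
    have "agree_on (att_set ?B) (att_map f) (att L) (att ?G)"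
      using agree_on_att[OF f(1) ballL] f(2) ballG by simp
    then have agree: "agree_on (att_set ?B) (att_map f) (im_graph L q0) (im_graph ?G q0)"
      by (simp add: agree_on_def im_graph_def)
    have ptr: "att_map f (pointer (im_graph L q0)) = pointer (im_graph ?G q0)"
      using f(3) by (simp add: im_graph_def split: option.split)
    have "ball_of (im_graph L q0) (k + 1) \<subseteq> att_set ?B"
      by (rule im_graph_ball[OF q0 pLv])
    moreover have "ball_of (im_graph ?G q0) (k + 1) \<subseteq> att_map f ` att_set ?B"
      unfolding att_set_image f(2) by (rule im_graph_ball[OF q0 Gv])
    ultimately have "isomorphic (disk_graph k (im_graph L q0)) (disk_graph k (im_graph ?G q0))"
      using isomorphic_disk_graph[OF pL pG agree _ _ ptr] by blast
    then have "disk k (modulo (im_graph L q0)) = disk k (modulo (im_graph ?G q0))"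
      by (simp add: disk_modulo pL pG modulo_eq_iff pointed_disk_graph)
    then show ?case using ZG elim(1) by simp
  qed
  moreover have "strict_mono s" using s1(1) s2 by (simp add: s_def strict_mono_def)
  moreover have "modulo (im_graph L q0) \<in> \<Y>" using im_graph_in_Y[OF L] q0 by blast
  ultimately show ?thesis using that by blast
qed

text \<open>Only finitely many ports occur: those of \<open>\<pi>\<close> and the three of the
  trees.\<close>

lemma finite_short_paths:
  assumes "Z \<in> \<Y>" shows "finite {w \<in> paths Z. length w \<le> k}"
proof -
  obtain G q where G: "pointed_graph_over \<Sigma> \<Delta> \<pi> G" "\<And>s. q = Some s \<Longrightarrow> s \<in> T" "Z = modulo (im_graph G q)"
    using Y_E[OF assms] by metis
  have p: "pointed_graph (im_graph G q)" using pointed_im_graph G by blast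
  let ?\<pi> = "insert m (insert l (insert r \<pi>))"
  have "w \<in> lists (?\<pi> \<times> ?\<pi>)" if "w \<in> paths Z" for w
  proof -
    obtain v where "walk (att G) (pointer (im_graph G q)) w v"
      using \<open>w \<in> paths Z\<close> unfolding G(3) paths_modulo[OF p] by (auto simp: im_graph_def)
    then show ?thesis by (rule walk_in_lists[OF att_ports[OF over_weaken[OF G(1)]]])
  qed
  then have "{w \<in> paths Z. length w \<le> k} \<subseteq> {w. set w \<subseteq> ?\<pi> \<times> ?\<pi> \<and> length w \<le> k}"
    unfolding lists_eq_set by blast
  then show ?thesis
    by (rule finite_subset[OF _ finite_lists_length_le]) (simp add: finite_alphabets(3))
qed

end

section \<open>Vertices of graphs modulo\<close>

lemma V_E:
  assumes "u \<in> V X" obtains w where "w \<in> paths X" "u = vert X w"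
  using assms by (auto simp: V_def)

lemma vert_in_V: "w \<in> paths X \<Longrightarrow> vert X w \<in> V X"
  by (simp add: V_def)

lemma vert_mem_iff:
  assumes "X \<in> mods" "p \<in> paths X" "q \<in> paths X"
  shows "q \<in> vert X p \<longleftrightarrow> vert X p = vert X q"
proof -
  obtain G :: "(nat, 'a, 'b, 'c) pgraph" where G: "pointed_graph G" "X = modulo G"
    using assms(1) by (rule modsE)
  have "same G q q" using assms(3) unfolding G(2) paths_modulo[OF G(1)] same_refl_iff by simp
  then show ?thesis
    unfolding G(2) vert_modulo[OF G(1)] using same_trans[OF G(1)] same_sym by blast
qed

lemma V_mem_iff:
  assumes "X \<in> mods" "u \<in> V X" "w \<in> paths X"
  shows "w \<in> u \<longleftrightarrow> u = vert X w"
  using assms(2) by (rule V_E) (use vert_mem_iff[OF assms(1)] assms(3) in blast)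

lemma vert_refl: "X \<in> mods \<Longrightarrow> p \<in> paths X \<Longrightarrow> p \<in> vert X p"
  by (simp add: vert_mem_iff)

lemma paths_disk_subset: "X \<in> mods \<Longrightarrow> paths (disk k X) \<subseteq> paths X"
  by (erule modsE) (auto simp: disk_modulo paths_modulo pointed_disk_graph dest: walk_disk_graphD)

lemma short_path_in_disk: "X \<in> mods \<Longrightarrow> p \<in> paths X \<Longrightarrow> length p \<le> k + 1 \<Longrightarrow> p \<in> paths (disk k X)"
  by (erule modsE) (auto simp: disk_modulo paths_modulo pointed_disk_graph walk_disk_graph)

lemma paths_disk_mono:
  assumes "X \<in> mods" "j \<le> k" shows "paths (disk j X) \<subseteq> paths (disk k X)"
  using paths_disk_subset[OF disk_mods[OF assms(1)], of j k] disk_disk[OF assms] by simp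

lemma vert_disk_mem_iff:
  assumes "X \<in> mods" "p \<in> paths (disk k X)" "q \<in> paths (disk k X)"
  shows "q \<in> vert (disk k X) p \<longleftrightarrow> q \<in> vert X p"
proof -
  obtain G :: "(nat, 'a, 'b, 'c) pgraph" where G: "pointed_graph G" "X = modulo G"
    using assms(1) by (rule modsE)
  note D = pointed_disk_graph[OF G(1), of k]
  obtain u v where u: "walk (disk_graph k G) (pointer G) p u" and v: "walk (disk_graph k G) (pointer G) q v"
    using assms(2,3) unfolding G(2) disk_modulo[OF G(1)] paths_modulo[OF D] by auto
  have "same (disk_graph k G) p q \<longleftrightarrow> u = v"
    using same_walk[OF D] u v walk_det[OF D] unfolding pointer_disk_graph by metis
  also have "\<dots> \<longleftrightarrow> same G p q"
    using same_walk[OF G(1) walk_disk_graphD[OF u]] walk_disk_graphD[OF v] walk_det[OF G(1)] by metis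
  finally show ?thesis
    unfolding G(2) disk_modulo[OF G(1)] vert_modulo[OF D] vert_modulo[OF G(1)] by simp
qed

text \<open>Whether two paths inside a disk end in the same vertex is decided inside that
  disk.\<close>

lemma vert_eq_disk_cong:
  assumes X: "X \<in> mods" and Y: "Y \<in> mods" and eq: "disk k X = disk k Y"
    and p: "p \<in> paths (disk k X)" and q: "q \<in> paths (disk k X)"
  shows "vert X p = vert X q \<longleftrightarrow> vert Y p = vert Y q"
proof -
  have "vert X p = vert X q \<longleftrightarrow> q \<in> vert X p"
    using vert_mem_iff[OF X] paths_disk_subset[OF X] p q by blast
  also have "\<dots> \<longleftrightarrow> q \<in> vert Y p"
    using vert_disk_mem_iff[OF X p q] vert_disk_mem_iff[OF Y, of p k q] p q eq by simp
  also have "\<dots> \<longleftrightarrow> vert Y p = vert Y q"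
    using vert_mem_iff[OF Y] paths_disk_subset[OF Y, of k] p q eq by auto
  finally show ?thesis .
qed

text \<open>Paths inside a disk can be arbitrarily long; with short representatives,
  \<open>finite_short_paths\<close> makes the set of vertices of the disk finite.\<close>

lemma disk_V_finite_rep:
  assumes "X \<in> mods"
  shows "disk_V k X \<subseteq> vert X ` {w \<in> paths X. length w \<le> k + 1}"
proof
  fix u assume "u \<in> disk_V k X"
  obtain G :: "(nat, 'a, 'b, 'c) pgraph" where G: "pointed_graph G" "X = modulo G"
    using assms(1) by (rule modsE)
  note D = pointed_disk_graph[OF G(1), of k]
  from \<open>u \<in> disk_V k X\<close> obtain p where p: "u = vert X p" "p \<in> paths (disk k X)"
    by (auto simp: disk_V_def)
  then obtain v where v: "walk (disk_graph k G) (pointer G) p v"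
    unfolding G(2) disk_modulo[OF G(1)] paths_modulo[OF D] by auto
  have "v \<in> verts (disk_graph k G)"
    using walk_verts[OF D v] pointer_verts[OF D] by simp
  then obtain w where w: "length w \<le> k + 1" "walk G (pointer G) w v"
    by (auto simp: disk_graph_def ball_of_def)
  then have "w \<in> paths X" unfolding G(2) paths_modulo[OF G(1)] by blast
  moreover have "w \<in> vert X p"
    using w(2) walk_disk_graphD[OF v] unfolding G(2) vert_modulo[OF G(1)] same_def by blast
  moreover have "p \<in> paths X" using p(2) paths_disk_subset[OF assms] by blast
  ultimately have "u = vert X w" using vert_mem_iff[OF assms] p(1) by blast
  with w(1) \<open>w \<in> paths X\<close> show "u \<in> vert X ` {w \<in> paths X. length w \<le> k + 1}" by blast
qed

lemma conc_vert:
  assumes X: "X \<in> mods" and p: "p \<in> paths X" and q: "q \<in> paths (shift X (vert X p))"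
  shows "conc X (vert X p) (vert (shift X (vert X p)) q) = vert X (p @ q)" "p @ q \<in> paths X"
proof -
  obtain G :: "(nat, 'a, 'b, 'c) pgraph" where G: "pointed_graph G" "X = modulo G"
    using X by (rule modsE)
  obtain v where v: "walk G (pointer G) p v" using p unfolding G(2) paths_modulo[OF G(1)] by blast
  have eq: "shift X (vert X p) = modulo (G\<lparr>pointer := v\<rparr>)"
    unfolding G(2) by (rule shift_modulo[OF G(1) v])
  have G': "pointed_graph (G\<lparr>pointer := v\<rparr>)"
    using pointed_graph_repoint[OF G(1)] walk_verts[OF G(1) v pointer_verts[OF G(1)]] .
  obtain x where x: "walk G v q x" using q unfolding eq paths_modulo[OF G'] by auto
  have "walk G v q' x" if "q' \<in> vert (modulo (G\<lparr>pointer := v\<rparr>)) q" for q'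
    using that same_walk[OF G', of q x q'] x unfolding vert_modulo[OF G'] by simp
  moreover have "q \<in> vert (modulo (G\<lparr>pointer := v\<rparr>)) q"
    using x unfolding vert_modulo[OF G'] same_def by auto
  ultimately show "conc X (vert X p) (vert (shift X (vert X p)) q) = vert X (p @ q)"
    unfolding eq unfolding G(2) using conc_modulo[OF G(1) v x] by blast
  have "walk G (pointer G) (p @ q) x" unfolding walk_append using v x by blast
  then show "p @ q \<in> paths X"
    unfolding G(2) paths_modulo[OF G(1)] by blast
qed

lemma conc_in_V:
  assumes "X \<in> mods" "u \<in> V X" "v \<in> V (shift X u)" shows "conc X u v \<in> V X"
proof -
  obtain p where p: "p \<in> paths X" "u = vert X p" using assms(2) by (rule V_E)
  obtain q where q: "q \<in> paths (shift X u)" "v = vert (shift X u) q" using assms(3) by (rule V_E)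
  show ?thesis using conc_vert[OF assms(1) p(1)] p(2) q vert_in_V by metis
qed

text \<open>Witnessed by the empty path, whose class in the disk consists of closed walks at
  \<open>u\<close>.\<close>

lemma conc_self:
  assumes X: "X \<in> mods" and u: "u \<in> V X"
  shows "\<exists>v\<in>V (disk k (shift X u)). u = conc X u v"
proof -
  obtain p where p: "p \<in> paths X" "u = vert X p" using u by (rule V_E)
  obtain G :: "(nat, 'a, 'b, 'c) pgraph" where G: "pointed_graph G" "X = modulo G"
    using X by (rule modsE)
  obtain v where v: "walk G (pointer G) p v" using p(1) unfolding G(2) paths_modulo[OF G(1)] by blast
  have eq: "shift X u = modulo (G\<lparr>pointer := v\<rparr>)"
    unfolding G(2) p(2) by (rule shift_modulo[OF G(1) v])
  have G': "pointed_graph (G\<lparr>pointer := v\<rparr>)"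
    using pointed_graph_repoint[OF G(1)] walk_verts[OF G(1) v pointer_verts[OF G(1)]] .
  note D = pointed_disk_graph[OF G', of k]
  let ?D = "disk_graph k (G\<lparr>pointer := v\<rparr>)"
  have "walk G v q' v" if "q' \<in> vert (modulo ?D) []" for q'
  proof -
    have "walk ?D v q' v"
      using that unfolding vert_modulo[OF D] same_def by auto
    from walk_disk_graphD[OF this] show ?thesis by simp
  qed
  moreover have "[] \<in> vert (modulo ?D) []"
    unfolding vert_modulo[OF D] same_def by auto
  ultimately have "conc (modulo G) (vert (modulo G) p) (vert (modulo ?D) []) = vert (modulo G) (p @ [])"
    using v by (intro conc_modulo[OF G(1)]) auto
  then have "u = conc X u (vert (disk k (shift X u)) [])"
    unfolding eq disk_modulo[OF G'] unfolding p(2) G(2) by simp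
  moreover have "[] \<in> paths (disk k (shift X u))"
    unfolding eq disk_modulo[OF G'] paths_modulo[OF D] by auto
  ultimately show ?thesis using vert_in_V by blast
qed

section \<open>Inverting an invertible IMCGD\<close>

locale invertible_IMCGD = invisible_matter \<Sigma> \<Delta> \<pi> \<mu> m l r
  for \<Sigma> :: "'s set" and \<Delta> :: "'d set" and \<pi> :: "'p set" and \<mu> :: 's and m l r :: 'p +
  fixes F :: "('p, 's, 'd) gmap" and R :: "('p, 's, 'd) vmap"
  assumes IMCGD: "IMCGD \<Sigma> \<Delta> \<pi> \<mu> m l r F R"
    and bij: "bij_betw F \<Y> \<Y>"
begin

section \<open>The inverse dynamics and its immediate properties\<close>

definition F' :: "('p, 's, 'd) gmap" where "F' = inv_into \<Y> F"

definition S :: "('p, 's, 'd) vmap" where "S Y = inv_into (V (F' Y)) (R (F' Y))"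

lemma F_Y: "X \<in> \<Y> \<Longrightarrow> F X \<in> \<Y>"
  using bij by (auto simp: bij_betw_def)

lemma F'_Y: "X \<in> \<Y> \<Longrightarrow> F' X \<in> \<Y>"
  unfolding F'_def using bij_betw_inv_into[OF bij] by (auto simp: bij_betw_def)

lemma F_F': "X \<in> \<Y> \<Longrightarrow> F (F' X) = X"
  unfolding F'_def using bij by (auto simp: bij_betw_def f_inv_into_f)

lemma F'_F: "X \<in> \<Y> \<Longrightarrow> F' (F X) = X"
  unfolding F'_def using bij by (auto simp: bij_betw_def)

lemma R_bij: "X \<in> \<Y> \<Longrightarrow> bij_betw (R X) (V X) (V (F X))"
  using IMCGD by (simp add: IMCGD_def vertex_preserving_def)

lemma R_V: "X \<in> \<Y> \<Longrightarrow> u \<in> V X \<Longrightarrow> R X u \<in> V (F X)"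
  by (rule bij_betw_apply[OF R_bij])

lemma S_bij: "Y \<in> \<Y> \<Longrightarrow> bij_betw (S Y) (V Y) (V (F' Y))"
  unfolding S_def using bij_betw_inv_into[OF R_bij[OF F'_Y]] F_F' by simp

lemma S_V: "Y \<in> \<Y> \<Longrightarrow> u \<in> V Y \<Longrightarrow> S Y u \<in> V (F' Y)"
  by (rule bij_betw_apply[OF S_bij])

lemma R_S: "Y \<in> \<Y> \<Longrightarrow> u \<in> V Y \<Longrightarrow> R (F' Y) (S Y u) = u"
  unfolding S_def using R_bij[OF F'_Y] F_F' by (metis bij_betw_inv_into_right)

lemma S_R: "Y \<in> \<Y> \<Longrightarrow> u \<in> V (F' Y) \<Longrightarrow> S Y (R (F' Y) u) = u"
  unfolding S_def using R_bij[OF F'_Y] by (metis bij_betw_inv_into_left)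

lemma shift_inv:
  assumes "X \<in> \<Y>" "u \<in> V X"
  shows "F (shift X u) = shift (F X) (R X u)"
    "v \<in> V (shift X u) \<Longrightarrow> R X (conc X u v) = conc (F X) (R X u) (R (shift X u) v)"
  using IMCGD assms by (simp_all add: IMCGD_def CGD_def shift_invariant_def)

lemma inverse_dynamics: "dynamics \<Y> F' S"
  unfolding dynamics_def using F'_Y S_V by blast

lemma inverse_vertex_preserving: "vertex_preserving \<Y> F' S"
  unfolding vertex_preserving_def using S_bij by blast

lemma inverse_shift_invariant: "shift_invariant \<Y> F' S"
  unfolding shift_invariant_def
proof (intro ballI conjI)
  fix Y u assume Y: "Y \<in> \<Y>" and u: "u \<in> V Y"
  let ?Z = "F' Y" and ?s = "S Y u"
  have Z: "?Z \<in> \<Y>" "F ?Z = Y" and s: "?s \<in> V ?Z" "R ?Z ?s = u"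
    using Y u F'_Y F_F' S_V R_S by auto
  have sh: "F (shift ?Z ?s) = shift Y u" "shift ?Z ?s \<in> \<Y>"
    using shift_inv(1)[OF Z(1) s(1)] Z s Y_shift by simp_all
  \<comment> \<open>Shift invariance of \<open>F\<close> at the preimage, read through
    \<open>F'\<close>.\<close>
  then show eq: "F' (shift Y u) = shift ?Z ?s" using F'_F by metis
  fix v assume v: "v \<in> V (shift Y u)"
  have Yu: "shift Y u \<in> \<Y>" using Y_shift Y u .
  let ?t = "S (shift Y u) v"
  have t: "?t \<in> V (shift ?Z ?s)" "R (shift ?Z ?s) ?t = v"
    using S_V[OF Yu v] R_S[OF Yu v] eq by simp_all
  have "R ?Z (conc ?Z ?s ?t) = conc Y u v"
    using shift_inv(2)[OF Z(1) s(1) t(1)] Z(2) s(2) t(2) by simp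
  moreover have "conc ?Z ?s ?t \<in> V ?Z" using conc_in_V[OF Y_mods[OF Z(1)] s(1) t(1)] .
  ultimately show "S Y (conc Y u v) = conc ?Z ?s ?t" using S_R[OF Y] by metis
qed

text \<open>\<open>S Y\<close> is onto, so each vertex is already an image and radius 0
  suffices.\<close>

lemma inverse_bounded: "bounded_dynamics \<Y> F' S"
  unfolding bounded_dynamics_def
proof (intro exI ballI)
  fix Y w assume Y: "Y \<in> \<Y>" and w: "w \<in> V (F' Y)"
  have "S Y ` V Y = V (F' Y)" using S_bij[OF Y] by (simp add: bij_betw_def)
  with w conc_self[OF Y_mods[OF F'_Y[OF Y]] w]
  show "\<exists>u\<in>S Y ` V Y. \<exists>v\<in>V (disk 0 (shift (F' Y) u)). w = conc (F' Y) u v" by blast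
qed

lemma continuity:
  assumes "X \<in> \<Y>"
  obtains n where "dom_restr F R k X \<subseteq> disk_V n X"
    "\<And>Y. Y \<in> \<Y> \<Longrightarrow> disk n Y = disk n X \<Longrightarrow> disk k (F Y) = disk k (F X)"
    "\<And>Y w. Y \<in> \<Y> \<Longrightarrow> disk n Y = disk n X \<Longrightarrow> w \<in> paths (disk n X) \<Longrightarrow>
       R Y (vert Y w) \<inter> paths (disk k (F Y)) = R X (vert X w) \<inter> paths (disk k (F X))"
proof -
  have "continuous_dynamics \<Y> F R" using IMCGD by (simp add: IMCGD_def CGD_def)
  then obtain n where "dom_restr F R k X \<subseteq> disk_V n X" and
    n: "\<forall>Y\<in>\<Y>. disk n Y = disk n X \<longrightarrow> disk k (F Y) = disk k (F X) \<and>
           dom_restr F R k Y \<subseteq> disk_V n Y \<and>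
           (\<forall>w\<in>paths (disk n X).
              R Y (vert Y w) \<inter> paths (disk k (F Y)) = R X (vert X w) \<inter> paths (disk k (F X)))"
    unfolding continuous_dynamics_def using assms by meson
  then show ?thesis by (intro that[of n]) (use n in simp_all)
qed

section \<open>Depth of the pointer under \<open>F\<close> and under its inverse\<close>

lemma deepI: "X \<in> \<X> \<Longrightarrow> s \<in> T \<Longrightarrow> b \<le> length s \<Longrightarrow> im_shift \<mu> m l r X s \<in> deep b"
  unfolding deep_def by blast

lemma limit_image:
  assumes W: "W \<in> \<Y>" and Z: "\<And>n. Z n \<in> \<Y>"
    and conv: "\<And>k. \<forall>\<^sub>F n in sequentially. disk k (Z n) = disk k W"
  shows "\<forall>\<^sub>F n in sequentially. disk k (F (Z n)) = disk k (F W)"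
proof -
  obtain n where n: "\<And>Y. Y \<in> \<Y> \<Longrightarrow> disk n Y = disk n W \<Longrightarrow> disk k (F Y) = disk k (F W)"
    using continuity[OF W] by metis
  from conv[of n] show ?thesis by eventually_elim (use n Z in blast)
qed

lemma quiescent_depth:
  obtains b where
    "\<And>X s t. X \<in> \<X> \<Longrightarrow> s \<in> T \<Longrightarrow> t \<in> T \<Longrightarrow> b \<le> length s \<Longrightarrow>
       t \<in> paths (F (im_shift \<mu> m l r X s)) \<and>
       R (im_shift \<mu> m l r X s) (vert (im_shift \<mu> m l r X s) t) = vert (F (im_shift \<mu> m l r X s)) t"
proof -
  have "im_quiescent \<Sigma> \<Delta> \<pi> \<mu> m l r F R" using IMCGD by (simp add: IMCGD_def)
  then show ?thesis unfolding im_quiescent_def Let_def using that by blast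
qed

text \<open>The image of a root of a quiescent subtree is invisible, and quiescence moves the pointer down
  equally in both trees; so \<open>F\<close> decreases depth by at most \<open>b\<close>.\<close>

lemma deep_image:
  obtains b where "\<And>k Z. Z \<in> deep (b + k) \<Longrightarrow> F Z \<in> deep k"
proof -
  obtain b where b: "\<And>X s t. X \<in> \<X> \<Longrightarrow> s \<in> T \<Longrightarrow> t \<in> T \<Longrightarrow> b \<le> length s \<Longrightarrow>
       t \<in> paths (F (im_shift \<mu> m l r X s)) \<and>
       R (im_shift \<mu> m l r X s) (vert (im_shift \<mu> m l r X s) t) = vert (F (im_shift \<mu> m l r X s)) t"
    using quiescent_depth by blast
  have "F Z \<in> deep k" if Z: "Z \<in> deep (b + k)" for k Z
  proof -
    obtain X s where X: "X \<in> \<X>" "s \<in> T" "b + k \<le> length s" "Z = im_shift \<mu> m l r X s"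
      using Z unfolding deep_def by blast
    \<comment> \<open>The ancestor of the pointer at depth \<open>b\<close> is the shallowest one to
      which the quiescence bound applies. The remaining address \<open>?t\<close> keeps a length of
      at least \<open>k\<close>.\<close>
    let ?s = "take b s" and ?t = "drop b s"
    have st: "?s \<in> T" "?t \<in> T"
      using X(2) set_take_subset[of b s] set_drop_subset[of b s] unfolding in_lists_conv_set by blast+
    have len: "length ?s = b" "k \<le> length ?t" using X(3) by auto
    let ?Z = "im_shift \<mu> m l r X ?s"
    have Zd: "?Z \<in> deep b" using X(1) st(1) len(1) by (intro deepI) simp_all
    then have ZY: "?Z \<in> \<Y>" using deep_in_Y by blast
    have "Z = shift ?Z (vert ?Z ?t)"
      using tree_path(2)[OF X(1) st] X(4) by simp
    moreover have "vert ?Z ?t \<in> V ?Z" using tree_path(1)[OF X(1) st] vert_in_V by blast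
    ultimately have FZ: "F Z = shift (F ?Z) (vert (F ?Z) ?t)"
      using shift_inv(1)[OF ZY] b[OF X(1) st] len(1) by simp
    \<comment> \<open>By quiescence this tree path survives in the image, so the image of the
      ancestor is invisible, at some address \<open>s'\<close>. Nothing is claimed about the length
      of \<open>s'\<close>, which is how up to \<open>b\<close> levels can be lost.\<close>
    have "[(l, m)] \<in> paths (F ?Z)" using b[OF X(1) st(1), of "[(l, m)]"] len(1) by simp
    then have "F ?Z \<in> deep 0" using invisible_if_tree_path[OF F_Y[OF ZY], of "[(l, m)]"] by simp
    then obtain X' s' where X': "X' \<in> \<X>" "s' \<in> T" "F ?Z = im_shift \<mu> m l r X' s'"
      unfolding deep_def by blast
    have "F Z = im_shift \<mu> m l r X' (s' @ ?t)"
      unfolding FZ X'(3) using tree_path(2)[OF X'(1,2) st(2)] by simp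
    moreover have "s' @ ?t \<in> T" using X'(2) st(2) by simp
    ultimately show ?thesis using X'(1) len(2) deepI[of X' "s' @ ?t" k] by simp
  qed
  then show ?thesis using that by blast
qed

text \<open>Otherwise pointers of unbounded depth would have shallow preimages. These accumulate at
  some \<open>W\<close>; by continuity of \<open>F\<close> the surface path of \<open>F W\<close>
  persists in the images far along the subsequence, and its fixed length contradicts their growing
  depth.\<close>

lemma deep_preimage:
  obtains b' where "\<And>Y. Y \<in> deep b' \<Longrightarrow> F' Y \<in> deep b"
proof (rule ccontr)
  assume "\<not> thesis"
  then have "\<forall>n. \<exists>Y. Y \<in> deep n \<and> F' Y \<notin> deep b" using that by blast
  then obtain Y where Y: "\<And>n. Y n \<in> deep n" "\<And>n. F' (Y n) \<notin> deep b" by metis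
  have YY: "Y n \<in> \<Y>" for n using Y(1) deep_in_Y by blast
  have "\<exists>(s :: nat \<Rightarrow> nat) W. strict_mono s \<and> W \<in> \<Y> \<and>
    (\<forall>k. \<forall>\<^sub>F n in sequentially. disk k (F' (Y (s n))) = disk k W)"
    by (rule shallow_compactness[of "\<lambda>n. F' (Y n)" b]) (use F'_Y YY Y(2) in blast)+
  then obtain s :: "nat \<Rightarrow> nat" and W where s: "strict_mono s" and W: "W \<in> \<Y>"
    and conv: "\<And>k. \<forall>\<^sub>F n in sequentially. disk k (F' (Y (s n))) = disk k W" by blast
  obtain w where w: "w \<in> lists {(m, l), (m, r)}" "w @ [(m, m)] \<in> paths (F W)"
    using surface_path[OF F_Y[OF W]] .
  let ?k = "length w"
  have "\<forall>\<^sub>F n in sequentially. disk ?k (F (F' (Y (s n)))) = disk ?k (F W)"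
    by (rule limit_image[OF W _ conv]) (use F'_Y YY in blast)
  then have "\<forall>\<^sub>F n in sequentially. disk ?k (F (F' (Y (s n)))) = disk ?k (F W) \<and> ?k < n"
    using eventually_gt_at_top by (rule eventually_conj)
  then obtain n where n: "disk ?k (F (F' (Y (s n)))) = disk ?k (F W)" "?k < n"
    using eventually_happens'[OF sequentially_bot] by blast
  then have "disk ?k (Y (s n)) = disk ?k (F W)" using F_F' YY by simp
  \<comment> \<open>The path has length \<open>?k + 1\<close>, exactly what a disk of radius
    \<open>?k\<close> accommodates.\<close>
  moreover have "w @ [(m, m)] \<in> paths (disk ?k (F W))"
    using short_path_in_disk[OF Y_mods[OF F_Y[OF W]] w(2)] by simp
  ultimately have "w @ [(m, m)] \<in> paths (Y (s n))"
    using paths_disk_subset[OF Y_mods[OF YY[of "s n"]], of ?k] by auto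
  then have "s n \<le> ?k" using surface_path_length[OF Y(1) w(1)] by blast
  with n(2) seq_suble[OF s, of n] show False by simp
qed

text \<open>For a deep pointer, \<open>deep_preimage\<close> places the preimage where
  \<open>R\<close> fixes tree paths; the inverse of \<open>R\<close> then fixes them too.\<close>

lemma inverse_quiescent: "im_quiescent \<Sigma> \<Delta> \<pi> \<mu> m l r F' S"
proof -
  obtain b where b: "\<And>X s t. X \<in> \<X> \<Longrightarrow> s \<in> T \<Longrightarrow> t \<in> T \<Longrightarrow> b \<le> length s \<Longrightarrow>
       t \<in> paths (F (im_shift \<mu> m l r X s)) \<and>
       R (im_shift \<mu> m l r X s) (vert (im_shift \<mu> m l r X s) t) = vert (F (im_shift \<mu> m l r X s)) t"
    using quiescent_depth by blast
  obtain b' where b': "\<And>Y. Y \<in> deep b' \<Longrightarrow> F' Y \<in> deep b" using deep_preimage by metis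
  show ?thesis
    unfolding im_quiescent_def Let_def
  proof (intro exI ballI impI)
    fix X s t assume X: "X \<in> \<X>" "s \<in> T" "t \<in> T" "b' \<le> length s"
    let ?Y = "im_shift \<mu> m l r X s"
    have Y: "?Y \<in> deep b'" using X unfolding deep_def by blast
    then have YY: "?Y \<in> \<Y>" using deep_in_Y by blast
    obtain X' s' where X': "X' \<in> \<X>" "s' \<in> T" "b \<le> length s'" "F' ?Y = im_shift \<mu> m l r X' s'"
      using b'[OF Y] unfolding deep_def by blast
    have t: "t \<in> paths (F' ?Y)" using tree_path(1)[OF X'(1,2) X(3)] X'(4) by simp
    have "R (F' ?Y) (vert (F' ?Y) t) = vert ?Y t"
      using b[OF X'(1,2) X(3) X'(3)] F_F'[OF YY] X'(4) by simp
    then have "S ?Y (vert ?Y t) = vert (F' ?Y) t" using S_R[OF YY vert_in_V[OF t]] by simp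
    with t show "t \<in> paths (F' ?Y) \<and> S ?Y (vert ?Y t) = vert (F' ?Y) t" by blast
  qed
qed

section \<open>Continuity of the inverse: graphs, then vertex maps\<close>

lemma inverse_disk_continuous:
  assumes Y: "Y \<in> \<Y>"
  obtains n where "\<And>Y'. Y' \<in> \<Y> \<Longrightarrow> disk n Y' = disk n Y \<Longrightarrow> disk k (F' Y') = disk k (F' Y)"
proof (rule ccontr)
  assume "\<not> thesis"
  then have "\<forall>n. \<exists>Y'. Y' \<in> \<Y> \<and> disk n Y' = disk n Y \<and> disk k (F' Y') \<noteq> disk k (F' Y)"
    using that by blast
  then obtain U where U: "\<And>n. U n \<in> \<Y>" "\<And>n. disk n (U n) = disk n Y"
    "\<And>n. disk k (F' (U n)) \<noteq> disk k (F' Y)"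
    by metis
  obtain b where b: "\<And>k Z. Z \<in> deep (b + k) \<Longrightarrow> F Z \<in> deep k" using deep_image by metis
  obtain w where w: "w \<in> lists {(m, l), (m, r)}" "w @ [(m, m)] \<in> paths Y"
    using surface_path[OF Y] .
  let ?d = "length w"
  \<comment> \<open>From index \<open>?d\<close> on, \<open>U n\<close> shares with \<open>Y\<close>
    a disk containing the surface path, so its depth is at most \<open>?d\<close>. As
    \<open>F\<close> lowers depth by at most \<open>b\<close>, the preimage is shallower than
    \<open>b + (?d + 1)\<close>.\<close>
  have shallow: "F' (U n) \<in> \<Y> - deep (b + (?d + 1))" if n: "?d \<le> n" for n
  proof -
    have "w @ [(m, m)] \<in> paths (disk n (U n))"
      using short_path_in_disk[OF Y_mods[OF Y] w(2), of n] n U(2) by simp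
    then have "w @ [(m, m)] \<in> paths (U n)"
      using paths_disk_subset[OF Y_mods[OF U(1)]] by blast
    then have "U n \<notin> deep (?d + 1)" using surface_path_length[OF _ w(1)] by force
    then have "F' (U n) \<notin> deep (b + (?d + 1))" using b F_F'[OF U(1)] by metis
    then show ?thesis using F'_Y[OF U(1)] by blast
  qed
  \<comment> \<open>Shifting the index by \<open>?d\<close> makes every term of the sequence
    shallow.\<close>
  have "\<exists>(s :: nat \<Rightarrow> nat) W. strict_mono s \<and> W \<in> \<Y> \<and>
    (\<forall>j. \<forall>\<^sub>F n in sequentially. disk j (F' (U (s n + ?d))) = disk j W)"
    by (rule shallow_compactness[of "\<lambda>n. F' (U (n + ?d))" "b + (?d + 1)"])
      (use shallow in \<open>blast intro: le_add2\<close>)+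
  then obtain s :: "nat \<Rightarrow> nat" and W where s: "strict_mono s" and W: "W \<in> \<Y>"
    and conv: "\<And>j. \<forall>\<^sub>F n in sequentially. disk j (F' (U (s n + ?d))) = disk j W" by blast
  \<comment> \<open>Along the subsequence the images converge to \<open>F W\<close> by continuity of
    \<open>F\<close> and to \<open>Y\<close> by the choice of \<open>U\<close>.\<close>
  have "disk j (F W) = disk j Y" for j
  proof -
    have "\<forall>\<^sub>F n in sequentially. disk j (F (F' (U (s n + ?d)))) = disk j (F W)"
      by (rule limit_image[OF W _ conv]) (use F'_Y U(1) in blast)
    then have "\<forall>\<^sub>F n in sequentially. disk j (F (F' (U (s n + ?d)))) = disk j (F W) \<and> j < n"
      using eventually_gt_at_top by (rule eventually_conj)
    then obtain n where n: "disk j (F (F' (U (s n + ?d)))) = disk j (F W)" "j < n"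
      using eventually_happens'[OF sequentially_bot] by blast
    then have "j \<le> s n + ?d" using seq_suble[OF s, of n] by simp
    then have "disk j (U (s n + ?d)) = disk j Y"
      using disk_eq_mono[OF Y_mods[OF U(1)] Y_mods[OF Y] U(2)] by blast
    with n(1) F_F'[OF U(1)] show ?thesis by simp
  qed
  then have "F W = Y" using disk_separated Y_mods F_Y W Y by blast
  then have "W = F' Y" using F'_F[OF W] by simp
  with eventually_happens'[OF sequentially_bot conv[of k]] U(3) show False by blast
qed

text \<open>What remains is locality of the vertex maps. The finitely many vertices of
  \<open>disk k Z\<close> have their images under \<open>R Z\<close> in some
  \<open>disk k' Y\<close>. Continuity of \<open>F\<close> at radius \<open>k'\<close> says that
  nearby preimages \<open>F' Y'\<close> map them to vertices named by the same paths, and as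
  \<open>S\<close> inverts \<open>R\<close>, the values of \<open>S\<close> within
  \<open>disk k Z\<close> agree as well.\<close>

lemma inverse_continuous: "continuous_dynamics \<Y> F' S"
  unfolding continuous_dynamics_def
proof (intro ballI allI)
  fix Y k assume Y: "Y \<in> \<Y>"
  define Z where "Z = F' Y"
  have Z: "Z \<in> \<Y>" "F Z = Y" using F'_Y F_F' Y by (simp_all add: Z_def)
  note mY = Y_mods[OF Y] and mZ = Y_mods[OF Z(1)]
  define B where "B = {w \<in> paths Z. length w \<le> k + 1}"
  have finB: "finite B" unfolding B_def using finite_short_paths[OF Z(1)] .
  have "\<exists>p. p \<in> paths Y \<and> R Z (vert Z w) = vert Y p" if "w \<in> B" for w
    using R_V[OF Z(1) vert_in_V[of w Z]] that Z(2) unfolding B_def by (auto elim: V_E)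
  then obtain p where p: "\<And>w. w \<in> B \<Longrightarrow> p w \<in> paths Y \<and> R Z (vert Z w) = vert Y (p w)" by metis
  \<comment> \<open>Large enough for all the chosen paths \<open>p w\<close>; the inserted
    \<open>0\<close> keeps \<open>Max\<close> well defined without a separate nonemptiness
    argument.\<close>
  define k' where "k' = Max (insert 0 (length ` p ` B))"
  have k': "p w \<in> paths (disk k' Y)" if "w \<in> B" for w
  proof (rule short_path_in_disk[OF mY])
    have "length (p w) \<le> k'" unfolding k'_def using finB that by (intro Max_ge) auto
    then show "length (p w) \<le> k' + 1" by simp
  qed (use p that in blast)
  have image: "R Z u \<in> disk_V k' Y" if u: "u \<in> disk_V k Z" for u
  proof -
    obtain w where "w \<in> B" "u = vert Z w"
      using disk_V_finite_rep[OF mZ, of k] u unfolding B_def[symmetric] by blast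
    then show ?thesis using k' p unfolding disk_V_def by auto
  qed
  obtain n' where n': "dom_restr F R k' Z \<subseteq> disk_V n' Z"
    "\<And>X w. X \<in> \<Y> \<Longrightarrow> disk n' X = disk n' Z \<Longrightarrow> w \<in> paths (disk n' Z) \<Longrightarrow>
       R X (vert X w) \<inter> paths (disk k' (F X)) = R Z (vert Z w) \<inter> paths (disk k' (F Z))"
    using continuity[OF Z(1), of k'] by metis
  \<comment> \<open>The preimages have to share both the disk on which continuity of
    \<open>R\<close> is used and the disk in which the values of \<open>S\<close> are
    compared.\<close>
  define N where "N = max n' k"
  obtain n0 where n0: "\<And>Y'. Y' \<in> \<Y> \<Longrightarrow> disk n0 Y' = disk n0 Y \<Longrightarrow> disk N (F' Y') = disk N Z"
    using inverse_disk_continuous[OF Y, of N] unfolding Z_def by metis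
  define n where "n = max n0 k'"
  have main: "disk k (F' Y') = disk k Z \<and> dom_restr F' S k Y' \<subseteq> disk_V n Y' \<and>
      (\<forall>w\<in>paths (disk n Y).
         S Y' (vert Y' w) \<inter> paths (disk k (F' Y')) = S Y (vert Y w) \<inter> paths (disk k Z))"
    if Y': "Y' \<in> \<Y>" "disk n Y' = disk n Y" for Y'
  proof -
    let ?Z = "F' Y'"
    have mY': "Y' \<in> mods" using Y_mods Y'(1) .
    have Z': "?Z \<in> \<Y>" "F ?Z = Y'" using F'_Y F_F' Y'(1) by simp_all
    note mZ' = Y_mods[OF Z'(1)]
    have "disk n0 Y' = disk n0 Y" using disk_eq_mono[OF mY' mY Y'(2)] by (simp add: n_def)
    then have N: "disk N ?Z = disk N Z" using n0 Y'(1) by blast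
    have dk: "disk k ?Z = disk k Z" and dn': "disk n' ?Z = disk n' Z"
      using disk_eq_mono[OF mZ' mZ N] by (simp_all add: N_def)
    have dk': "disk k' Y' = disk k' Y" using disk_eq_mono[OF mY' mY Y'(2)] by (simp add: n_def)
    have image': "\<exists>q \<in> paths (disk k' Y). R Z (vert Z w) = vert Y q \<and> R ?Z (vert ?Z w) = vert Y' q"
      if w: "w \<in> paths (disk k Z)" for w
    proof -
      have wZ: "w \<in> paths Z" "w \<in> paths ?Z"
        using w paths_disk_subset[OF mZ] paths_disk_subset[OF mZ', of k] dk by auto
      obtain q where q: "q \<in> paths (disk k' Y)" "R Z (vert Z w) = vert Y q"
        using image[of "vert Z w"] w unfolding disk_V_def by blast
      have qY: "q \<in> paths Y" "q \<in> paths Y'"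
        using q(1) paths_disk_subset[OF mY] paths_disk_subset[OF mY', of k'] dk' by auto
      \<comment> \<open>The path \<open>w\<close> lies in \<open>disk k Z\<close>, which may reach
        beyond \<open>disk n' Z\<close>. The domain clause of continuity supplies a path
        \<open>w'\<close> to the same vertex inside \<open>disk n' Z\<close>, and both paths lie in
        \<open>disk N Z\<close>, so they also meet in \<open>?Z\<close>.\<close>
      have "vert Z w \<in> dom_restr F R k' Z"
        using image[of "vert Z w"] w vert_in_V[OF wZ(1)] Z(2) unfolding dom_restr_def disk_V_def by blast
      then obtain w' where w': "w' \<in> paths (disk n' Z)" "vert Z w = vert Z w'"
        using n'(1) unfolding disk_V_def by blast
      have "vert ?Z w = vert ?Z w'"
        using vert_eq_disk_cong[OF mZ mZ' N[symmetric], of w w'] w w'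
          paths_disk_mono[OF mZ, of k N] paths_disk_mono[OF mZ, of n' N] unfolding N_def by auto
      moreover have "R ?Z (vert ?Z w') \<inter> paths (disk k' Y) = R Z (vert Z w') \<inter> paths (disk k' Y)"
        using n'(2)[OF Z'(1) dn' w'(1)] Z'(2) Z(2) dk' by simp
      \<comment> \<open>Continuity equates only the parts of the two vertices inside
        \<open>disk k' Y\<close>, but a single common path already identifies a vertex.\<close>
      ultimately have "q \<in> R ?Z (vert ?Z w)"
        using q vert_refl[OF mY qY(1)] w'(2) by auto
      then have "R ?Z (vert ?Z w) = vert Y' q"
        using V_mem_iff[OF mY' _ qY(2)] R_V[OF Z'(1) vert_in_V[OF wZ(2)]] Z'(2) by auto
      with q show ?thesis by blast
    qed
    \<comment> \<open>Turns membership of a path in a value of \<open>S\<close> into an equation for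
      \<open>R\<close>, to which \<open>image'\<close> applies.\<close>
    have S_iff: "w \<in> S X u \<longleftrightarrow> u = R (F' X) (vert (F' X) w)"
      if "X \<in> \<Y>" "u \<in> V X" "w \<in> paths (F' X)" for X u w
      using V_mem_iff[OF Y_mods[OF F'_Y[OF that(1)]] S_V[OF that(1,2)] that(3)]
        R_S[OF that(1,2)] S_R[OF that(1) vert_in_V[OF that(3)]] by auto
    have "dom_restr F' S k Y' \<subseteq> disk_V n Y'"
    proof
      fix u assume "u \<in> dom_restr F' S k Y'"
      then obtain w where u: "u \<in> V Y'" and w: "w \<in> paths (disk k Z)" "S Y' u = vert ?Z w"
        unfolding dom_restr_def disk_V_def using dk by auto
      have "u = R ?Z (vert ?Z w)" using R_S[OF Y'(1) u] w(2) by simp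
      moreover obtain q where "q \<in> paths (disk k' Y)" "R ?Z (vert ?Z w) = vert Y' q"
        using image'[OF w(1)] by blast
      moreover have "paths (disk k' Y) \<subseteq> paths (disk n Y')"
        using paths_disk_mono[OF mY', of k' n] dk' by (simp add: n_def)
      ultimately show "u \<in> disk_V n Y'" unfolding disk_V_def by blast
    qed
    moreover have "S Y' (vert Y' p) \<inter> paths (disk k ?Z) = S Y (vert Y p) \<inter> paths (disk k Z)"
      if p: "p \<in> paths (disk n Y)" for p
    proof -
      have pY: "p \<in> paths Y" "p \<in> paths Y'"
        using p paths_disk_subset[OF mY] paths_disk_subset[OF mY', of n] Y'(2) by auto
      have "w \<in> S Y' (vert Y' p) \<longleftrightarrow> w \<in> S Y (vert Y p)" if w: "w \<in> paths (disk k Z)" for w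
      proof -
        have wZ: "w \<in> paths (F' Y)" "w \<in> paths ?Z"
          using w paths_disk_subset[OF mZ] paths_disk_subset[OF mZ', of k] dk by (auto simp: Z_def)
        obtain q where q: "q \<in> paths (disk k' Y)" "R Z (vert Z w) = vert Y q"
          "R ?Z (vert ?Z w) = vert Y' q"
          using image'[OF w] by blast
        have "q \<in> paths (disk n Y)"
          using q(1) paths_disk_mono[OF mY, of k' n] by (auto simp: n_def)
        then have "vert Y p = vert Y q \<longleftrightarrow> vert Y' p = vert Y' q"
          using vert_eq_disk_cong[OF mY mY' Y'(2)[symmetric] p] by blast
        then show ?thesis
          using S_iff[OF Y vert_in_V[OF pY(1)] wZ(1)] S_iff[OF Y'(1) vert_in_V[OF pY(2)] wZ(2)] q(2,3)
          by (simp add: Z_def)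
      qed
      then show ?thesis using dk by auto
    qed
    ultimately show ?thesis using dk by blast
  qed
  show "\<exists>n. dom_restr F' S k Y \<subseteq> disk_V n Y \<and>
        (\<forall>Y'\<in>\<Y>. disk n Y' = disk n Y \<longrightarrow>
           disk k (F' Y') = disk k (F' Y) \<and> dom_restr F' S k Y' \<subseteq> disk_V n Y' \<and>
           (\<forall>w\<in>paths (disk n Y).
              S Y' (vert Y' w) \<inter> paths (disk k (F' Y')) = S Y (vert Y w) \<inter> paths (disk k (F' Y))))"
    using main main[OF Y refl] unfolding Z_def by blast
qed

lemma inverse_IMCGD: "IMCGD \<Sigma> \<Delta> \<pi> \<mu> m l r F' S"
  unfolding IMCGD_def CGD_def
  using inverse_dynamics inverse_continuous inverse_shift_invariant inverse_bounded
    inverse_vertex_preserving inverse_quiescent by blast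

end

theorem theorem4:
  fixes \<Sigma> :: "'s set" and \<Delta> :: "'d set" and \<pi> :: "'p set"
    and \<mu> :: 's and m l r :: 'p
    and F :: "('p, 's, 'd) graph_mod \<Rightarrow> ('p, 's, 'd) graph_mod"
    and R :: "('p, 's, 'd) graph_mod \<Rightarrow> 'p vertex \<Rightarrow> 'p vertex"
  defines "\<Y> \<equiv> im_graphs \<Sigma> \<Delta> \<pi> \<mu> m l r"
  defines "F' \<equiv> inv_into \<Y> F"
  defines "S \<equiv> \<lambda>Y. inv_into (V (F' Y)) (R (F' Y))"
  assumes "finite \<Sigma>" and "finite \<Delta>" and "finite \<pi>"
    and "\<mu> \<notin> \<Sigma>" and "m \<notin> \<pi>" and "l \<notin> \<pi>" and "r \<notin> \<pi>" and "distinct [m, l, r]"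
    and "IMCGD \<Sigma> \<Delta> \<pi> \<mu> m l r F R"
    and "bij_betw F \<Y> \<Y>"
  shows "IMCGD \<Sigma> \<Delta> \<pi> \<mu> m l r F' S"
proof -
  interpret invertible_IMCGD \<Sigma> \<Delta> \<pi> \<mu> m l r F R
    using assms by unfold_locales auto
  have "invertible_IMCGD.F' \<Sigma> \<Delta> \<pi> \<mu> m l r F = F'"
    unfolding F'_def assms(1,2) ..
  moreover have "invertible_IMCGD.S \<Sigma> \<Delta> \<pi> \<mu> m l r F R = S"
    unfolding S_def assms(3) calculation by (rule ext) (simp add: S_def)
  ultimately show ?thesis using inverse_IMCGD by simp
qed

end
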